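(* Let $G=(V,E)$ be a finite directed graph. There exists a Cuntz-Krieger family $\mathrm{S}=(S_v,S_e)_{v\in V,e\in E}$ for $G$ with $S_v\neq 0$ for all $v\in V$ whose free semigroupoid algebra $\mathfrak{S}$ is self-adjoint if and only if $G$ is a (disjoint) union of transitive components. Furthermore, if $G$ is transitive and not a cycle, then $B(\mathcal{H})$ is a free semigroupoid algebra for $G$, where $\mathcal{H}$ is a separable infinite dimensional Hilbert space; that is, there is a Toeplitz-Cuntz-Krieger family for $G$ on $\mathcal{H}$ whose generated WOT-closed algebra is $B(\mathcal{H})$.
   Context: A directed graph $G=(V,E,r,s)$ has range and source maps $r,s:E\to V$; it is finite if $V$ and $E$ are finite. A family $\mathrm{S}=(S_v,S_e)_{v\in V,e\in E}$ of operators on a Hilbert space $\mathcal{H}$ is a Toeplitz-Cuntz-Krieger (TCK) family if: the $S_v$ are pairwise orthogonal projections; $S_e^*S_e=S_{s(e)}$ for each $e\in E$; $\sum_{e\in F}S_eS_e^*\le S_v$ for every finite $F\subseteq r^{-1}(v)$. It is a Cuntz-Krieger (CK) family if moreover $\sum_{e\in r^{-1}(v)}S_eS_e^*=S_v$ whenever $0<|r^{-1}(v)|<\infty$. Throughout, all TCK families are assumed nondegenerate: $\mathrm{SOT}\text{-}\sum_{v\in V}S_v=I_{\mathcal{H}}$. The free semigroupoid algebra $\mathfrak{S}$ of $\mathrm{S}$ is the WOT-closed algebra generated by $\{S_v,S_e\}$. A path $e_1\cdots e_n$ satisfies $s(e_i)=r(e_{i+1})$; $G$ is transitive if there is a path between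 any vertex and any other. "$G$ is a cycle" means $G$ is the $n$-cycle graph for some $n\ge1$ (vertices $v_1,\dots,v_n$ and exactly one edge from $v_i$ to $v_{i+1}$, indices mod $n$). A transitive component is a maximal transitive induced subgraph; "union of transitive components" means $G$ is a disjoint union of transitive subgraphs with no edges between them.
   Formalization: In the second part, transitive means nonempty with a path of positive length between any two vertices (also from a vertex to itself), excluding the empty graph and the single edgeless vertex, where the claim fails; Hilbert spaces are taken as l2(I), which is general up to unitary equivalence. *)

theory Defs
  imports "HOL-Analysis.Analysis"
begin

text \<open>Hilbert spaces are modelled concretely as l2(I) for an index set I
  (every complex Hilbert space is unitarily equivalent to one of these).
  Vectors are functions 'i => complex vanishing outside I; operators are maps
  on such functions, only their behaviour on l2(I) matters.\<close>

type_synonym 'i vec = "'i \<Rightarrow> complex"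
type_synonym 'i op = "'i vec \<Rightarrow> 'i vec"

definition l2 :: "'i set \<Rightarrow> 'i vec set" where
  "l2 I = {x. (\<forall>i. i \<notin> I \<longrightarrow> x i = 0) \<and> (\<lambda>i. (cmod (x i))\<^sup>2) summable_on I}"

definition l2_inner :: "'i set \<Rightarrow> 'i vec \<Rightarrow> 'i vec \<Rightarrow> complex" where
  "l2_inner I x y = (\<Sum>\<^sub>\<infinity>i\<in>I. cnj (x i) * y i)"

definition l2_norm :: "'i set \<Rightarrow> 'i vec \<Rightarrow> real" where
  "l2_norm I x = sqrt (\<Sum>\<^sub>\<infinity>i\<in>I. (cmod (x i))\<^sup>2)"

text \<open>Bounded linear operators on l2(I).\<close>
definition bounded_op :: "'i set \<Rightarrow> 'i op \<Rightarrow> bool" where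
  "bounded_op I T \<longleftrightarrow>
     (\<forall>x\<in>l2 I. T x \<in> l2 I) \<and>
     (\<forall>x\<in>l2 I. \<forall>y\<in>l2 I. \<forall>a::complex. T (\<lambda>i. a * x i + y i) = (\<lambda>i. a * T x i + T y i)) \<and>
     (\<exists>C. \<forall>x\<in>l2 I. l2_norm I (T x) \<le> C * l2_norm I x)"

text \<open>A is the adjoint of T (on l2(I)).\<close>
definition is_adjoint :: "'i set \<Rightarrow> 'i op \<Rightarrow> 'i op \<Rightarrow> bool" where
  "is_adjoint I T A \<longleftrightarrow> bounded_op I T \<and> bounded_op I A \<and>
     (\<forall>x\<in>l2 I. \<forall>y\<in>l2 I. l2_inner I (T x) y = l2_inner I x (A y))"

definition is_projection :: "'i set \<Rightarrow> 'i op \<Rightarrow> bool" where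
  "is_projection I P \<longleftrightarrow> is_adjoint I P P \<and> (\<forall>x\<in>l2 I. P (P x) = P x)"

text \<open>Operator order A \<le> B: B - A is a positive operator.\<close>
definition op_le :: "'i set \<Rightarrow> 'i op \<Rightarrow> 'i op \<Rightarrow> bool" where
  "op_le I A B \<longleftrightarrow> (\<forall>x\<in>l2 I.
     Im (l2_inner I x (\<lambda>i. B x i - A x i)) = 0 \<and> Re (l2_inner I x (\<lambda>i. B x i - A x i)) \<ge> 0)"

section \<open>Directed graphs G = (V, E, r, s)\<close>

definition finite_graph :: "'v set \<Rightarrow> 'e set \<Rightarrow> ('e \<Rightarrow> 'v) \<Rightarrow> ('e \<Rightarrow> 'v) \<Rightarrow> bool" where
  "finite_graph V E r s \<longleftrightarrow> finite V \<and> finite E \<and> r ` E \<subseteq> V \<and> s ` E \<subseteq> V"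

text \<open>One-step relation of the subgraph induced on W: (s e, r e) for edges inside W.\<close>
definition edge_rel :: "'v set \<Rightarrow> 'e set \<Rightarrow> ('e \<Rightarrow> 'v) \<Rightarrow> ('e \<Rightarrow> 'v) \<Rightarrow> ('v \<times> 'v) set" where
  "edge_rel W E r s = {(s e, r e) | e. e \<in> E \<and> s e \<in> W \<and> r e \<in> W}"

text \<open>Induced subgraph on W is transitive: a path from any vertex to any other
  vertex (reflexive closure: a single vertex is trivially transitive).\<close>
definition transitive_on :: "'v set \<Rightarrow> 'e set \<Rightarrow> ('e \<Rightarrow> 'v) \<Rightarrow> ('e \<Rightarrow> 'v) \<Rightarrow> bool" where
  "transitive_on W E r s \<longleftrightarrow> (\<forall>v\<in>W. \<forall>w\<in>W. (v, w) \<in> (edge_rel W E r s)\<^sup>*)"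

text \<open>G is a disjoint union of transitive subgraphs with no edges between them.\<close>
definition union_of_transitive_components ::
  "'v set \<Rightarrow> 'e set \<Rightarrow> ('e \<Rightarrow> 'v) \<Rightarrow> ('e \<Rightarrow> 'v) \<Rightarrow> bool" where
  "union_of_transitive_components V E r s \<longleftrightarrow>
     (\<exists>P. \<Union>P = V \<and> {} \<notin> P \<and> (\<forall>W1\<in>P. \<forall>W2\<in>P. W1 \<noteq> W2 \<longrightarrow> W1 \<inter> W2 = {}) \<and>
          (\<forall>W\<in>P. transitive_on W E r s) \<and>
          (\<forall>e\<in>E. \<exists>W\<in>P. s e \<in> W \<and> r e \<in> W))"

text \<open>G transitive (nonempty, every vertex reaches every vertex by a path of
  positive length); used in the second part, see NOTES.\<close>
definition transitive_graph :: "'v set \<Rightarrow> 'e set \<Rightarrow> ('e \<Rightarrow> 'v) \<Rightarrow> ('e \<Rightarrow> 'v) \<Rightarrow> bool" where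
  "transitive_graph V E r s \<longleftrightarrow> V \<noteq> {} \<and> (\<forall>v\<in>V. \<forall>w\<in>V. (v, w) \<in> (edge_rel V E r s)\<^sup>+)"

text \<open>G is the n-cycle graph for some n \<ge> 1.\<close>
definition is_cycle :: "'v set \<Rightarrow> 'e set \<Rightarrow> ('e \<Rightarrow> 'v) \<Rightarrow> ('e \<Rightarrow> 'v) \<Rightarrow> bool" where
  "is_cycle V E r s \<longleftrightarrow> (\<exists>n f. n \<ge> 1 \<and> bij_betw f {..<n} V \<and>
      (\<forall>e\<in>E. \<exists>i<n. s e = f i \<and> r e = f (Suc i mod n)) \<and>
      (\<forall>i<n. \<exists>!e. e \<in> E \<and> s e = f i \<and> r e = f (Suc i mod n)))"

section \<open>(Toeplitz-)Cuntz-Krieger families\<close>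

definition tck_family ::
  "'i set \<Rightarrow> 'v set \<Rightarrow> 'e set \<Rightarrow> ('e \<Rightarrow> 'v) \<Rightarrow> ('e \<Rightarrow> 'v) \<Rightarrow> ('v \<Rightarrow> 'i op) \<Rightarrow> ('e \<Rightarrow> 'i op) \<Rightarrow> bool" where
  "tck_family I V E r s Sv Se \<longleftrightarrow>
     (\<forall>v\<in>V. is_projection I (Sv v)) \<and>
     (\<forall>v\<in>V. \<forall>w\<in>V. v \<noteq> w \<longrightarrow> (\<forall>x\<in>l2 I. Sv v (Sv w x) = (\<lambda>i. 0))) \<and>
     (\<forall>e\<in>E. \<exists>A. is_adjoint I (Se e) A \<and> (\<forall>x\<in>l2 I. A (Se e x) = Sv (s e) x)) \<and>
     (\<forall>v\<in>V. \<forall>F. finite F \<and> F \<subseteq> {e\<in>E. r e = v} \<longrightarrow>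
        (\<exists>A. (\<forall>e\<in>F. is_adjoint I (Se e) (A e)) \<and>
             op_le I (\<lambda>x i. \<Sum>e\<in>F. Se e (A e x) i) (Sv v))) \<and>
     (\<forall>x\<in>l2 I. (\<lambda>i. \<Sum>v\<in>V. Sv v x i) = x)"

definition ck_family ::
  "'i set \<Rightarrow> 'v set \<Rightarrow> 'e set \<Rightarrow> ('e \<Rightarrow> 'v) \<Rightarrow> ('e \<Rightarrow> 'v) \<Rightarrow> ('v \<Rightarrow> 'i op) \<Rightarrow> ('e \<Rightarrow> 'i op) \<Rightarrow> bool" where
  "ck_family I V E r s Sv Se \<longleftrightarrow> tck_family I V E r s Sv Se \<and>
     (\<forall>v\<in>V. 0 < card {e\<in>E. r e = v} \<and> finite {e\<in>E. r e = v} \<longrightarrow>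
        (\<exists>A. (\<forall>e\<in>{e\<in>E. r e = v}. is_adjoint I (Se e) (A e)) \<and>
             (\<forall>x\<in>l2 I. (\<lambda>i. \<Sum>e\<in>{e\<in>E. r e = v}. Se e (A e x) i) = Sv v x)))"

section \<open>Free semigroupoid algebra\<close>

inductive_set alg_gen :: "'i op set \<Rightarrow> 'i op set" for Gs :: "'i op set" where
  gen: "T \<in> Gs \<Longrightarrow> T \<in> alg_gen Gs"
| add: "T \<in> alg_gen Gs \<Longrightarrow> U \<in> alg_gen Gs \<Longrightarrow> (\<lambda>x i. T x i + U x i) \<in> alg_gen Gs"
| smult: "T \<in> alg_gen Gs \<Longrightarrow> (\<lambda>x i. (a::complex) * T x i) \<in> alg_gen Gs"
| mult: "T \<in> alg_gen Gs \<Longrightarrow> U \<in> alg_gen Gs \<Longrightarrow> (\<lambda>x. T (U x)) \<in> alg_gen Gs"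

text \<open>WOT closure within the bounded operators on l2(I).\<close>
definition wot_closure :: "'i set \<Rightarrow> 'i op set \<Rightarrow> 'i op set" where
  "wot_closure I A = {T. bounded_op I T \<and>
     (\<forall>F. finite F \<and> F \<subseteq> l2 I \<times> l2 I \<longrightarrow> (\<forall>\<epsilon>>0. \<exists>B\<in>A.
        \<forall>(x, y)\<in>F. cmod (l2_inner I y (T x) - l2_inner I y (B x)) < \<epsilon>))}"

definition free_semigroupoid_alg ::
  "'i set \<Rightarrow> 'v set \<Rightarrow> 'e set \<Rightarrow> ('v \<Rightarrow> 'i op) \<Rightarrow> ('e \<Rightarrow> 'i op) \<Rightarrow> 'i op set" where
  "free_semigroupoid_alg I V E Sv Se = wot_closure I (alg_gen (Sv ` V \<union> Se ` E))"

definition self_adjoint_set :: "'i set \<Rightarrow> 'i op set \<Rightarrow> bool" where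
  "self_adjoint_set I A \<longleftrightarrow> (\<forall>T\<in>A. \<exists>T'\<in>A. is_adjoint I T T')"

end

theory Submission
  imports Defs "HOL-Library.Stream"
begin

text \<open>
  If the algebra is self-adjoint, then the adjoint of \<open>S\<^sub>e\<close> is a weak limit of polynomials, and its corner from
  the range to the source of \<open>e\<close> can only be non-zero if some path leads back; so every edge lies in a
  transitive component.

  Conversely, represent a component on the span of a tail-equivalence class of infinite paths, an edge acting
  by prepending itself. For a component in which all vertices have at most one incoming edge the vertex
  projections have rank one and nothing more is needed. Otherwise pick a vertex \<open>v\<close> with incoming edges
  \<open>e\<^sub>0 \<noteq> e\<^sub>1\<close>, completed to loops \<open>L\<^sub>0, L\<^sub>1\<close> that return to \<open>v\<close> only at the end, and compose the prepending operators
  with the reflections of the planes spanned by the pairs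
  \<open>P\<^sub>t = L\<^sub>0 L\<^sub>1\<^sup>t\<^sup>+\<^sup>1 L\<^sub>0 L\<^sub>0 Y\<^sub>t P\<^sub>0\<close> and \<open>Q\<^sub>t = L\<^sub>1 P\<^sub>t\<^sub>+\<^sub>1\<close>, where \<open>Y\<close> visits every closed path at \<open>v\<close> infinitely often.
  Then \<open>P\<^sub>t\<close> and \<open>Q\<^sub>t\<close> are, up to the factor \<open>1/\<surd>2\<close>, the sum and the difference of a word applied to an earlier or later
  special vector and of a word applied to \<open>P\<^sub>t\<^sub>+\<^sub>1\<close>. Iterating these relations from a prescribed
  vector in place of \<open>P\<^sub>t\<close> yields contractions in the algebra; their matrix entries are governed by a random
  walk that hits \<open>P\<^sub>t\<close> with probability one, while all other entries are at most \<open>2\<^sup>-\<^sup>m\<^sup>/\<^sup>2\<close> once \<open>P\<^sub>t\<close> is more than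
  \<open>m\<close> steps away. In the limit one obtains rank one operators, then all matrix units of the component.
\<close>

section \<open>Operators on l2 spaces\<close>

definition sqn :: "'i set \<Rightarrow> 'i vec \<Rightarrow> real" where
  "sqn I x = (\<Sum>\<^sub>\<infinity>i\<in>I. (cmod (x i))\<^sup>2)"

definition delta :: "'i \<Rightarrow> 'i vec" where
  "delta i = (\<lambda>k. if k = i then 1 else 0)"

lemma l2_outside: "x \<in> l2 I \<Longrightarrow> i \<notin> I \<Longrightarrow> x i = 0"
  by (simp add: l2_def)

lemma l2_summable: "x \<in> l2 I \<Longrightarrow> (\<lambda>i. (cmod (x i))\<^sup>2) summable_on I"
  by (simp add: l2_def)

lemma l2I:
  assumes "\<And>i. i \<notin> I \<Longrightarrow> x i = 0" "(\<lambda>i. (cmod (x i))\<^sup>2) summable_on I"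
  shows "x \<in> l2 I"
  using assms by (simp add: l2_def)

lemma l2_norm_sqn: "l2_norm I x = sqrt (sqn I x)"
  by (simp add: l2_norm_def sqn_def)

lemma sqn_nonneg [simp]: "0 \<le> sqn I x"
  unfolding sqn_def by (rule infsum_nonneg) simp

lemma l2_norm_nonneg [simp]: "0 \<le> l2_norm I x"
  by (simp add: l2_norm_sqn)

lemma l2_norm_power2: "(l2_norm I x)\<^sup>2 = sqn I x"
  by (simp add: l2_norm_sqn)

lemma l2_zero [simp]: "(\<lambda>i. 0) \<in> l2 I"
  by (simp add: l2_def)

lemma sqn_zero [simp]: "sqn I (\<lambda>i. 0) = 0"
  by (simp add: sqn_def)

lemma l2_scale:
  assumes "x \<in> l2 I" shows "(\<lambda>i. a * x i) \<in> l2 I"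
proof -
  have "(\<lambda>i. (cmod (a * x i))\<^sup>2) = (\<lambda>i. (cmod a)\<^sup>2 * (cmod (x i))\<^sup>2)"
    by (simp add: norm_mult power_mult_distrib)
  then show ?thesis
    using assms by (auto simp: l2_def intro: summable_on_cmult_right)
qed

lemma sqn_scale: "sqn I (\<lambda>i. a * x i) = (cmod a)\<^sup>2 * sqn I x"
  unfolding sqn_def by (simp add: norm_mult power_mult_distrib infsum_cmult_right')

lemma cmod_add_square_le: "(cmod (a + b))\<^sup>2 \<le> 2 * (cmod a)\<^sup>2 + 2 * (cmod b)\<^sup>2"
proof -
  have "(cmod (a + b))\<^sup>2 \<le> (cmod a + cmod b)\<^sup>2"
    by (simp add: norm_triangle_ineq)
  also have "\<dots> \<le> 2 * (cmod a)\<^sup>2 + 2 * (cmod b)\<^sup>2"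
    using sum_squares_ge_zero[of "cmod a - cmod b" 0] by (simp add: power2_eq_square algebra_simps)
  finally show ?thesis .
qed

lemma summable_on_mono_nonneg:
  fixes f g :: "'i \<Rightarrow> real"
  assumes "g summable_on I" "\<And>i. i \<in> I \<Longrightarrow> 0 \<le> f i" "\<And>i. i \<in> I \<Longrightarrow> f i \<le> g i"
  shows "f summable_on I"
proof (rule abs_summable_summable)
  show "(\<lambda>i. norm (f i)) summable_on I"
    by (rule Infinite_Sum.abs_summable_on_comparison_test'[OF assms(1)]) (use assms in auto)
qed

lemma l2_add:
  assumes "x \<in> l2 I" "y \<in> l2 I" shows "(\<lambda>i. x i + y i) \<in> l2 I"
proof (rule l2I)
  show "(\<lambda>i. (cmod (x i + y i))\<^sup>2) summable_on I"
  proof (rule summable_on_mono_nonneg)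
    show "(\<lambda>i. 2 * (cmod (x i))\<^sup>2 + 2 * (cmod (y i))\<^sup>2) summable_on I"
      using assms by (intro summable_on_add summable_on_cmult_right l2_summable)
  qed (auto simp: cmod_add_square_le)
qed (use assms in \<open>simp add: l2_outside[of x I] l2_outside[of y I]\<close>)

lemma sqn_add_le:
  assumes "x \<in> l2 I" "y \<in> l2 I"
  shows "sqn I (\<lambda>i. x i + y i) \<le> 2 * sqn I x + 2 * sqn I y"
proof -
  note x = l2_summable[OF assms(1)] and y = l2_summable[OF assms(2)]
  have s: "(\<lambda>i. 2 * (cmod (x i))\<^sup>2) summable_on I" "(\<lambda>i. 2 * (cmod (y i))\<^sup>2) summable_on I"
    by (intro summable_on_cmult_right x y)+
  have "sqn I (\<lambda>i. x i + y i) \<le> (\<Sum>\<^sub>\<infinity>i\<in>I. 2 * (cmod (x i))\<^sup>2 + 2 * (cmod (y i))\<^sup>2)"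
    unfolding sqn_def
    by (rule infsum_mono[OF l2_summable[OF l2_add[OF assms]] summable_on_add[OF s]])
       (rule cmod_add_square_le)
  also have "\<dots> = 2 * sqn I x + 2 * sqn I y"
    unfolding sqn_def by (subst infsum_add[OF s]) (simp add: infsum_cmult_right')
  finally show ?thesis .
qed

lemma l2_lincomb:
  assumes "x \<in> l2 I" "y \<in> l2 I" shows "(\<lambda>i. a * x i + y i) \<in> l2 I"
  using l2_add[OF l2_scale[OF assms(1)] assms(2)] .

lemma l2_uminus: "x \<in> l2 I \<Longrightarrow> (\<lambda>i. - x i) \<in> l2 I"
  using l2_scale[of x I "-1"] by simp

lemma l2_diff: "x \<in> l2 I \<Longrightarrow> y \<in> l2 I \<Longrightarrow> (\<lambda>i. x i - y i) \<in> l2 I"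
  using l2_add[OF _ l2_uminus, of x I y] by simp

lemma l2_sum: "(\<And>k. k \<in> K \<Longrightarrow> x k \<in> l2 I) \<Longrightarrow> (\<lambda>i. \<Sum>k\<in>K. x k i) \<in> l2 I"
proof (induction K rule: infinite_finite_induct)
  case (insert k K)
  then show ?case using l2_add[of "x k" I "\<lambda>i. \<Sum>k\<in>K. x k i"] by simp
qed auto

lemma delta_l2 [simp]: "i \<in> I \<Longrightarrow> delta i \<in> l2 I"
proof (rule l2I)
  assume "i \<in> I"
  have "(\<lambda>k. (cmod (delta i k))\<^sup>2) summable_on I \<longleftrightarrow> (\<lambda>k. (cmod (delta i k))\<^sup>2) summable_on {i}"
    by (rule summable_on_cong_neutral) (use \<open>i \<in> I\<close> in \<open>auto simp: delta_def\<close>)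
  then show "(\<lambda>k. (cmod (delta i k))\<^sup>2) summable_on I" by simp
qed (auto simp: delta_def)

lemma delta_simps [simp]: "delta i i = 1" "j \<noteq> i \<Longrightarrow> delta i j = 0"
  by (auto simp: delta_def)

lemma sqn_delta [simp]: "i \<in> I \<Longrightarrow> sqn I (delta i) = 1"
proof -
  assume "i \<in> I"
  have "sqn I (delta i) = (\<Sum>\<^sub>\<infinity>k\<in>{i}. (cmod (delta i k))\<^sup>2)"
    unfolding sqn_def by (rule infsum_cong_neutral) (use \<open>i \<in> I\<close> in \<open>auto simp: delta_def\<close>)
  then show ?thesis by simp
qed

lemma cmod_le_sqn:
  assumes "x \<in> l2 I" "i \<in> I" shows "(cmod (x i))\<^sup>2 \<le> sqn I x"
  unfolding sqn_def
  using finite_sum_le_infsum[of "\<lambda>i. (cmod (x i))\<^sup>2" I "{i}"] assms by (auto simp: l2_summable)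

lemma cmod_le_l2_norm:
  assumes "x \<in> l2 I" shows "cmod (x i) \<le> l2_norm I x"
proof (cases "i \<in> I")
  case True
  have "(cmod (x i))\<^sup>2 \<le> (l2_norm I x)\<^sup>2"
    using cmod_le_sqn[OF assms True] by (simp add: l2_norm_power2)
  then show ?thesis by (rule power2_le_imp_le) simp
qed (simp add: l2_outside[OF assms])

lemma sqn_eq_0D:
  assumes "x \<in> l2 I" "sqn I x = 0" shows "x = (\<lambda>i. 0)"
proof
  fix i show "x i = 0"
    using cmod_le_sqn[OF assms(1), of i] assms l2_outside[OF assms(1), of i]
    by (cases "i \<in> I") auto
qed

lemma inner_summable:
  assumes "x \<in> l2 I" "y \<in> l2 I"
  shows "(\<lambda>i. cnj (x i) * y i) summable_on I"
proof -
  have "(\<lambda>i. norm (cnj (x i) * y i)) summable_on I"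
    by (rule abs_summable_product)
       (use assms in \<open>auto simp: l2_def power2_eq_square norm_mult\<close>)
  then show ?thesis by (rule abs_summable_summable)
qed

lemma inner_add_right:
  assumes "x \<in> l2 I" "y \<in> l2 I" "z \<in> l2 I"
  shows "l2_inner I x (\<lambda>i. y i + z i) = l2_inner I x y + l2_inner I x z"
  unfolding l2_inner_def
  using infsum_add[OF inner_summable[OF assms(1,2)] inner_summable[OF assms(1,3)]]
  by (simp add: algebra_simps)

lemma inner_scale_right: "l2_inner I x (\<lambda>i. a * y i) = a * l2_inner I x y"
  unfolding l2_inner_def
  by (subst infsum_cmult_right'[symmetric]) (simp add: algebra_simps)

lemma inner_cnj: "l2_inner I y x = cnj (l2_inner I x y)"
  unfolding l2_inner_def by (subst infsum_cnj[symmetric]) (simp add: mult.commute del: infsum_cnj)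

lemma inner_add_left:
  assumes "x \<in> l2 I" "y \<in> l2 I" "z \<in> l2 I"
  shows "l2_inner I (\<lambda>i. y i + z i) x = l2_inner I y x + l2_inner I z x"
  by (subst (1 2 3) inner_cnj) (simp add: inner_add_right assms)

lemma inner_scale_left: "l2_inner I (\<lambda>i. a * y i) x = cnj a * l2_inner I y x"
  by (subst (1 2) inner_cnj) (simp add: inner_scale_right)

lemma inner_diff_right:
  assumes "x \<in> l2 I" "y \<in> l2 I" "z \<in> l2 I"
  shows "l2_inner I x (\<lambda>i. y i - z i) = l2_inner I x y - l2_inner I x z"
  using inner_add_right[OF assms(1,2) l2_uminus[OF assms(3)]] inner_scale_right[of I x "-1" z]
  by simp

lemma inner_diff_left:
  assumes "x \<in> l2 I" "y \<in> l2 I" "z \<in> l2 I"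
  shows "l2_inner I (\<lambda>i. y i - z i) x = l2_inner I y x - l2_inner I z x"
  by (subst (1 2 3) inner_cnj) (simp add: inner_diff_right assms)

lemma inner_zero_right [simp]: "l2_inner I x (\<lambda>i. 0) = 0"
  by (simp add: l2_inner_def)

lemma inner_zero_left [simp]: "l2_inner I (\<lambda>i. 0) x = 0"
  by (simp add: l2_inner_def)

lemma inner_sum_right:
  assumes "x \<in> l2 I" "\<And>k. k \<in> K \<Longrightarrow> y k \<in> l2 I"
  shows "l2_inner I x (\<lambda>i. \<Sum>k\<in>K. y k i) = (\<Sum>k\<in>K. l2_inner I x (y k))"
  using assms(2)
proof (induction K rule: infinite_finite_induct)
  case (insert k K)
  then show ?case
    using inner_add_right[OF assms(1), of "y k" "\<lambda>i. \<Sum>k\<in>K. y k i"] by (simp add: l2_sum)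
qed auto

lemma inner_sum_left:
  assumes "x \<in> l2 I" "\<And>k. k \<in> K \<Longrightarrow> y k \<in> l2 I"
  shows "l2_inner I (\<lambda>i. \<Sum>k\<in>K. y k i) x = (\<Sum>k\<in>K. l2_inner I (y k) x)"
  by (subst inner_cnj) (simp add: inner_sum_right assms flip: inner_cnj)

lemma inner_self: "x \<in> l2 I \<Longrightarrow> l2_inner I x x = of_real (sqn I x)"
proof -
  assume "x \<in> l2 I"
  have "l2_inner I x x = (\<Sum>\<^sub>\<infinity>i\<in>I. of_real ((cmod (x i))\<^sup>2))"
    unfolding l2_inner_def by (simp add: complex_norm_square mult.commute del: of_real_power)
  also have "\<dots> = of_real (sqn I x)"
    unfolding sqn_def
    by (rule infsumI, rule has_sum_of_real, rule has_sum_infsum, rule l2_summable) fact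
  finally show ?thesis .
qed

lemma inner_delta_left: "i \<in> I \<Longrightarrow> l2_inner I (delta i) y = y i"
proof -
  assume "i \<in> I"
  have "l2_inner I (delta i) y = (\<Sum>\<^sub>\<infinity>k\<in>{i}. cnj (delta i k) * y k)"
    unfolding l2_inner_def by (rule infsum_cong_neutral) (use \<open>i \<in> I\<close> in \<open>auto simp: delta_def\<close>)
  then show ?thesis by simp
qed

lemma inner_delta_right: "i \<in> I \<Longrightarrow> l2_inner I y (delta i) = cnj (y i)"
  by (subst inner_cnj) (simp add: inner_delta_left)

lemma sqn_add:
  assumes "x \<in> l2 I" "y \<in> l2 I"
  shows "sqn I (\<lambda>i. x i + y i) = sqn I x + sqn I y + 2 * Re (l2_inner I x y)"
proof -
  have "complex_of_real (sqn I (\<lambda>i. x i + y i))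
      = of_real (sqn I x) + of_real (sqn I y) + (l2_inner I x y + cnj (l2_inner I x y))"
    using assms
    by (simp add: inner_self[symmetric] inner_cnj[symmetric] inner_add_left inner_add_right l2_add)
  also have "\<dots> = of_real (sqn I x + sqn I y + 2 * Re (l2_inner I x y))"
    by (simp add: complex_add_cnj)
  finally show ?thesis by (simp only: of_real_eq_iff)
qed

lemma cauchy_schwarz:
  assumes x: "x \<in> l2 I" and y: "y \<in> l2 I"
  shows "cmod (l2_inner I x y) \<le> l2_norm I x * l2_norm I y"
proof (cases "sqn I y = 0")
  case True
  then show ?thesis using sqn_eq_0D[OF y] by simp
next
  case False
  then have pos: "sqn I y > 0" using sqn_nonneg[of I y] by linarith
  define p where "p = l2_inner I x y"
  define b where "b = - cnj p / of_real (sqn I y)"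
  have bp: "b * p = of_real (- (cmod p)\<^sup>2 / sqn I y)"
    using complex_norm_square[of p] by (simp add: b_def mult.commute)
  have "0 \<le> sqn I (\<lambda>i. x i + b * y i)" by simp
  also have "\<dots> = sqn I x + (cmod b)\<^sup>2 * sqn I y + 2 * Re (b * p)"
    unfolding p_def by (simp only: sqn_add[OF x l2_scale[OF y]] sqn_scale inner_scale_right)
  also have "(cmod b)\<^sup>2 * sqn I y = (cmod p)\<^sup>2 / sqn I y"
    using pos by (simp add: b_def norm_divide power2_eq_square)
  also have "Re (b * p) = - (cmod p)\<^sup>2 / sqn I y"
    unfolding bp by simp
  finally have "(cmod p)\<^sup>2 / sqn I y \<le> sqn I x" by simp
  then have "(cmod p)\<^sup>2 \<le> sqn I x * sqn I y"
    using pos by (simp add: pos_divide_le_eq)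
  then have "(cmod p)\<^sup>2 \<le> (l2_norm I x * l2_norm I y)\<^sup>2"
    by (simp only: power_mult_distrib l2_norm_power2)
  then have "cmod p \<le> l2_norm I x * l2_norm I y"
    by (rule power2_le_imp_le) simp
  then show ?thesis by (simp only: p_def)
qed

definition restr :: "'i set \<Rightarrow> 'i vec \<Rightarrow> 'i vec" where
  "restr D x = (\<lambda>i. if i \<in> D then x i else 0)"

lemma restr_l2: "x \<in> l2 I \<Longrightarrow> restr D x \<in> l2 I"
proof (rule l2I)
  assume x: "x \<in> l2 I"
  show "(\<lambda>i. (cmod (restr D x i))\<^sup>2) summable_on I"
    by (rule summable_on_mono_nonneg[OF l2_summable[OF x]]) (auto simp: restr_def)
qed (auto simp: restr_def l2_outside)

lemma restr_finite: "finite D \<Longrightarrow> restr D x = (\<lambda>i. \<Sum>k\<in>D. x k * delta k i)"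
  by (auto simp: restr_def delta_def fun_eq_iff if_distrib cong: if_cong)

lemma l2_tail:
  assumes x: "x \<in> l2 I" and "\<epsilon> > 0"
  shows "\<exists>D. finite D \<and> D \<subseteq> I \<and>
    (\<forall>D'. D \<subseteq> D' \<longrightarrow> l2_norm I (\<lambda>i. x i - restr D' x i) < \<epsilon>)"
proof -
  have "0 < \<epsilon>\<^sup>2 / 2" using \<open>\<epsilon> > 0\<close> by simp
  from infsum_finite_approximation[OF l2_summable[OF x] this]
  obtain D where D: "finite D" "D \<subseteq> I"
    and d: "dist (sum (\<lambda>i. (cmod (x i))\<^sup>2) D) (sqn I x) \<le> \<epsilon>\<^sup>2 / 2"
    unfolding sqn_def by (elim exE conjE)
  have "l2_norm I (\<lambda>i. x i - restr D' x i) < \<epsilon>" if "D \<subseteq> D'" for D'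
  proof -
    have "sqn I (\<lambda>i. x i - restr D' x i) \<le> (\<Sum>\<^sub>\<infinity>i\<in>I - D. (cmod (x i))\<^sup>2)"
      unfolding sqn_def
    proof (rule infsum_mono_neutral)
      show "(\<lambda>i. (cmod (x i - restr D' x i))\<^sup>2) summable_on I"
        by (rule l2_summable[OF l2_diff[OF x restr_l2[OF x]]])
      show "(\<lambda>i. (cmod (x i))\<^sup>2) summable_on I - D"
        using l2_summable[OF x] by (rule summable_on_subset_banach) auto
    qed (use that in \<open>auto simp: restr_def\<close>)
    also have "\<dots> = sqn I x - sum (\<lambda>i. (cmod (x i))\<^sup>2) D"
      unfolding sqn_def using D by (subst infsum_Diff[OF l2_summable[OF x]]) auto
    also have "\<dots> \<le> \<epsilon>\<^sup>2 / 2" using d unfolding dist_real_def by linarith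
    also have "\<dots> < \<epsilon>\<^sup>2" using \<open>\<epsilon> > 0\<close> by simp
    finally have "(l2_norm I (\<lambda>i. x i - restr D' x i))\<^sup>2 < \<epsilon>\<^sup>2"
      by (simp only: l2_norm_power2)
    then show ?thesis
      by (rule power2_less_imp_less) (use \<open>\<epsilon> > 0\<close> in simp)
  qed
  with D show ?thesis by blast
qed

lemma bounded_op_l2: "bounded_op I T \<Longrightarrow> x \<in> l2 I \<Longrightarrow> T x \<in> l2 I"
  by (simp add: bounded_op_def)

lemma bounded_op_lincomb:
  "bounded_op I T \<Longrightarrow> x \<in> l2 I \<Longrightarrow> y \<in> l2 I \<Longrightarrow>
    T (\<lambda>i. a * x i + y i) = (\<lambda>i. a * T x i + T y i)"
  by (simp add: bounded_op_def)

lemma bounded_op_bound: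
  assumes "bounded_op I T"
  obtains C where "C \<ge> 0" "\<And>x. x \<in> l2 I \<Longrightarrow> l2_norm I (T x) \<le> C * l2_norm I x"
proof -
  have "\<exists>C. \<forall>x\<in>l2 I. l2_norm I (T x) \<le> C * l2_norm I x"
    using assms by (simp add: bounded_op_def)
  then obtain C where C: "\<And>x. x \<in> l2 I \<Longrightarrow> l2_norm I (T x) \<le> C * l2_norm I x"
    by blast
  have "C * l2_norm I x \<le> max C 0 * l2_norm I x" for x
    by (rule mult_right_mono) auto
  with C show ?thesis using that[of "max C 0"] by (meson max.cobounded2 order_trans)
qed

lemma bounded_opI:
  assumes "\<And>x. x \<in> l2 I \<Longrightarrow> T x \<in> l2 I"
    and "\<And>x y a. x \<in> l2 I \<Longrightarrow> y \<in> l2 I \<Longrightarrow> T (\<lambda>i. a * x i + y i) = (\<lambda>i. a * T x i + T y i)"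
    and "\<And>x. x \<in> l2 I \<Longrightarrow> sqn I (T x) \<le> C * sqn I x"
  shows "bounded_op I T"
proof -
  have "l2_norm I (T x) \<le> sqrt C * l2_norm I x" if "x \<in> l2 I" for x
    using real_sqrt_le_mono[OF assms(3)[OF that]] by (simp only: l2_norm_sqn real_sqrt_mult)
  with assms show ?thesis unfolding bounded_op_def by blast
qed

lemma bounded_op_sqn:
  assumes "bounded_op I T"
  obtains C where "C \<ge> 0" "\<And>x. x \<in> l2 I \<Longrightarrow> sqn I (T x) \<le> C * sqn I x"
proof -
  obtain C where C: "C \<ge> 0" "\<And>x. x \<in> l2 I \<Longrightarrow> l2_norm I (T x) \<le> C * l2_norm I x"
    using bounded_op_bound[OF assms] by blast
  have "sqn I (T x) \<le> C\<^sup>2 * sqn I x" if "x \<in> l2 I" for x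
    using power_mono[OF C(2)[OF that], of 2] by (simp add: power_mult_distrib l2_norm_power2)
  then show ?thesis using that[of "C\<^sup>2"] by simp
qed

lemma bounded_op_zero: "bounded_op I T \<Longrightarrow> T (\<lambda>i. 0) = (\<lambda>i. 0)"
  using bounded_op_lincomb[of I T "\<lambda>i. 0" "\<lambda>i. 0" "-1"] by simp

lemma bounded_op_add_vec:
  "bounded_op I T \<Longrightarrow> x \<in> l2 I \<Longrightarrow> y \<in> l2 I \<Longrightarrow> T (\<lambda>i. x i + y i) = (\<lambda>i. T x i + T y i)"
  using bounded_op_lincomb[of I T x y 1] by simp

lemma bounded_op_scale_vec:
  "bounded_op I T \<Longrightarrow> x \<in> l2 I \<Longrightarrow> T (\<lambda>i. a * x i) = (\<lambda>i. a * T x i)"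
  using bounded_op_lincomb[of I T x "\<lambda>i. 0" a] by (simp add: bounded_op_zero)

lemma bounded_op_diff_vec:
  "bounded_op I T \<Longrightarrow> x \<in> l2 I \<Longrightarrow> y \<in> l2 I \<Longrightarrow> T (\<lambda>i. x i - y i) = (\<lambda>i. T x i - T y i)"
  using bounded_op_lincomb[of I T y x "-1"] by simp

lemma bounded_op_sum_vec:
  assumes "bounded_op I T" "\<And>k. k \<in> K \<Longrightarrow> x k \<in> l2 I"
  shows "T (\<lambda>i. \<Sum>k\<in>K. x k i) = (\<lambda>i. \<Sum>k\<in>K. T (x k) i)"
  using assms(2)
proof (induction K rule: infinite_finite_induct)
  case (insert k K)
  then show ?case
    using bounded_op_add_vec[OF assms(1), of "x k" "\<lambda>i. \<Sum>k\<in>K. x k i"] by (simp add: l2_sum)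
qed (auto simp: bounded_op_zero[OF assms(1)])

lemma bounded_op_add:
  assumes T: "bounded_op I T" and U: "bounded_op I U"
  shows "bounded_op I (\<lambda>x i. T x i + U x i)"
proof -
  obtain C where C: "C \<ge> 0" "\<And>x. x \<in> l2 I \<Longrightarrow> sqn I (T x) \<le> C * sqn I x"
    using bounded_op_sqn[OF T] by blast
  obtain D where D: "D \<ge> 0" "\<And>x. x \<in> l2 I \<Longrightarrow> sqn I (U x) \<le> D * sqn I x"
    using bounded_op_sqn[OF U] by blast
  show ?thesis
  proof (rule bounded_opI)
    fix x assume x: "x \<in> l2 I"
    show "sqn I (\<lambda>i. T x i + U x i) \<le> (2 * C + 2 * D) * sqn I x"
      using sqn_add_le[OF bounded_op_l2[OF T x] bounded_op_l2[OF U x]] C(2)[OF x] D(2)[OF x]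
      by (simp add: algebra_simps)
    show "(\<lambda>i. T x i + U x i) \<in> l2 I"
      by (rule l2_add[OF bounded_op_l2[OF T x] bounded_op_l2[OF U x]])
    fix y a assume y: "y \<in> l2 I"
    show "(\<lambda>i. T (\<lambda>i. a * x i + y i) i + U (\<lambda>i. a * x i + y i) i) =
        (\<lambda>i. a * (T x i + U x i) + (T y i + U y i))"
      unfolding bounded_op_lincomb[OF T x y] bounded_op_lincomb[OF U x y]
      by (simp add: algebra_simps)
  qed
qed

lemma bounded_op_scale:
  assumes T: "bounded_op I T" shows "bounded_op I (\<lambda>x i. a * T x i)"
proof -
  obtain C where C: "C \<ge> 0" "\<And>x. x \<in> l2 I \<Longrightarrow> sqn I (T x) \<le> C * sqn I x"
    using bounded_op_sqn[OF T] by blast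
  show ?thesis
  proof (rule bounded_opI)
    fix x assume x: "x \<in> l2 I"
    show "sqn I (\<lambda>i. a * T x i) \<le> ((cmod a)\<^sup>2 * C) * sqn I x"
      using mult_left_mono[OF C(2)[OF x], of "(cmod a)\<^sup>2"] by (simp add: sqn_scale mult.assoc)
    show "(\<lambda>i. a * T x i) \<in> l2 I"
      by (rule l2_scale[OF bounded_op_l2[OF T x]])
    fix y b assume y: "y \<in> l2 I"
    show "(\<lambda>i. a * T (\<lambda>i. b * x i + y i) i) = (\<lambda>i. b * (a * T x i) + a * T y i)"
      unfolding bounded_op_lincomb[OF T x y] by (simp add: algebra_simps)
  qed
qed

lemma bounded_op_comp:
  assumes T: "bounded_op I T" and U: "bounded_op I U" shows "bounded_op I (\<lambda>x. T (U x))"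
proof -
  obtain C where C: "C \<ge> 0" "\<And>x. x \<in> l2 I \<Longrightarrow> sqn I (T x) \<le> C * sqn I x"
    using bounded_op_sqn[OF T] by blast
  obtain D where D: "D \<ge> 0" "\<And>x. x \<in> l2 I \<Longrightarrow> sqn I (U x) \<le> D * sqn I x"
    using bounded_op_sqn[OF U] by blast
  show ?thesis
  proof (rule bounded_opI)
    fix x assume x: "x \<in> l2 I"
    show "sqn I (T (U x)) \<le> (C * D) * sqn I x"
      using C(2)[OF bounded_op_l2[OF U x]] mult_left_mono[OF D(2)[OF x] C(1)]
      by (simp add: mult.assoc)
    show "T (U x) \<in> l2 I"
      by (rule bounded_op_l2[OF T bounded_op_l2[OF U x]])
    fix y a assume y: "y \<in> l2 I"
    show "T (U (\<lambda>i. a * x i + y i)) = (\<lambda>i. a * T (U x) i + T (U y) i)"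
      unfolding bounded_op_lincomb[OF U x y]
      by (rule bounded_op_lincomb[OF T bounded_op_l2[OF U x] bounded_op_l2[OF U y]])
  qed
qed

lemma adjoint_bounded: "is_adjoint I T A \<Longrightarrow> bounded_op I T" "is_adjoint I T A \<Longrightarrow> bounded_op I A"
  by (simp_all add: is_adjoint_def)

lemma adjoint_inner:
  "is_adjoint I T A \<Longrightarrow> x \<in> l2 I \<Longrightarrow> y \<in> l2 I \<Longrightarrow> l2_inner I (T x) y = l2_inner I x (A y)"
  by (simp add: is_adjoint_def)

lemma adjoint_inner':
  assumes "is_adjoint I T A" "x \<in> l2 I" "y \<in> l2 I"
  shows "l2_inner I (A y) x = l2_inner I y (T x)"
  using inner_cnj[of I "A y" x] inner_cnj[of I y "T x"] adjoint_inner[OF assms] by simp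

lemma adjoint_add:
  assumes T: "is_adjoint I T A" and U: "is_adjoint I U B"
  shows "is_adjoint I (\<lambda>x i. T x i + U x i) (\<lambda>x i. A x i + B x i)"
  unfolding is_adjoint_def
proof (intro conjI ballI)
  note b = adjoint_bounded[OF T] adjoint_bounded[OF U]
  show "bounded_op I (\<lambda>x i. T x i + U x i)" "bounded_op I (\<lambda>x i. A x i + B x i)"
    by (intro bounded_op_add b)+
  fix x y assume x: "x \<in> l2 I" and y: "y \<in> l2 I"
  show "l2_inner I (\<lambda>i. T x i + U x i) y = l2_inner I x (\<lambda>i. A y i + B y i)"
    using b x y
    by (simp add: inner_add_left inner_add_right bounded_op_l2 adjoint_inner[OF T] adjoint_inner[OF U])
qed

lemma adjoint_scale:
  assumes T: "is_adjoint I T A"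
  shows "is_adjoint I (\<lambda>x i. a * T x i) (\<lambda>x i. cnj a * A x i)"
  unfolding is_adjoint_def
  by (intro conjI ballI bounded_op_scale adjoint_bounded[OF T])
     (simp add: inner_scale_left inner_scale_right adjoint_inner[OF T])

lemma adjoint_comp:
  assumes T: "is_adjoint I T A" and U: "is_adjoint I U B"
  shows "is_adjoint I (\<lambda>x. T (U x)) (\<lambda>x. B (A x))"
  unfolding is_adjoint_def
proof (intro conjI ballI)
  note b = adjoint_bounded[OF T] adjoint_bounded[OF U]
  show "bounded_op I (\<lambda>x. T (U x))" by (rule bounded_op_comp[OF b(1,3)])
  show "bounded_op I (\<lambda>x. B (A x))" by (rule bounded_op_comp[OF b(4,2)])
  fix x y assume x: "x \<in> l2 I" and y: "y \<in> l2 I"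
  show "l2_inner I (T (U x)) y = l2_inner I x (B (A y))"
    using adjoint_inner[OF T bounded_op_l2[OF b(3) x] y] adjoint_inner[OF U x bounded_op_l2[OF b(2) y]]
    by simp
qed

section \<open>Adjoints and weak operator closures\<close>

lemma restr_norm_le: "x \<in> l2 I \<Longrightarrow> l2_norm I (restr D x) \<le> l2_norm I x"
proof -
  assume x: "x \<in> l2 I"
  have "sqn I (restr D x) \<le> sqn I x"
    unfolding sqn_def
    by (rule infsum_mono[OF l2_summable[OF restr_l2[OF x]] l2_summable[OF x]]) (auto simp: restr_def)
  then show ?thesis by (simp add: l2_norm_sqn)
qed

lemma restr_sum_delta:
  "finite D \<Longrightarrow> D \<subseteq> I \<Longrightarrow> bounded_op I T \<Longrightarrow> T (restr D x) = (\<lambda>i. \<Sum>k\<in>D. x k * T (delta k) i)"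
  by (subst restr_finite, assumption, subst bounded_op_sum_vec)
     (auto simp: bounded_op_scale_vec subset_iff intro!: l2_scale)

lemma inner_lincomb_left:
  assumes "y \<in> l2 I" "\<And>k. k \<in> K \<Longrightarrow> v k \<in> l2 I"
  shows "l2_inner I (\<lambda>i. \<Sum>k\<in>K. a k * v k i) y = (\<Sum>k\<in>K. cnj (a k) * l2_inner I (v k) y)"
  by (subst inner_sum_left[OF assms(1)]) (simp_all add: l2_scale assms(2) inner_scale_left)

lemma inner_restr_left:
  "finite D \<Longrightarrow> D \<subseteq> I \<Longrightarrow> z \<in> l2 I \<Longrightarrow> l2_inner I (restr D y) z = (\<Sum>k\<in>D. cnj (y k) * z k)"
  by (subst restr_finite, assumption, subst inner_sum_left)
     (auto simp: inner_scale_left inner_delta_left subset_iff intro!: l2_scale)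

lemma sqn_restr: "finite D \<Longrightarrow> D \<subseteq> I \<Longrightarrow> sqn I (restr D x) = (\<Sum>k\<in>D. (cmod (x k))\<^sup>2)"
proof -
  assume "finite D" "D \<subseteq> I"
  then have "sqn I (restr D x) = (\<Sum>\<^sub>\<infinity>k\<in>D. (cmod (x k))\<^sup>2)"
    unfolding sqn_def by (intro infsum_cong_neutral) (auto simp: restr_def)
  with \<open>finite D\<close> show ?thesis by simp
qed

lemma adjoint_exists:
  assumes T: "bounded_op I T" shows "\<exists>A. is_adjoint I T A"
proof -
  obtain C where C: "C \<ge> 0" "\<And>x. x \<in> l2 I \<Longrightarrow> l2_norm I (T x) \<le> C * l2_norm I x"
    using bounded_op_bound[OF T] by blast
  define A where "A = (\<lambda>y i. if i \<in> I then l2_inner I (T (delta i)) y else 0)"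
  have Td: "T (delta k) \<in> l2 I" if "k \<in> I" for k
    by (rule bounded_op_l2[OF T delta_l2[OF that]])
  have fin: "(\<Sum>k\<in>D. (cmod (A y k))\<^sup>2) \<le> C\<^sup>2 * sqn I y"
    if "finite D" "D \<subseteq> I" and y: "y \<in> l2 I" for D y
  proof -
    define z where "z = restr D (A y)"
    define S where "S = (\<Sum>k\<in>D. (cmod (A y k))\<^sup>2)"
    have zeq: "z = (\<lambda>i. \<Sum>k\<in>D. A y k * delta k i)"
      unfolding z_def by (rule restr_finite) fact
    have z: "z \<in> l2 I"
      unfolding zeq by (intro l2_sum l2_scale delta_l2) (use that in auto)
    have "T z = (\<lambda>i. \<Sum>k\<in>D. A y k * T (delta k) i)"
      unfolding z_def by (rule restr_sum_delta) fact+
    then have "l2_inner I (T z) y = l2_inner I (\<lambda>i. \<Sum>k\<in>D. A y k * T (delta k) i) y"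
      by (rule arg_cong)
    also have "\<dots> = (\<Sum>k\<in>D. cnj (A y k) * l2_inner I (T (delta k)) y)"
      using Td \<open>D \<subseteq> I\<close> by (intro inner_lincomb_left y) auto
    also have "\<dots> = of_real S"
      unfolding S_def of_real_sum
    proof (rule sum.cong[OF refl])
      fix k assume "k \<in> D"
      then have "l2_inner I (T (delta k)) y = A y k" using \<open>D \<subseteq> I\<close> by (auto simp: A_def)
      then show "cnj (A y k) * l2_inner I (T (delta k)) y = of_real ((cmod (A y k))\<^sup>2)"
        using complex_norm_square[of "A y k"] by (simp only: mult.commute)
    qed
    finally have "l2_inner I (T z) y = of_real S" .
    moreover have "S \<ge> 0" by (simp add: S_def sum_nonneg)
    ultimately have "S = cmod (l2_inner I (T z) y)" by simp
    also have "\<dots> \<le> l2_norm I (T z) * l2_norm I y"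
      by (rule cauchy_schwarz[OF bounded_op_l2[OF T z] y])
    also have "\<dots> \<le> (C * l2_norm I z) * l2_norm I y"
      by (intro mult_right_mono C z) simp
    also have "l2_norm I z = sqrt S"
      unfolding z_def l2_norm_sqn S_def using that by (simp add: sqn_restr)
    finally have *: "S \<le> sqrt S * (C * l2_norm I y)" by (simp add: mult_ac)
    have "sqrt S \<le> C * l2_norm I y"
    proof (cases "S = 0")
      case False
      then have "0 < sqrt S" using \<open>S \<ge> 0\<close> by simp
      moreover have "sqrt S * sqrt S \<le> sqrt S * (C * l2_norm I y)" using * \<open>S \<ge> 0\<close> by simp
      ultimately show ?thesis using mult_le_cancel_left_pos by blast
    qed (use C in simp)
    then have "(sqrt S)\<^sup>2 \<le> (C * l2_norm I y)\<^sup>2" by (rule power_mono) (simp add: \<open>S \<ge> 0\<close>)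
    then show ?thesis using \<open>S \<ge> 0\<close> by (simp add: S_def[symmetric] power_mult_distrib l2_norm_power2)
  qed
  have Asum: "(\<lambda>i. (cmod (A y i))\<^sup>2) summable_on I" if "y \<in> l2 I" for y
    by (rule nonneg_bdd_above_summable_on) (auto intro!: bdd_aboveI[of _ "C\<^sup>2 * sqn I y"] fin that)
  have Al2: "A y \<in> l2 I" if "y \<in> l2 I" for y
    using Asum[OF that] by (auto intro!: l2I simp: A_def)
  have A: "bounded_op I A"
  proof (rule bounded_opI)
    fix y assume y: "y \<in> l2 I"
    show "sqn I (A y) \<le> C\<^sup>2 * sqn I y"
      unfolding sqn_def[of I "A y"]
      by (rule infsum_le_finite_sums[OF Asum[OF y]]) (use fin y in auto)
    fix z a assume z: "z \<in> l2 I"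
    show "A (\<lambda>i. a * y i + z i) = (\<lambda>i. a * A y i + A z i)"
      using y z T by (auto simp: A_def fun_eq_iff inner_add_right inner_scale_right l2_scale bounded_op_l2)
  qed (rule Al2)
  have "l2_inner I (T x) y = l2_inner I x (A y)" if x: "x \<in> l2 I" and y: "y \<in> l2 I" for x y
  proof -
    let ?d = "cmod (l2_inner I (T x) y - l2_inner I x (A y))"
    define M where "M = C * l2_norm I y + l2_norm I (A y)"
    have "M \<ge> 0" using C by (simp add: M_def)
    have le: "?d \<le> M * \<epsilon>" if "\<epsilon> > 0" for \<epsilon>
    proof -
      obtain D where D: "finite D" "D \<subseteq> I"
        and d: "l2_norm I (\<lambda>i. x i - restr D x i) < \<epsilon>"
        using l2_tail[OF x \<open>\<epsilon> > 0\<close>] by blast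
      define w where "w = (\<lambda>i. x i - restr D x i)"
      have w: "w \<in> l2 I" unfolding w_def by (intro l2_diff restr_l2 x)
      have "l2_inner I (T (restr D x)) y = (\<Sum>k\<in>D. cnj (x k) * l2_inner I (T (delta k)) y)"
        unfolding restr_sum_delta[OF D T] using Td D by (intro inner_lincomb_left y) auto
      also have "\<dots> = l2_inner I (restr D x) (A y)"
        unfolding inner_restr_left[OF D Al2[OF y]]
        using D by (intro sum.cong) (auto simp: A_def)
      finally have eq: "l2_inner I (T (restr D x)) y = l2_inner I (restr D x) (A y)" .
      have "T w = (\<lambda>i. T x i - T (restr D x) i)"
        unfolding w_def by (rule bounded_op_diff_vec[OF T x restr_l2[OF x]])
      then have "l2_inner I (T w) y = l2_inner I (T x) y - l2_inner I (T (restr D x)) y"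
        by (simp add: inner_diff_left y bounded_op_l2[OF T] x restr_l2)
      moreover have "l2_inner I w (A y) = l2_inner I x (A y) - l2_inner I (restr D x) (A y)"
        unfolding w_def by (rule inner_diff_left) (auto simp: Al2 y x restr_l2)
      ultimately have "?d = cmod (l2_inner I (T w) y - l2_inner I w (A y))"
        using eq by simp
      also have "\<dots> \<le> cmod (l2_inner I (T w) y) + cmod (l2_inner I w (A y))"
        by (rule norm_triangle_ineq4)
      also have "\<dots> \<le> l2_norm I (T w) * l2_norm I y + l2_norm I w * l2_norm I (A y)"
        by (rule add_mono[OF cauchy_schwarz[OF bounded_op_l2[OF T w] y] cauchy_schwarz[OF w Al2[OF y]]])
      also have "\<dots> \<le> (C * l2_norm I w) * l2_norm I y + l2_norm I w * l2_norm I (A y)"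
        by (intro add_mono mult_right_mono C w) auto
      also have "\<dots> = M * l2_norm I w" by (simp add: M_def algebra_simps)
      also have "\<dots> \<le> M * \<epsilon>"
        using d \<open>M \<ge> 0\<close> by (intro mult_left_mono) (auto simp: w_def)
      finally show ?thesis .
    qed
    have "?d \<le> 0"
    proof (rule field_le_epsilon)
      fix e :: real assume "e > 0"
      have "?d \<le> M * (e / (M + 1))" using \<open>M \<ge> 0\<close> \<open>e > 0\<close> by (intro le) simp
      also have "\<dots> \<le> e" using \<open>M \<ge> 0\<close> \<open>e > 0\<close> by (simp add: field_simps)
      finally show "?d \<le> 0 + e" by simp
    qed
    then show ?thesis by simp
  qed
  with T A show ?thesis by (auto simp: is_adjoint_def)
qed

lemma bounded_op_cong:
  assumes T: "bounded_op I T" and eq: "\<And>x. x \<in> l2 I \<Longrightarrow> T x = U x"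
  shows "bounded_op I U"
proof -
  obtain C where C: "C \<ge> 0" "\<And>x. x \<in> l2 I \<Longrightarrow> sqn I (T x) \<le> C * sqn I x"
    using bounded_op_sqn[OF T] by blast
  show ?thesis
  proof (rule bounded_opI)
    fix x assume x: "x \<in> l2 I"
    show "U x \<in> l2 I" using bounded_op_l2[OF T x] eq[OF x] by simp
    show "sqn I (U x) \<le> C * sqn I x" using C(2)[OF x] eq[OF x] by simp
    fix y a assume y: "y \<in> l2 I"
    show "U (\<lambda>i. a * x i + y i) = (\<lambda>i. a * U x i + U y i)"
      using bounded_op_lincomb[OF T x y, of a] eq[OF x] eq[OF y] eq[OF l2_lincomb[OF x y, of a]]
      by simp
  qed
qed

lemma wot_closure_cong:
  assumes "T \<in> wot_closure I A" "\<And>x. x \<in> l2 I \<Longrightarrow> T x = U x" shows "U \<in> wot_closure I A"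
proof -
  have "bounded_op I T" using assms(1) by (simp add: wot_closure_def)
  then have "bounded_op I U" using assms(2) by (rule bounded_op_cong)
  moreover have "\<exists>B\<in>A. \<forall>(x, y)\<in>F. cmod (l2_inner I y (U x) - l2_inner I y (B x)) < \<epsilon>"
    if F: "finite F" "F \<subseteq> l2 I \<times> l2 I" "\<epsilon> > 0" for F \<epsilon>
  proof -
    have "\<exists>B\<in>A. \<forall>(x, y)\<in>F. cmod (l2_inner I y (T x) - l2_inner I y (B x)) < \<epsilon>"
      using assms(1) F by (simp add: wot_closure_def)
    moreover have "T x = U x" if "(x, y) \<in> F" for x y
      using that F(2) by (intro assms(2)) blast
    ultimately show ?thesis by (metis (no_types, lifting) case_prodD case_prodI2)
  qed
  ultimately show ?thesis by (simp add: wot_closure_def)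
qed

lemma wot_closure_bounded: "T \<in> wot_closure I A \<Longrightarrow> bounded_op I T"
  by (simp add: wot_closure_def)

lemma wot_closure_approx:
  assumes "T \<in> wot_closure I A" "finite F" "F \<subseteq> l2 I \<times> l2 I" "\<epsilon> > 0"
  obtains B where "B \<in> A" "\<And>x y. (x, y) \<in> F \<Longrightarrow> cmod (l2_inner I y (T x) - l2_inner I y (B x)) < \<epsilon>"
proof -
  have "\<exists>B\<in>A. \<forall>(x, y)\<in>F. cmod (l2_inner I y (T x) - l2_inner I y (B x)) < \<epsilon>"
    using assms by (simp add: wot_closure_def)
  then show ?thesis using that by fast
qed

lemma wot_closureI:
  assumes "bounded_op I T"
    and "\<And>F \<epsilon>. finite F \<Longrightarrow> F \<subseteq> l2 I \<times> l2 I \<Longrightarrow> \<epsilon> > 0 \<Longrightarrow>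
      \<exists>B\<in>A. \<forall>x y. (x, y) \<in> F \<longrightarrow> cmod (l2_inner I y (T x) - l2_inner I y (B x)) < \<epsilon>"
  shows "T \<in> wot_closure I A"
proof -
  have "\<exists>B\<in>A. \<forall>(x, y)\<in>F. cmod (l2_inner I y (T x) - l2_inner I y (B x)) < \<epsilon>"
    if "finite F" "F \<subseteq> l2 I \<times> l2 I" "\<epsilon> > 0" for F \<epsilon>
    using assms(2)[OF that] by fast
  with assms(1) show ?thesis by (simp add: wot_closure_def)
qed

lemma subset_wot_closure: "T \<in> A \<Longrightarrow> bounded_op I T \<Longrightarrow> T \<in> wot_closure I A"
  by (rule wot_closureI) (auto intro!: bexI[of _ T])

lemma wot_closure_idem:
  assumes "T \<in> wot_closure I (wot_closure I A)" shows "T \<in> wot_closure I A"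
proof (rule wot_closureI)
  fix F \<epsilon> assume F: "finite F" "F \<subseteq> l2 I \<times> l2 I" "(\<epsilon>::real) > 0"
  then have h: "\<epsilon> / 2 > 0" by simp
  obtain U where U: "U \<in> wot_closure I A"
    "\<And>x y. (x, y) \<in> F \<Longrightarrow> cmod (l2_inner I y (T x) - l2_inner I y (U x)) < \<epsilon> / 2"
    using wot_closure_approx[OF assms F(1,2) h] by blast
  obtain B where B: "B \<in> A"
    "\<And>x y. (x, y) \<in> F \<Longrightarrow> cmod (l2_inner I y (U x) - l2_inner I y (B x)) < \<epsilon> / 2"
    using wot_closure_approx[OF U(1) F(1,2) h] by blast
  have "cmod (l2_inner I y (T x) - l2_inner I y (B x)) < \<epsilon>" if "(x, y) \<in> F" for x y
    using norm_diff_triangle_less[OF U(2)[OF that] B(2)[OF that]] by simp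
  with B(1) show "\<exists>B\<in>A. \<forall>x y. (x, y) \<in> F \<longrightarrow> cmod (l2_inner I y (T x) - l2_inner I y (B x)) < \<epsilon>"
    by blast
qed (use assms wot_closure_bounded in blast)

lemma wot_closure_entrywise:
  assumes T: "bounded_op I T"
    and approx: "\<And>D \<epsilon>. finite D \<Longrightarrow> D \<subseteq> I \<Longrightarrow> \<epsilon> > 0 \<Longrightarrow>
      \<exists>B\<in>A. bounded_op I B \<and> (\<forall>x\<in>l2 I. l2_norm I (B x) \<le> K * l2_norm I x) \<and>
        (\<forall>i\<in>D. \<forall>j\<in>D. cmod (T (delta j) i - B (delta j) i) < \<epsilon>)"
  shows "T \<in> wot_closure I A"
proof (rule wot_closureI[OF T])
  fix F \<epsilon> assume F: "finite F" "F \<subseteq> l2 I \<times> l2 I" "(\<epsilon>::real) > 0"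
  obtain C where C: "C \<ge> 0" "\<And>x. x \<in> l2 I \<Longrightarrow> l2_norm I (T x) \<le> C * l2_norm I x"
    using bounded_op_bound[OF T] by blast
  define K' where "K' = max C (max K 0)"
  have "K' \<ge> 0" by (simp add: K'_def)
  define Z where "Z = fst ` F \<union> snd ` F"
  have Z: "finite Z" "Z \<subseteq> l2 I" using F by (auto simp: Z_def)
  define N where "N = 1 + (\<Sum>z\<in>Z. l2_norm I z)"
  have N: "l2_norm I z \<le> N" if "z \<in> Z" for z
    unfolding N_def using member_le_sum[of z Z "l2_norm I"] that Z by simp
  have "N \<ge> 1" by (simp add: N_def sum_nonneg)
  define \<eta> where "\<eta> = \<epsilon> / (8 * N * (K' + 1))"
  have "\<eta> > 0" using \<open>N \<ge> 1\<close> \<open>K' \<ge> 0\<close> F by (simp add: \<eta>_def)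
  have "\<forall>z\<in>Z. \<exists>D. finite D \<and> D \<subseteq> I \<and> (\<forall>D'. D \<subseteq> D' \<longrightarrow> l2_norm I (\<lambda>i. z i - restr D' z i) < \<eta>)"
    by (intro ballI l2_tail \<open>\<eta> > 0\<close> subsetD[OF Z(2)])
  then obtain Dz where Dz: "\<And>z. z \<in> Z \<Longrightarrow> finite (Dz z)" "\<And>z. z \<in> Z \<Longrightarrow> Dz z \<subseteq> I"
    "\<And>z D'. z \<in> Z \<Longrightarrow> Dz z \<subseteq> D' \<Longrightarrow> l2_norm I (\<lambda>i. z i - restr D' z i) < \<eta>"
    by metis
  define D where "D = (\<Union>z\<in>Z. Dz z)"
  have D: "finite D" "D \<subseteq> I" using Dz Z by (auto simp: D_def)
  have tail: "l2_norm I (\<lambda>i. z i - restr D z i) < \<eta>" if "z \<in> Z" for z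
    using Dz(3)[OF that] that by (auto simp: D_def)
  define \<delta> where "\<delta> = \<epsilon> / (4 * (1 + real (card D * card D) * (N * N)))"
  have den: "1 + real (card D * card D) * (N * N) > 0"
    using \<open>N \<ge> 1\<close> by (intro add_pos_nonneg) auto
  have "\<delta> > 0" unfolding \<delta>_def using F den by (intro divide_pos_pos) auto
  obtain B where B: "B \<in> A" "bounded_op I B" "\<And>x. x \<in> l2 I \<Longrightarrow> l2_norm I (B x) \<le> K * l2_norm I x"
    "\<And>i j. i \<in> D \<Longrightarrow> j \<in> D \<Longrightarrow> cmod (T (delta j) i - B (delta j) i) < \<delta>"
    using approx[OF D \<open>\<delta> > 0\<close>] by (elim bexE conjE) auto
  have trunc: "cmod (l2_inner I y (U x) - l2_inner I (restr D y) (U (restr D x))) \<le> \<epsilon> / 4"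
    if x: "x \<in> Z" and y: "y \<in> Z" and U: "bounded_op I U"
      and UK: "\<And>x. x \<in> l2 I \<Longrightarrow> l2_norm I (U x) \<le> K' * l2_norm I x" for x y U
  proof -
    define w where "w = (\<lambda>i. x i - restr D x i)"
    define v where "v = (\<lambda>i. y i - restr D y i)"
    have xl: "x \<in> l2 I" and yl: "y \<in> l2 I" using x y Z by auto
    have wl: "w \<in> l2 I" and vl: "v \<in> l2 I" by (auto simp: w_def v_def intro!: l2_diff restr_l2 xl yl)
    have "l2_inner I v (U x) = l2_inner I y (U x) - l2_inner I (restr D y) (U x)"
      unfolding v_def by (rule inner_diff_left) (auto simp: bounded_op_l2[OF U] xl yl restr_l2)
    moreover have "U w = (\<lambda>i. U x i - U (restr D x) i)"
      unfolding w_def by (rule bounded_op_diff_vec[OF U]) (auto simp: xl restr_l2)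
    then have "l2_inner I (restr D y) (U w) = l2_inner I (restr D y) (U x) - l2_inner I (restr D y) (U (restr D x))"
      by (simp add: inner_diff_right bounded_op_l2[OF U] xl yl restr_l2)
    ultimately have "cmod (l2_inner I y (U x) - l2_inner I (restr D y) (U (restr D x)))
        = cmod (l2_inner I v (U x) + l2_inner I (restr D y) (U w))" by simp
    also have "\<dots> \<le> cmod (l2_inner I v (U x)) + cmod (l2_inner I (restr D y) (U w))"
      by (rule norm_triangle_ineq)
    also have "\<dots> \<le> l2_norm I v * l2_norm I (U x) + l2_norm I (restr D y) * l2_norm I (U w)"
      by (intro add_mono cauchy_schwarz) (auto simp: bounded_op_l2[OF U] xl yl vl wl restr_l2)
    also have "\<dots> \<le> \<eta> * (K' * N) + N * (K' * \<eta>)"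
    proof (intro add_mono mult_mono)
      show "l2_norm I v \<le> \<eta>" using tail[OF y] by (simp add: v_def)
      show "l2_norm I (U x) \<le> K' * N"
        using UK[OF xl] mult_left_mono[OF N[OF x] \<open>K' \<ge> 0\<close>] by linarith
      show "l2_norm I (restr D y) \<le> N" using restr_norm_le[OF yl, of D] N[OF y] by linarith
      have "l2_norm I w \<le> \<eta>" using tail[OF x] by (simp add: w_def)
      then show "l2_norm I (U w) \<le> K' * \<eta>"
        using UK[OF wl] mult_left_mono[OF _ \<open>K' \<ge> 0\<close>, of "l2_norm I w" \<eta>] by linarith
    qed (use \<open>\<eta> > 0\<close> \<open>N \<ge> 1\<close> in auto)
    also have "\<dots> = 2 * K' * (\<eta> * N)" by simp
    also have "\<eta> * N = \<epsilon> / (8 * (K' + 1))"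
      using \<open>N \<ge> 1\<close> by (simp add: \<eta>_def)
    also have "2 * K' * (\<epsilon> / (8 * (K' + 1))) = \<epsilon> / 4 * (K' / (K' + 1))"
      using \<open>K' \<ge> 0\<close> by (simp add: field_simps)
    also have "\<dots> \<le> \<epsilon> / 4" using \<open>K' \<ge> 0\<close> F by (intro mult_left_le) auto
    finally show ?thesis .
  qed
  have "cmod (l2_inner I y (T x) - l2_inner I y (B x)) < \<epsilon>" if xy: "(x, y) \<in> F" for x y
  proof -
    have x: "x \<in> Z" and y: "y \<in> Z" using xy by (force simp: Z_def)+
    have xl: "x \<in> l2 I" and yl: "y \<in> l2 I" using x y Z by auto
    have le1: "l2_norm I (T z) \<le> K' * l2_norm I z" if "z \<in> l2 I" for z
      using C(2)[OF that] mult_right_mono[of C K' "l2_norm I z"] by (simp add: K'_def)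
    have le2: "l2_norm I (B z) \<le> K' * l2_norm I z" if "z \<in> l2 I" for z
    proof -
      have "K \<le> K'" by (simp add: K'_def)
      then have "K * l2_norm I z \<le> K' * l2_norm I z" by (rule mult_right_mono) simp
      with B(3)[OF that] show ?thesis by linarith
    qed
    have xi: "cmod (x i) \<le> N" for i
      by (rule order_trans[OF cmod_le_l2_norm[OF xl] N[OF x]])
    have yi: "cmod (y i) \<le> N" for i
      by (rule order_trans[OF cmod_le_l2_norm[OF yl] N[OF y]])
    have ent: "l2_inner I (restr D y) (U (restr D x)) = (\<Sum>i\<in>D. \<Sum>j\<in>D. cnj (y i) * (x j * U (delta j) i))"
      if "bounded_op I U" for U
      unfolding inner_restr_left[OF D bounded_op_l2[OF that restr_l2[OF xl]]]
      by (simp add: restr_sum_delta[OF D that] sum_distrib_left)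
    have "cmod (l2_inner I (restr D y) (T (restr D x)) - l2_inner I (restr D y) (B (restr D x)))
        = cmod (\<Sum>i\<in>D. \<Sum>j\<in>D. cnj (y i) * (x j * (T (delta j) i - B (delta j) i)))"
      by (simp add: ent T B(2) sum_subtractf[symmetric] algebra_simps)
    also have "\<dots> \<le> (\<Sum>i\<in>D. \<Sum>j\<in>D. cmod (cnj (y i) * (x j * (T (delta j) i - B (delta j) i))))"
      by (intro order_trans[OF norm_sum] sum_mono norm_sum)
    also have "\<dots> \<le> (\<Sum>i\<in>D. \<Sum>j\<in>D. N * (N * \<delta>))"
      using \<open>N \<ge> 1\<close> \<open>\<delta> > 0\<close>
      by (intro sum_mono) (auto simp: norm_mult intro!: mult_mono xi yi less_imp_le[OF B(4)])
    also have "\<dots> = (real (card D * card D) * (N * N)) * \<delta>" by simp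
    also have "\<dots> \<le> (1 + real (card D * card D) * (N * N)) * \<delta>"
      using \<open>\<delta> > 0\<close> by (intro mult_right_mono) auto
    also have "\<dots> = \<epsilon> / 4"
      unfolding \<delta>_def using den by (simp add: field_simps)
    finally have mid: "cmod (l2_inner I (restr D y) (T (restr D x)) - l2_inner I (restr D y) (B (restr D x))) \<le> \<epsilon> / 4" .
    have tri: "cmod (p - q) \<le> cmod (p - p') + cmod (p' - q') + cmod (q - q')" for p q p' q'
      using norm_triangle_ineq[of "p - p'" "p' - q'"] norm_triangle_ineq[of "p - q'" "q' - q"]
      by (simp add: norm_minus_commute[of q q'])
    show ?thesis
      using tri[of "l2_inner I y (T x)" "l2_inner I y (B x)" "l2_inner I (restr D y) (T (restr D x))"
          "l2_inner I (restr D y) (B (restr D x))"]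
        trunc[OF x y T le1] trunc[OF x y B(2) le2] mid F(3)
      by linarith
  qed
  with B(1) show "\<exists>B\<in>A. \<forall>x y. (x, y) \<in> F \<longrightarrow> cmod (l2_inner I y (T x) - l2_inner I y (B x)) < \<epsilon>"
    by blast
qed

locale op_algebra =
  fixes I :: "'i set" and A :: "'i op set"
  assumes nonempty: "A \<noteq> {}"
    and add: "T \<in> A \<Longrightarrow> U \<in> A \<Longrightarrow> (\<lambda>x i. T x i + U x i) \<in> A"
    and smult: "T \<in> A \<Longrightarrow> (\<lambda>x i. a * T x i) \<in> A"
    and mult: "T \<in> A \<Longrightarrow> U \<in> A \<Longrightarrow> (\<lambda>x. T (U x)) \<in> A"
    and adjointable: "T \<in> A \<Longrightarrow> \<exists>T'. is_adjoint I T T'"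
begin

lemma bounded: "T \<in> A \<Longrightarrow> bounded_op I T"
  using adjointable adjoint_bounded(1) by blast

lemma closure_zero: "(\<lambda>x i. 0) \<in> wot_closure I A"
proof -
  obtain T where "T \<in> A" using nonempty by blast
  then have "(\<lambda>x i. 0 * T x i) \<in> A" by (rule smult)
  then have z: "(\<lambda>x i. 0) \<in> A" by simp
  show ?thesis by (rule subset_wot_closure[OF z bounded[OF z]])
qed

lemma closure_add:
  assumes T: "T \<in> wot_closure I A" and U: "U \<in> wot_closure I A"
  shows "(\<lambda>x i. T x i + U x i) \<in> wot_closure I A"
proof (rule wot_closureI)
  note bT = wot_closure_bounded[OF T] and bU = wot_closure_bounded[OF U]
  show "bounded_op I (\<lambda>x i. T x i + U x i)" by (rule bounded_op_add[OF bT bU])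
  fix F \<epsilon> assume F: "finite F" "F \<subseteq> l2 I \<times> l2 I" "(\<epsilon>::real) > 0"
  then have h: "\<epsilon> / 2 > 0" by simp
  obtain B where B: "B \<in> A"
    "\<And>x y. (x, y) \<in> F \<Longrightarrow> cmod (l2_inner I y (T x) - l2_inner I y (B x)) < \<epsilon> / 2"
    using wot_closure_approx[OF T F(1,2) h] by blast
  obtain B' where B': "B' \<in> A"
    "\<And>x y. (x, y) \<in> F \<Longrightarrow> cmod (l2_inner I y (U x) - l2_inner I y (B' x)) < \<epsilon> / 2"
    using wot_closure_approx[OF U F(1,2) h] by blast
  have "cmod (l2_inner I y (\<lambda>i. T x i + U x i) - l2_inner I y (\<lambda>i. B x i + B' x i)) < \<epsilon>"
    if "(x, y) \<in> F" for x y
  proof -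
    have "x \<in> l2 I" "y \<in> l2 I" using that F by auto
    then have "l2_inner I y (\<lambda>i. T x i + U x i) - l2_inner I y (\<lambda>i. B x i + B' x i)
      = (l2_inner I y (T x) - l2_inner I y (B x)) + (l2_inner I y (U x) - l2_inner I y (B' x))"
      using bounded[OF B(1)] bounded[OF B'(1)] bT bU by (simp add: inner_add_right bounded_op_l2)
    then show ?thesis using norm_add_less[OF B(2)[OF that] B'(2)[OF that]] by simp
  qed
  then show "\<exists>B\<in>A. \<forall>x y. (x, y) \<in> F \<longrightarrow> cmod (l2_inner I y (\<lambda>i. T x i + U x i) - l2_inner I y (B x)) < \<epsilon>"
    using add[OF B(1) B'(1)] by (intro bexI[of _ "\<lambda>x i. B x i + B' x i"]) auto
qed

lemma closure_scale:
  assumes T: "T \<in> wot_closure I A" shows "(\<lambda>x i. a * T x i) \<in> wot_closure I A"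
proof (rule wot_closureI)
  show "bounded_op I (\<lambda>x i. a * T x i)" by (rule bounded_op_scale[OF wot_closure_bounded[OF T]])
  fix F \<epsilon> assume F: "finite F" "F \<subseteq> l2 I \<times> l2 I" "(\<epsilon>::real) > 0"
  then have h: "\<epsilon> / (cmod a + 1) > 0" by (simp add: add_nonneg_pos)
  obtain B where B: "B \<in> A"
    "\<And>x y. (x, y) \<in> F \<Longrightarrow> cmod (l2_inner I y (T x) - l2_inner I y (B x)) < \<epsilon> / (cmod a + 1)"
    using wot_closure_approx[OF T F(1,2) h] by blast
  have "cmod (a * l2_inner I y (T x) - a * l2_inner I y (B x)) < \<epsilon>" if "(x, y) \<in> F" for x y
  proof -
    let ?d = "cmod (l2_inner I y (T x) - l2_inner I y (B x))"
    have "cmod (a * l2_inner I y (T x) - a * l2_inner I y (B x)) = cmod a * ?d"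
      by (simp flip: norm_mult add: algebra_simps)
    also have "\<dots> \<le> (cmod a + 1) * ?d" by (intro mult_right_mono) auto
    also have "\<dots> < \<epsilon>"
      using B(2)[OF that] by (simp add: pos_less_divide_eq add_nonneg_pos mult.commute)
    finally show ?thesis .
  qed
  then show "\<exists>B\<in>A. \<forall>x y. (x, y) \<in> F \<longrightarrow> cmod (l2_inner I y (\<lambda>i. a * T x i) - l2_inner I y (B x)) < \<epsilon>"
    using smult[OF B(1)] by (intro bexI[of _ "\<lambda>x i. a * B x i"]) (auto simp: inner_scale_right)
qed

lemma closure_sum:
  "(\<And>k. k \<in> K \<Longrightarrow> T k \<in> wot_closure I A) \<Longrightarrow> (\<lambda>x i. \<Sum>k\<in>K. T k x i) \<in> wot_closure I A"
proof (induction K rule: infinite_finite_induct)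
  case (insert k K)
  then show ?case using closure_add[of "T k" "\<lambda>x i. \<Sum>k\<in>K. T k x i"] by simp
qed (auto simp: closure_zero)

lemma closure_mult_left:
  assumes B: "B \<in> A" and T: "T \<in> wot_closure I A"
  shows "(\<lambda>x. B (T x)) \<in> wot_closure I A"
proof (rule wot_closureI)
  note bT = wot_closure_bounded[OF T]
  obtain B' where B': "is_adjoint I B B'" using adjointable[OF B] by blast
  show "bounded_op I (\<lambda>x. B (T x))" by (rule bounded_op_comp[OF bounded[OF B] bT])
  fix F \<epsilon> assume F: "finite F" "F \<subseteq> l2 I \<times> l2 I" "(\<epsilon>::real) > 0"
  define G where "G = (\<lambda>(x, y). (x, B' y)) ` F"
  have G: "finite G" "G \<subseteq> l2 I \<times> l2 I"
    using F adjoint_bounded(2)[OF B'] by (auto simp: G_def bounded_op_l2)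
  obtain U where U: "U \<in> A"
    "\<And>x y. (x, y) \<in> G \<Longrightarrow> cmod (l2_inner I y (T x) - l2_inner I y (U x)) < \<epsilon>"
    using wot_closure_approx[OF T G F(3)] by blast
  have "cmod (l2_inner I y (B (T x)) - l2_inner I y (B (U x))) < \<epsilon>" if "(x, y) \<in> F" for x y
  proof -
    have "x \<in> l2 I" "y \<in> l2 I" using that F by auto
    then have "l2_inner I y (B (T x)) = l2_inner I (B' y) (T x)" "l2_inner I y (B (U x)) = l2_inner I (B' y) (U x)"
      using adjoint_inner'[OF B'] bT bounded[OF U(1)] by (simp_all add: bounded_op_l2)
    moreover have "(x, B' y) \<in> G" using that by (force simp: G_def)
    ultimately show ?thesis using U(2) by simp
  qed
  then show "\<exists>C\<in>A. \<forall>x y. (x, y) \<in> F \<longrightarrow> cmod (l2_inner I y (B (T x)) - l2_inner I y (C x)) < \<epsilon>"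
    using mult[OF B U(1)] by (intro bexI[of _ "\<lambda>x. B (U x)"]) auto
qed

lemma closure_mult_right:
  assumes B: "B \<in> A" and T: "T \<in> wot_closure I A"
  shows "(\<lambda>x. T (B x)) \<in> wot_closure I A"
proof (rule wot_closureI)
  note bT = wot_closure_bounded[OF T]
  show "bounded_op I (\<lambda>x. T (B x))" by (rule bounded_op_comp[OF bT bounded[OF B]])
  fix F \<epsilon> assume F: "finite F" "F \<subseteq> l2 I \<times> l2 I" "(\<epsilon>::real) > 0"
  define G where "G = (\<lambda>(x, y). (B x, y)) ` F"
  have G: "finite G" "G \<subseteq> l2 I \<times> l2 I"
    using F bounded[OF B] by (auto simp: G_def bounded_op_l2)
  obtain U where U: "U \<in> A"
    "\<And>x y. (x, y) \<in> G \<Longrightarrow> cmod (l2_inner I y (T x) - l2_inner I y (U x)) < \<epsilon>"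
    using wot_closure_approx[OF T G F(3)] by blast
  have "cmod (l2_inner I y (T (B x)) - l2_inner I y (U (B x))) < \<epsilon>" if "(x, y) \<in> F" for x y
    using that by (intro U(2)) (force simp: G_def)
  then show "\<exists>C\<in>A. \<forall>x y. (x, y) \<in> F \<longrightarrow> cmod (l2_inner I y (T (B x)) - l2_inner I y (C x)) < \<epsilon>"
    using mult[OF U(1) B] by (intro bexI[of _ "\<lambda>x. U (B x)"]) auto
qed

lemma closure_from_matrix_units:
  assumes T: "bounded_op I T"
    and E: "\<And>i j. i \<in> I \<Longrightarrow> j \<in> I \<Longrightarrow> T (delta j) i \<noteq> 0 \<Longrightarrow> (\<lambda>x k. x j * delta i k) \<in> wot_closure I A"
  shows "T \<in> wot_closure I A"
proof -
  obtain C where C: "C \<ge> 0" "\<And>x. x \<in> l2 I \<Longrightarrow> l2_norm I (T x) \<le> C * l2_norm I x"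
    using bounded_op_bound[OF T] by blast
  have "T \<in> wot_closure I (wot_closure I A)"
  proof (rule wot_closure_entrywise[OF T, of _ C])
    fix D and \<epsilon> :: real assume D: "finite D" "D \<subseteq> I" "\<epsilon> > 0"
    define B where "B = (\<lambda>x. restr D (T (restr D x)))"
    define B' where "B' = (\<lambda>x k. \<Sum>i\<in>D. \<Sum>j\<in>D. T (delta j) i * (x j * delta i k))"
    have eq: "B' x = B x" for x
      unfolding B_def B'_def restr_sum_delta[OF D(1,2) T] restr_finite[OF D(1), of "\<lambda>i. \<Sum>k\<in>D. x k * T (delta k) i"]
      by (simp add: sum_distrib_left mult_ac)
    have "(\<lambda>x k. T (delta j) i * (x j * delta i k)) \<in> wot_closure I A" if "i \<in> D" "j \<in> D" for i j
      using closure_scale[OF E] closure_zero D that by (cases "T (delta j) i = 0") auto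
    then have "B' \<in> wot_closure I A"
      unfolding B'_def by (intro closure_sum) auto
    then have B: "B \<in> wot_closure I A" by (simp add: eq[abs_def, symmetric])
    moreover have "l2_norm I (B x) \<le> C * l2_norm I x" if x: "x \<in> l2 I" for x
    proof -
      have "l2_norm I (B x) \<le> l2_norm I (T (restr D x))"
        unfolding B_def by (intro restr_norm_le bounded_op_l2[OF T] restr_l2 x)
      also have "\<dots> \<le> C * l2_norm I (restr D x)" by (intro C restr_l2 x)
      also have "\<dots> \<le> C * l2_norm I x" by (intro mult_left_mono restr_norm_le x C)
      finally show ?thesis .
    qed
    moreover have "cmod (T (delta j) i - B (delta j) i) < \<epsilon>" if "i \<in> D" "j \<in> D" for i j
    proof -
      have "restr D (delta j) = delta j" using that by (auto simp: restr_def delta_def)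
      then show ?thesis using that D by (simp add: B_def restr_def)
    qed
    ultimately show "\<exists>B\<in>wot_closure I A. bounded_op I B \<and>
        (\<forall>x\<in>l2 I. l2_norm I (B x) \<le> C * l2_norm I x) \<and>
        (\<forall>i\<in>D. \<forall>j\<in>D. cmod (T (delta j) i - B (delta j) i) < \<epsilon>)"
      using wot_closure_bounded by blast
  qed
  then show ?thesis by (rule wot_closure_idem)
qed

end

lemma op_algebra_alg_gen:
  assumes "Gs \<noteq> {}" "\<And>T. T \<in> Gs \<Longrightarrow> \<exists>T'. is_adjoint I T T'"
  shows "op_algebra I (alg_gen Gs)"
proof
  show "alg_gen Gs \<noteq> {}" using assms(1) alg_gen.gen by fast
  show "\<exists>T'. is_adjoint I T T'" if "T \<in> alg_gen Gs" for T
    using that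
  proof induction
    case (gen T)
    then show ?case by (rule assms(2))
  next
    case (add T U)
    then obtain T' U' where "is_adjoint I T T'" "is_adjoint I U U'" by blast
    then show ?case by (intro exI) (rule adjoint_add)
  next
    case (smult T a)
    then obtain T' where "is_adjoint I T T'" by blast
    then show ?case by (intro exI) (rule adjoint_scale)
  next
    case (mult T U)
    then obtain T' U' where "is_adjoint I T T'" "is_adjoint I U U'" by blast
    then show ?case by (intro exI) (rule adjoint_comp)
  qed
qed (fact alg_gen.add alg_gen.smult alg_gen.mult)+

section \<open>Self-adjointness forces return paths\<close>

context
  fixes I :: "'i set" and V :: "'v set" and E :: "'e set" and r s :: "'e \<Rightarrow> 'v" and Sv Se
  assumes tck: "tck_family I V E r s Sv Se" and graph: "finite_graph V E r s"
begin

lemma Sv_adjoint: "v \<in> V \<Longrightarrow> is_adjoint I (Sv v) (Sv v)"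
  using tck by (simp add: tck_family_def is_projection_def)

lemma Sv_idem: "v \<in> V \<Longrightarrow> x \<in> l2 I \<Longrightarrow> Sv v (Sv v x) = Sv v x"
  using tck by (simp add: tck_family_def is_projection_def)

lemma Sv_orth: "v \<in> V \<Longrightarrow> w \<in> V \<Longrightarrow> v \<noteq> w \<Longrightarrow> x \<in> l2 I \<Longrightarrow> Sv v (Sv w x) = (\<lambda>i. 0)"
  using tck by (simp add: tck_family_def)

lemma Sv_sum: "x \<in> l2 I \<Longrightarrow> (\<lambda>i. \<Sum>v\<in>V. Sv v x i) = x"
  using tck by (simp add: tck_family_def)

lemma Sv_l2: "v \<in> V \<Longrightarrow> x \<in> l2 I \<Longrightarrow> Sv v x \<in> l2 I"
  by (rule bounded_op_l2[OF adjoint_bounded(1)[OF Sv_adjoint]])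

lemma edge_vertices: "e \<in> E \<Longrightarrow> s e \<in> V" "e \<in> E \<Longrightarrow> r e \<in> V"
  using graph by (auto simp: finite_graph_def)

lemma Se_adjoint: "e \<in> E \<Longrightarrow> \<exists>A. is_adjoint I (Se e) A \<and> (\<forall>x\<in>l2 I. A (Se e x) = Sv (s e) x)"
  using tck by (simp add: tck_family_def)

lemma Se_l2: "e \<in> E \<Longrightarrow> x \<in> l2 I \<Longrightarrow> Se e x \<in> l2 I"
  using Se_adjoint[of e] adjoint_bounded(1)[of I "Se e"] bounded_op_l2[of I "Se e" x] by blast

lemma inner_Se_Se:
  assumes e: "e \<in> E" and x: "x \<in> l2 I" and y: "y \<in> l2 I"
  shows "l2_inner I (Se e x) (Se e y) = l2_inner I x (Sv (s e) y)"
proof -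
  obtain A where A: "is_adjoint I (Se e) A" "\<forall>x\<in>l2 I. A (Se e x) = Sv (s e) x"
    using Se_adjoint[OF e] by blast
  then show ?thesis using adjoint_inner[OF A(1) x Se_l2[OF e y]] y by simp
qed

lemma Se_other_source:
  assumes e: "e \<in> E" and w: "w \<in> V" "w \<noteq> s e" and x: "x \<in> l2 I"
  shows "Se e (Sv w x) = (\<lambda>i. 0)"
proof -
  have u: "Sv w x \<in> l2 I" by (rule Sv_l2[OF w(1) x])
  have "Sv (s e) (Sv w x) = (\<lambda>i. 0)"
    by (rule Sv_orth) (use e w x edge_vertices in auto)
  then have "complex_of_real (sqn I (Se e (Sv w x))) = 0"
    using inner_Se_Se[OF e u u] by (simp add: inner_self Se_l2[OF e u])
  then show ?thesis using sqn_eq_0D[OF Se_l2[OF e u]] by simp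
qed

lemma Se_other_range:
  assumes e: "e \<in> E" and v: "v \<in> V" "v \<noteq> r e" and x: "x \<in> l2 I"
  shows "Sv v (Se e x) = (\<lambda>i. 0)"
proof -
  have "\<exists>A. (\<forall>e'\<in>{e}. is_adjoint I (Se e') (A e')) \<and>
      op_le I (\<lambda>x i. \<Sum>e'\<in>{e}. Se e' (A e' x) i) (Sv (r e))"
  proof -
    have "\<forall>v\<in>V. \<forall>F. finite F \<and> F \<subseteq> {e\<in>E. r e = v} \<longrightarrow>
        (\<exists>A. (\<forall>e\<in>F. is_adjoint I (Se e) (A e)) \<and>
             op_le I (\<lambda>x i. \<Sum>e\<in>F. Se e (A e x) i) (Sv v))"
      using tck unfolding tck_family_def by (elim conjE)
    from bspec[OF this edge_vertices(2)[OF e], THEN spec[of _ "{e}"]]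
    show ?thesis using e by simp
  qed
  then obtain A where A: "is_adjoint I (Se e) A"
    and le: "op_le I (\<lambda>x. Se e (A x)) (Sv (r e))" by auto
  define y where "y = Se e x"
  have y: "y \<in> l2 I" unfolding y_def by (rule Se_l2[OF e x])
  define z where "z = Sv v y"
  have z: "z \<in> l2 I" unfolding z_def by (rule Sv_l2[OF v(1) y])
  have Az: "A z \<in> l2 I" by (rule bounded_op_l2[OF adjoint_bounded(2)[OF A] z])
  have "Sv (r e) z = (\<lambda>i. 0)"
    unfolding z_def by (rule Sv_orth) (use e v y edge_vertices in auto)
  moreover have "0 \<le> Re (l2_inner I z (\<lambda>i. Sv (r e) z i - Se e (A z) i))"
    using le z unfolding op_le_def by blast
  ultimately have "0 \<le> Re (l2_inner I z (\<lambda>i. 0 - Se e (A z) i))" by simp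
  also have "l2_inner I z (\<lambda>i. 0 - Se e (A z) i) = - l2_inner I z (Se e (A z))"
    using inner_diff_right[OF z l2_zero Se_l2[OF e Az]] by simp
  also have "l2_inner I z (Se e (A z)) = of_real (sqn I (A z))"
    using adjoint_inner'[OF A Az z] by (simp add: inner_self[OF Az])
  finally have "sqn I (A z) = 0" using sqn_nonneg[of I "A z"] by simp
  then have "A z = (\<lambda>i. 0)" by (rule sqn_eq_0D[OF Az])
  then have "l2_inner I z (Se e x) = 0"
    using adjoint_inner'[OF A x z] by simp
  moreover have "l2_inner I z (Se e x) = l2_inner I z z"
  proof -
    have "l2_inner I z z = l2_inner I (Sv v z) y"
      using adjoint_inner[OF Sv_adjoint[OF v(1)] z y] by (simp add: z_def)
    also have "Sv v z = z" unfolding z_def by (rule Sv_idem[OF v(1) y])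
    finally show ?thesis by (simp add: y_def)
  qed
  ultimately have "sqn I z = 0" by (simp add: inner_self[OF z])
  then show ?thesis using sqn_eq_0D[OF z] by (simp add: z_def y_def)
qed

lemma alg_gen_reach:
  assumes "T \<in> alg_gen (Sv ` V \<union> Se ` E)"
  shows "bounded_op I T \<and> (\<forall>w\<in>V. \<forall>u\<in>V. (w, u) \<notin> (edge_rel V E r s)\<^sup>* \<longrightarrow>
    (\<forall>x\<in>l2 I. Sv u (T (Sv w x)) = (\<lambda>i. 0)))"
  using assms
proof induction
  case (gen T)
  then consider v where "v \<in> V" "T = Sv v" | e where "e \<in> E" "T = Se e" by blast
  then show ?case
  proof cases
    case 1
    have "Sv u (Sv v (Sv w x)) = (\<lambda>i. 0)"
      if "w \<in> V" "u \<in> V" "(w, u) \<notin> (edge_rel V E r s)\<^sup>*" "x \<in> l2 I" for w u x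
    proof (cases "u = v")
      case True
      then have "v \<noteq> w" using that(3) by blast
      then have "Sv v (Sv w x) = (\<lambda>i. 0)" using Sv_orth 1 that by simp
      then show ?thesis using Sv_idem[OF that(2) Sv_l2[OF that(1,4)]] True by simp
    next
      case False
      then show ?thesis using Sv_orth[OF that(2) 1(1) False Sv_l2[OF that(1,4)]] by simp
    qed
    then show ?thesis using 1 adjoint_bounded(1)[OF Sv_adjoint] by simp
  next
    case 2
    have "Sv u (Se e (Sv w x)) = (\<lambda>i. 0)"
      if "w \<in> V" "u \<in> V" "(w, u) \<notin> (edge_rel V E r s)\<^sup>*" "x \<in> l2 I" for w u x
    proof (cases "u = r e")
      case False
      then show ?thesis using Se_other_range[OF 2(1) that(2) False Sv_l2[OF that(1,4)]] by simp
    next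
      case True
      have "(s e, r e) \<in> (edge_rel V E r s)\<^sup>*"
        using 2 edge_vertices by (auto simp: edge_rel_def)
      then have "w \<noteq> s e" using that(3) True by blast
      then have "Se e (Sv w x) = (\<lambda>i. 0)" using Se_other_source[OF 2(1) that(1) _ that(4)] by simp
      then show ?thesis using bounded_op_zero[OF adjoint_bounded(1)[OF Sv_adjoint[OF that(2)]]] by simp
    qed
    moreover have "bounded_op I (Se e)" using Se_adjoint[OF 2(1)] adjoint_bounded(1)[of I "Se e"] by blast
    ultimately show ?thesis using 2 by simp
  qed
next
  case (add T U)
  then have T: "bounded_op I T" and U: "bounded_op I U" by auto
  have "Sv u (\<lambda>i. T (Sv w x) i + U (Sv w x) i) = (\<lambda>i. 0)"
    if "w \<in> V" "u \<in> V" "(w, u) \<notin> (edge_rel V E r s)\<^sup>*" "x \<in> l2 I" for w u x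
  proof -
    have y: "Sv w x \<in> l2 I" by (rule Sv_l2[OF that(1,4)])
    show ?thesis
      using bounded_op_add_vec[OF adjoint_bounded(1)[OF Sv_adjoint[OF that(2)]]
          bounded_op_l2[OF T y] bounded_op_l2[OF U y]] add.IH that by simp
  qed
  then show ?case using bounded_op_add[OF T U] by simp
next
  case (smult T a)
  then have T: "bounded_op I T" by auto
  have "Sv u (\<lambda>i. a * T (Sv w x) i) = (\<lambda>i. 0)"
    if "w \<in> V" "u \<in> V" "(w, u) \<notin> (edge_rel V E r s)\<^sup>*" "x \<in> l2 I" for w u x
  proof -
    have y: "Sv w x \<in> l2 I" by (rule Sv_l2[OF that(1,4)])
    show ?thesis
      using bounded_op_scale_vec[OF adjoint_bounded(1)[OF Sv_adjoint[OF that(2)]]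
          bounded_op_l2[OF T y], of a] smult.IH that by simp
  qed
  then show ?case using bounded_op_scale[OF T] by simp
next
  case (mult T U)
  then have T: "bounded_op I T" and U: "bounded_op I U" by auto
  have "Sv u (T (U (Sv w x))) = (\<lambda>i. 0)"
    if w: "w \<in> V" and u: "u \<in> V" and no: "(w, u) \<notin> (edge_rel V E r s)\<^sup>*" and x: "x \<in> l2 I" for w u x
  proof -
    define y where "y = U (Sv w x)"
    have y: "y \<in> l2 I" unfolding y_def by (rule bounded_op_l2[OF U Sv_l2[OF w x]])
    have z: "Sv u (T (Sv v y)) = (\<lambda>i. 0)" if v: "v \<in> V" for v
    proof (cases "(w, v) \<in> (edge_rel V E r s)\<^sup>*")
      case True
      then have "(v, u) \<notin> (edge_rel V E r s)\<^sup>*" using no by (meson rtrancl_trans)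
      then show ?thesis using mult.IH(1) u v y by simp
    next
      case False
      then have "Sv v y = (\<lambda>i. 0)" using mult.IH(2) w v x by (simp add: y_def)
      then show ?thesis
        using bounded_op_zero[OF T] bounded_op_zero[OF adjoint_bounded(1)[OF Sv_adjoint[OF u]]] by simp
    qed
    have "T y = T (\<lambda>i. \<Sum>v\<in>V. Sv v y i)" using Sv_sum[OF y] by simp
    also have "\<dots> = (\<lambda>i. \<Sum>v\<in>V. T (Sv v y) i)"
      by (rule bounded_op_sum_vec[OF T Sv_l2[OF _ y]])
    finally have "Sv u (T y) = Sv u (\<lambda>i. \<Sum>v\<in>V. T (Sv v y) i)" by simp
    also have "\<dots> = (\<lambda>i. \<Sum>v\<in>V. Sv u (T (Sv v y)) i)"
      by (rule bounded_op_sum_vec[OF adjoint_bounded(1)[OF Sv_adjoint[OF u]] bounded_op_l2[OF T Sv_l2[OF _ y]]])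
    finally show ?thesis using z by (simp add: y_def)
  qed
  then show ?case using bounded_op_comp[OF T U] by simp
qed

lemma self_adjoint_reverse_path:
  assumes sa: "self_adjoint_set I (free_semigroupoid_alg I V E Sv Se)"
    and nz: "\<And>v. v \<in> V \<Longrightarrow> \<exists>x\<in>l2 I. Sv v x \<noteq> (\<lambda>i. 0)"
    and e: "e \<in> E"
  shows "(r e, s e) \<in> (edge_rel V E r s)\<^sup>*"
proof (rule ccontr)
  assume no: "(r e, s e) \<notin> (edge_rel V E r s)\<^sup>*"
  let ?A = "alg_gen (Sv ` V \<union> Se ` E)"
  note se = edge_vertices(1)[OF e] and re = edge_vertices(2)[OF e]
  have "Se e \<in> ?A" using e by (intro alg_gen.gen) blast
  then have "Se e \<in> wot_closure I ?A" using alg_gen_reach by (blast intro: subset_wot_closure)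
  then obtain T' where T': "T' \<in> wot_closure I ?A" and adj: "is_adjoint I (Se e) T'"
    using sa by (auto simp: self_adjoint_set_def free_semigroupoid_alg_def)
  obtain x where x: "x \<in> l2 I" and xn: "Sv (s e) x \<noteq> (\<lambda>i. 0)" using nz[OF se] by blast
  define u where "u = Sv (s e) x"
  have u: "u \<in> l2 I" unfolding u_def by (rule Sv_l2[OF se x])
  have uu: "Sv (s e) u = u" unfolding u_def by (rule Sv_idem[OF se x])
  define y where "y = Se e u"
  have y: "y \<in> l2 I" unfolding y_def by (rule Se_l2[OF e u])
  have yy: "Sv (r e) y = y"
  proof -
    have "y i = Sv (r e) y i" for i
    proof -
      have "y i = (\<Sum>v\<in>V. Sv v y i)" using fun_cong[OF Sv_sum[OF y], of i] by simp
      also have "\<dots> = (\<Sum>v\<in>{r e}. Sv v y i)"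
        by (rule sum.mono_neutral_right)
          (use graph re Se_other_range[OF e _ _ u] in \<open>auto simp: finite_graph_def y_def\<close>)
      finally show ?thesis by simp
    qed
    then show ?thesis by (simp add: fun_eq_iff)
  qed
  have "cmod (l2_inner I u (T' y)) < \<epsilon>" if "\<epsilon> > 0" for \<epsilon>
  proof -
    obtain B where B: "B \<in> ?A"
      and d: "cmod (l2_inner I u (T' y) - l2_inner I u (B y)) < \<epsilon>"
    proof (rule wot_closure_approx[OF T', of "{(y, u)}" \<epsilon>])
      show "{(y, u)} \<subseteq> l2 I \<times> l2 I" using y u by simp
    qed (use \<open>\<epsilon> > 0\<close> in auto)
    have bB: "bounded_op I B" and z: "Sv (s e) (B (Sv (r e) y)) = (\<lambda>i. 0)"
      using alg_gen_reach[OF B] se re no y by auto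
    have "l2_inner I u (B y) = l2_inner I (Sv (s e) u) (B y)" by (simp add: uu)
    also have "\<dots> = l2_inner I u (Sv (s e) (B y))"
      by (rule adjoint_inner[OF Sv_adjoint[OF se] u bounded_op_l2[OF bB y]])
    also have "\<dots> = 0" using z by (simp add: yy)
    finally show ?thesis using d by simp
  qed
  from this[of "cmod (l2_inner I u (T' y))"] have "l2_inner I u (T' y) = 0" by auto
  then have "l2_inner I (Se e u) y = 0" using adjoint_inner[OF adj u y] by simp
  then have "l2_inner I u (Sv (s e) u) = 0" using inner_Se_Se[OF e u u] by (simp add: y_def)
  then have "sqn I u = 0" by (simp add: uu inner_self[OF u])
  then show False using sqn_eq_0D[OF u] xn by (simp add: u_def)
qed

end

lemma union_of_transitive_componentsI:
  assumes graph: "finite_graph V E r s"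
    and rev: "\<And>e. e \<in> E \<Longrightarrow> (r e, s e) \<in> (edge_rel V E r s)\<^sup>*"
  shows "union_of_transitive_components V E r s"
proof -
  let ?R = "(edge_rel V E r s)\<^sup>*"
  have sym: "(w, v) \<in> ?R" if "(v, w) \<in> ?R" for v w
    using that
  proof induction
    case (step y z)
    then have "(z, y) \<in> ?R" using rev by (auto simp: edge_rel_def)
    then show ?case using step.IH by (rule rtrancl_trans)
  qed simp
  have stay: "w \<in> V" if "(v, w) \<in> ?R" "v \<in> V" for v w
    using that by induction (auto simp: edge_rel_def)
  define cls where "cls v = {w. (v, w) \<in> ?R}" for v
  have eq: "cls v = cls w" if "(v, w) \<in> ?R" for v w
    using that sym[OF that] unfolding cls_def by (auto intro: rtrancl_trans)
  have trans: "transitive_on (cls v) E r s" for v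
    unfolding transitive_on_def
  proof (intro ballI)
    fix a b assume a: "a \<in> cls v" and b: "b \<in> cls v"
    then have "(a, b) \<in> ?R" using sym[of v a] by (auto simp: cls_def intro: rtrancl_trans)
    then show "(a, b) \<in> (edge_rel (cls v) E r s)\<^sup>*"
    proof induction
      case (step y z)
      have "(v, y) \<in> ?R" using a step.hyps(1) by (auto simp: cls_def intro: rtrancl_trans)
      moreover have "(v, z) \<in> ?R" using calculation step.hyps(2) by (rule rtrancl_into_rtrancl)
      ultimately have "(y, z) \<in> edge_rel (cls v) E r s"
        using step.hyps(2) by (auto simp: edge_rel_def cls_def)
      with step.IH show ?case by (rule rtrancl_into_rtrancl)
    qed simp
  qed
  show ?thesis
    unfolding union_of_transitive_components_def
  proof (intro exI[of _ "cls ` V"] conjI ballI impI)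
    show "\<Union> (cls ` V) = V" using stay by (auto simp: cls_def)
    show "{} \<notin> cls ` V" by (auto simp: cls_def)
    show "W1 \<inter> W2 = {}" if "W1 \<in> cls ` V" "W2 \<in> cls ` V" "W1 \<noteq> W2" for W1 W2
    proof (rule ccontr)
      assume "W1 \<inter> W2 \<noteq> {}"
      then obtain u where u: "u \<in> W1" "u \<in> W2" by blast
      obtain v w where "W1 = cls v" "W2 = cls w" using \<open>W1 \<in> cls ` V\<close> \<open>W2 \<in> cls ` V\<close> by blast
      then have "(v, u) \<in> ?R" "(w, u) \<in> ?R" using u by (auto simp: cls_def)
      then show False using eq \<open>W1 = cls v\<close> \<open>W2 = cls w\<close> \<open>W1 \<noteq> W2\<close> by metis
    qed
    show "transitive_on W E r s" if "W \<in> cls ` V" for W using that trans by blast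
    show "\<exists>W\<in>cls ` V. s e \<in> W \<and> r e \<in> W" if "e \<in> E" for e
    proof -
      have "s e \<in> V" "r e \<in> V" using that graph by (auto simp: finite_graph_def)
      moreover have "(s e, r e) \<in> ?R" using that calculation by (auto simp: edge_rel_def)
      ultimately show ?thesis by (intro bexI[of _ "cls (s e)"]) (auto simp: cls_def)
    qed
  qed
qed

section \<open>Cuntz-Krieger families from path bases\<close>

definition pw :: "('i \<Rightarrow> real) \<Rightarrow> ('i \<Rightarrow> 'i) \<Rightarrow> 'i set \<Rightarrow> 'i op" where
  "pw c f A x = (\<lambda>i. if i \<in> A then of_real (c i) * x (f i) else 0)"

lemma pw_bounded:
  fixes I :: "'i set"
  assumes f: "inj_on f A" "f ` A \<subseteq> I" and A: "A \<subseteq> I" and c: "\<And>i. i \<in> A \<Longrightarrow> \<bar>c i\<bar> \<le> 1"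
  shows "bounded_op I (pw c f A)"
proof (rule bounded_opI)
  fix x assume x: "x \<in> l2 I"
  have sum: "(\<lambda>i. (cmod (x (f i)))\<^sup>2) summable_on A"
    using summable_on_reindex[OF f(1), of "\<lambda>i. (cmod (x i))\<^sup>2"]
      summable_on_subset_banach[OF l2_summable[OF x] f(2)] by (simp add: o_def)
  have le: "(cmod (pw c f A x i))\<^sup>2 \<le> (cmod (x (f i)))\<^sup>2" if "i \<in> A" for i
  proof -
    have "cmod (pw c f A x i) \<le> 1 * cmod (x (f i))"
      using mult_right_mono[OF c[OF that] norm_ge_zero[of "x (f i)"]] that
      by (simp add: pw_def norm_mult)
    then show ?thesis by (simp add: power_mono)
  qed
  have sumA: "(\<lambda>i. (cmod (pw c f A x i))\<^sup>2) summable_on A"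
    by (rule summable_on_mono_nonneg[OF sum _ le]) auto
  have "(\<lambda>i. (cmod (pw c f A x i))\<^sup>2) summable_on I \<longleftrightarrow> (\<lambda>i. (cmod (pw c f A x i))\<^sup>2) summable_on A"
    by (rule summable_on_cong_neutral) (use A in \<open>auto simp: pw_def\<close>)
  with sumA show "pw c f A x \<in> l2 I"
    using A by (intro l2I) (auto simp: pw_def)
  have "sqn I (pw c f A x) = (\<Sum>\<^sub>\<infinity>i\<in>A. (cmod (pw c f A x i))\<^sup>2)"
    unfolding sqn_def by (rule infsum_cong_neutral) (use A in \<open>auto simp: pw_def\<close>)
  also have "\<dots> \<le> (\<Sum>\<^sub>\<infinity>i\<in>A. (cmod (x (f i)))\<^sup>2)"
    by (rule infsum_mono[OF sumA sum le])
  also have "\<dots> = (\<Sum>\<^sub>\<infinity>i\<in>f ` A. (cmod (x i))\<^sup>2)"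
    by (subst infsum_reindex[OF f(1)]) (simp add: o_def)
  also have "\<dots> \<le> sqn I x"
    unfolding sqn_def
    by (rule infsum_mono_neutral[OF summable_on_subset_banach[OF l2_summable[OF x] f(2)] l2_summable[OF x]])
       (use f(2) in auto)
  finally show "sqn I (pw c f A x) \<le> 1 * sqn I x" by simp
next
  fix x y :: "'i vec" and a
  show "pw c f A (\<lambda>i. a * x i + y i) = (\<lambda>i. a * pw c f A x i + pw c f A y i)"
    by (auto simp: pw_def algebra_simps)
qed

lemma pw_adjoint:
  assumes f: "inj_on f A" "f ` A = B" and A: "A \<subseteq> I" and B: "B \<subseteq> I"
    and g: "\<And>i. i \<in> A \<Longrightarrow> g (f i) = i" and c: "\<And>i. i \<in> A \<Longrightarrow> \<bar>c i\<bar> \<le> 1"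
    and d: "\<And>i. i \<in> A \<Longrightarrow> d (f i) = c i"
  shows "is_adjoint I (pw c f A) (pw d g B)"
  unfolding is_adjoint_def
proof (intro conjI ballI)
  show "bounded_op I (pw c f A)" using f A B c by (intro pw_bounded) auto
  have "inj_on g B" using f(2) g by (auto simp: inj_on_def)
  moreover have "g ` B \<subseteq> I" using f(2) g A by auto
  ultimately show "bounded_op I (pw d g B)" using f A B c d by (intro pw_bounded) auto
  fix x y
  have "l2_inner I (pw c f A x) y = (\<Sum>\<^sub>\<infinity>i\<in>A. cnj (of_real (c i) * x (f i)) * y i)"
    unfolding l2_inner_def by (rule infsum_cong_neutral) (use A in \<open>auto simp: pw_def\<close>)
  also have "\<dots> = (\<Sum>\<^sub>\<infinity>i\<in>A. cnj (x (f i)) * (of_real (d (f i)) * y (g (f i))))"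
    by (rule infsum_cong) (simp add: g d)
  also have "\<dots> = (\<Sum>\<^sub>\<infinity>j\<in>B. cnj (x j) * (of_real (d j) * y (g j)))"
    unfolding f(2)[symmetric] by (subst infsum_reindex[OF f(1)]) (simp add: o_def)
  also have "\<dots> = l2_inner I x (pw d g B y)"
    unfolding l2_inner_def by (rule infsum_cong_neutral) (use B in \<open>auto simp: pw_def\<close>)
  finally show "l2_inner I (pw c f A x) y = l2_inner I x (pw d g B y)" .
qed

lemma restr_adjoint: "is_adjoint I (restr D) (restr D)"
proof -
  have adj: "is_adjoint I (pw (\<lambda>_. 1) id (D \<inter> I)) (pw (\<lambda>_. 1) id (D \<inter> I))"
    by (rule pw_adjoint) auto
  have eq: "pw (\<lambda>_. 1) id (D \<inter> I) x = restr D x" if "x \<in> l2 I" for x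
    using l2_outside[OF that] by (auto simp: pw_def restr_def)
  have "bounded_op I (restr D)" by (rule bounded_op_cong[OF adjoint_bounded(1)[OF adj] eq])
  then show ?thesis
    using adj by (simp add: is_adjoint_def eq)
qed

definition kap :: real where "kap = 1 / sqrt 2"

lemma kap: "kap * kap = 1 / 2" "kap > 0" "kap < 1" "complex_of_real kap * of_real kap = 1 / 2"
proof -
  show *: "kap * kap = 1 / 2" by (simp add: kap_def)
  show "complex_of_real kap * of_real kap = 1 / 2"
    unfolding of_real_mult[symmetric] * by simp
qed (auto simp: kap_def)

locale path_rep =
  fixes I :: "'i set" and V :: "'v set" and E :: "'e set" and r s :: "'e \<Rightarrow> 'v"
    and rng :: "'i \<Rightarrow> 'v" and first :: "'i \<Rightarrow> 'e option" and rest :: "'i \<Rightarrow> 'i"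
    and cons :: "'e \<Rightarrow> 'i \<Rightarrow> 'i" and mate :: "'i \<Rightarrow> 'i" and upper :: "'i \<Rightarrow> bool"
  assumes graph: "finite_graph V E r s"
    and rng_V: "i \<in> I \<Longrightarrow> rng i \<in> V"
    and first_Some: "i \<in> I \<Longrightarrow> first i = Some e \<Longrightarrow>
      e \<in> E \<and> r e = rng i \<and> rest i \<in> I \<and> rng (rest i) = s e \<and> cons e (rest i) = i"
    and cons_I: "i \<in> I \<Longrightarrow> e \<in> E \<Longrightarrow> rng i = s e \<Longrightarrow>
      cons e i \<in> I \<and> first (cons e i) = Some e \<and> rest (cons e i) = i"
    and first_None: "i \<in> I \<Longrightarrow> first i = None \<Longrightarrow> e \<in> E \<Longrightarrow> r e \<noteq> rng i"
    and mate_I: "i \<in> I \<Longrightarrow> mate i \<in> I \<and> mate (mate i) = i \<and> rng (mate i) = rng i"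
    and upper_mate: "i \<in> I \<Longrightarrow> mate i \<noteq> i \<Longrightarrow> upper (mate i) = (\<not> upper i)"
    and first_mate: "i \<in> I \<Longrightarrow> mate i \<noteq> i \<Longrightarrow> first (mate i) \<noteq> first i"
begin

definition diag :: "'i \<Rightarrow> real" where
  "diag i = (if mate i = i then 1 else if upper i then kap else - kap)"

definition offd :: "'i \<Rightarrow> real" where
  "offd i = (if mate i = i then 0 else kap)"

lemma diag_le: "\<bar>diag i\<bar> \<le> 1" and offd_le: "\<bar>offd i\<bar> \<le> 1"
  using kap by (auto simp: diag_def offd_def)

text \<open>The reflection of each two-dimensional block spanned by a basis vector and its mate.\<close>
definition Rot :: "'i op" where
  "Rot x = (\<lambda>i. if i \<in> I then of_real (diag i) * x i + of_real (offd i) * x (mate i) else 0)"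

definition Tr :: "'e \<Rightarrow> 'i op" where
  "Tr e = pw (\<lambda>_. 1) rest {i \<in> I. first i = Some e}"

definition Tr' :: "'e \<Rightarrow> 'i op" where
  "Tr' e = pw (\<lambda>_. 1) (cons e) {i \<in> I. rng i = s e}"

definition Se :: "'e \<Rightarrow> 'i op" where "Se e x = Rot (Tr e x)"
definition Se' :: "'e \<Rightarrow> 'i op" where "Se' e x = Tr' e (Rot x)"
definition Sv :: "'v \<Rightarrow> 'i op" where "Sv v = restr {i \<in> I. rng i = v}"

lemma Rot_adjoint: "is_adjoint I Rot Rot"
proof -
  have 1: "is_adjoint I (pw diag id I) (pw diag id I)"
    by (rule pw_adjoint) (auto simp: diag_le)
  have inj: "inj_on mate I" by (rule inj_on_inverseI[of _ mate]) (simp add: mate_I)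
  have im: "mate ` I = I" using mate_I by (auto simp: image_iff) metis
  have 2: "is_adjoint I (pw offd mate I) (pw offd mate I)"
  proof (rule pw_adjoint[OF inj im])
    show "offd (mate i) = offd i" if "i \<in> I" for i
      using mate_I[OF that] by (auto simp: offd_def)
  qed (auto simp: mate_I offd_le)
  have "Rot = (\<lambda>x i. pw diag id I x i + pw offd mate I x i)"
    by (auto simp: Rot_def pw_def fun_eq_iff)
  with adjoint_add[OF 1 2] show ?thesis by simp
qed

lemma Tr_adjoint:
  assumes e: "e \<in> E" shows "is_adjoint I (Tr e) (Tr' e)"
  unfolding Tr_def Tr'_def
proof (rule pw_adjoint)
  show "inj_on rest {i \<in> I. first i = Some e}"
    by (rule inj_on_inverseI[of _ "cons e"]) (use first_Some in auto)
  show "rest ` {i \<in> I. first i = Some e} = {i \<in> I. rng i = s e}"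
  proof (intro equalityI subsetI)
    fix j assume "j \<in> {i \<in> I. rng i = s e}"
    then have "rest (cons e j) = j" "cons e j \<in> I" "first (cons e j) = Some e" using cons_I e by auto
    then show "j \<in> rest ` {i \<in> I. first i = Some e}" by force
  qed (use first_Some in auto)
qed (use first_Some in auto)

lemma Se_adjoint: "e \<in> E \<Longrightarrow> is_adjoint I (Se e) (Se' e)"
  using adjoint_comp[OF Rot_adjoint Tr_adjoint] unfolding Se_def[abs_def] Se'_def[abs_def] .

lemma Sv_adjoint: "is_adjoint I (Sv v) (Sv v)"
  unfolding Sv_def by (rule restr_adjoint)

lemma Rot_l2: "x \<in> l2 I \<Longrightarrow> Rot x \<in> l2 I"
  by (rule bounded_op_l2[OF adjoint_bounded(1)[OF Rot_adjoint]])

lemma Rot_Rot: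
  assumes x: "x \<in> l2 I" shows "Rot (Rot x) = x"
proof
  fix i
  show "Rot (Rot x) i = x i"
  proof (cases "i \<in> I")
    case False
    then show ?thesis using l2_outside[OF x] by (simp add: Rot_def)
  next
    case i: True
    note m = mate_I[OF i]
    show ?thesis
    proof (cases "mate i = i")
      case True
      then show ?thesis using i by (simp add: Rot_def diag_def offd_def)
    next
      case False
      then have ne: "mate (mate i) \<noteq> mate i" using m by simp
      have up: "upper (mate i) = (\<not> upper i)" by (rule upper_mate[OF i False])
      let ?k = "complex_of_real kap"
      have "?k * (?k * a + ?k * b) + ?k * (?k * a - ?k * b) = 2 * (?k * ?k) * a"
        "?k * (?k * b + ?k * a) - ?k * (?k * b - ?k * a) = 2 * (?k * ?k) * a" for a b
        by (simp_all add: algebra_simps)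
      then show ?thesis
        using False ne up i m unfolding kap(4)
        by (cases "upper i") (simp_all add: Rot_def diag_def offd_def)
    qed
  qed
qed

lemma Rot_restr:
  assumes "\<And>i. i \<in> I \<Longrightarrow> mate i \<in> D \<longleftrightarrow> i \<in> D"
  shows "Rot (restr D x) = restr D (Rot x)"
  using assms by (auto simp: Rot_def restr_def fun_eq_iff)

lemma Rot_Sv: "Rot (Sv v x) = Sv v (Rot x)"
  unfolding Sv_def by (rule Rot_restr) (simp add: mate_I)

lemma Tr'_Tr: "e \<in> E \<Longrightarrow> Tr' e (Tr e x) = Sv (s e) x"
  using cons_I by (auto simp: Tr_def Tr'_def Sv_def pw_def restr_def fun_eq_iff)

lemma Tr_Tr': "e \<in> E \<Longrightarrow> Tr e (Tr' e x) = restr {i \<in> I. first i = Some e} x"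
  using first_Some by (auto simp: Tr_def Tr'_def Sv_def pw_def restr_def fun_eq_iff)

lemma Tr_l2: "e \<in> E \<Longrightarrow> x \<in> l2 I \<Longrightarrow> Tr e x \<in> l2 I"
  by (rule bounded_op_l2[OF adjoint_bounded(1)[OF Tr_adjoint]])

lemma Se'_Se: "e \<in> E \<Longrightarrow> x \<in> l2 I \<Longrightarrow> Se' e (Se e x) = Sv (s e) x"
  by (simp add: Se_def Se'_def Rot_Rot Tr_l2 Tr'_Tr)

lemma sum_Se_Se':
  assumes F: "finite F" "F \<subseteq> E" and x: "x \<in> l2 I"
  shows "(\<lambda>i. \<Sum>e\<in>F. Se e (Se' e x) i) = Rot (restr {i \<in> I. \<exists>e\<in>F. first i = Some e} (Rot x))"
proof -
  let ?z = "Rot x"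
  have z: "?z \<in> l2 I" by (rule Rot_l2[OF x])
  have "(\<lambda>i. \<Sum>e\<in>F. Se e (Se' e x) i) = (\<lambda>i. \<Sum>e\<in>F. Rot (restr {i \<in> I. first i = Some e} ?z) i)"
    using F by (auto simp: Se_def Se'_def Tr_Tr' fun_eq_iff intro!: sum.cong)
  also have "\<dots> = Rot (\<lambda>i. \<Sum>e\<in>F. restr {i \<in> I. first i = Some e} ?z i)"
    by (rule bounded_op_sum_vec[OF adjoint_bounded(1)[OF Rot_adjoint] restr_l2[OF z], symmetric])
  also have "(\<lambda>i. \<Sum>e\<in>F. restr {i \<in> I. first i = Some e} ?z i) = restr {i \<in> I. \<exists>e\<in>F. first i = Some e} ?z"
  proof
    fix i
    show "(\<Sum>e\<in>F. restr {i \<in> I. first i = Some e} ?z i) = restr {i \<in> I. \<exists>e\<in>F. first i = Some e} ?z i"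
    proof (cases "i \<in> I \<and> (\<exists>e\<in>F. first i = Some e)")
      case True
      then obtain e where e: "e \<in> F" "first i = Some e" by blast
      have "(\<Sum>e\<in>F. restr {i \<in> I. first i = Some e} ?z i) = (\<Sum>e\<in>{e}. restr {i \<in> I. first i = Some e} ?z i)"
        by (rule sum.mono_neutral_right) (use F e in \<open>auto simp: restr_def\<close>)
      then show ?thesis using True e by (auto simp: restr_def)
    qed (auto simp: restr_def)
  qed
  finally show ?thesis .
qed

theorem ck: "ck_family I V E r s Sv Se"
  unfolding ck_family_def tck_family_def
proof (intro conjI ballI allI impI)
  show "is_projection I (Sv v)" for v
    using Sv_adjoint by (auto simp: is_projection_def Sv_def restr_def fun_eq_iff)
  show "Sv v (Sv w x) = (\<lambda>i. 0)" if "v \<noteq> w" for v w x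
    using that by (auto simp: Sv_def restr_def fun_eq_iff)
  show "\<exists>A. is_adjoint I (Se e) A \<and> (\<forall>x\<in>l2 I. A (Se e x) = Sv (s e) x)" if "e \<in> E" for e
    using Se_adjoint[OF that] Se'_Se[OF that] by blast
  show "\<exists>A. (\<forall>e\<in>F. is_adjoint I (Se e) (A e)) \<and> op_le I (\<lambda>x i. \<Sum>e\<in>F. Se e (A e x) i) (Sv v)"
    if F: "finite F \<and> F \<subseteq> {e \<in> E. r e = v}" for F v
  proof (intro exI[of _ Se'] conjI ballI)
    show "is_adjoint I (Se e) (Se' e)" if "e \<in> F" for e using that F by (intro Se_adjoint) auto
    show "op_le I (\<lambda>x i. \<Sum>e\<in>F. Se e (Se' e x) i) (Sv v)"
      unfolding op_le_def
    proof
      fix x assume x: "x \<in> l2 I"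
      define z where "z = Rot x"
      have z: "z \<in> l2 I" unfolding z_def by (rule Rot_l2[OF x])
      let ?D = "{i \<in> I. \<exists>e\<in>F. first i = Some e}"
      define w where "w = restr ({i \<in> I. rng i = v} - ?D) z"
      have w: "w \<in> l2 I" unfolding w_def by (rule restr_l2[OF z])
      have sub: "?D \<subseteq> {i \<in> I. rng i = v}" using F first_Some by fastforce
      have "(\<lambda>i. Sv v x i - (\<Sum>e\<in>F. Se e (Se' e x) i)) = (\<lambda>i. Rot (Sv v z) i - Rot (restr ?D z) i)"
        using sum_Se_Se'[of F x] F x by (auto simp: z_def Rot_Sv Rot_Rot fun_eq_iff)
      also have "\<dots> = Rot (\<lambda>i. Sv v z i - restr ?D z i)"
        unfolding Sv_def
        by (rule bounded_op_diff_vec[OF adjoint_bounded(1)[OF Rot_adjoint] restr_l2[OF z] restr_l2[OF z], symmetric])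
      also have "(\<lambda>i. Sv v z i - restr ?D z i) = w"
        using sub by (auto simp: Sv_def restr_def w_def fun_eq_iff)
      finally have "l2_inner I x (\<lambda>i. Sv v x i - (\<Sum>e\<in>F. Se e (Se' e x) i)) = l2_inner I x (Rot w)"
        by simp
      also have "\<dots> = l2_inner I z w" unfolding z_def by (rule adjoint_inner[OF Rot_adjoint x w, symmetric])
      also have "\<dots> = l2_inner I z (restr ({i \<in> I. rng i = v} - ?D) w)"
        by (rule arg_cong[where f = "l2_inner I z"]) (simp add: w_def restr_def fun_eq_iff)
      also have "\<dots> = l2_inner I w w"
        using adjoint_inner[OF restr_adjoint z w, symmetric] by (simp only: w_def[symmetric])
      also have "\<dots> = of_real (sqn I w)" by (rule inner_self[OF w])
      finally show "Im (l2_inner I x (\<lambda>i. Sv v x i - (\<Sum>e\<in>F. Se e (Se' e x) i))) = 0 \<and>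
          0 \<le> Re (l2_inner I x (\<lambda>i. Sv v x i - (\<Sum>e\<in>F. Se e (Se' e x) i)))" by simp
    qed
  qed
  show "(\<lambda>i. \<Sum>v\<in>V. Sv v x i) = x" if x: "x \<in> l2 I" for x
  proof
    fix i
    show "(\<Sum>v\<in>V. Sv v x i) = x i"
    proof (cases "i \<in> I")
      case True
      have "(\<Sum>v\<in>V. Sv v x i) = (\<Sum>v\<in>{rng i}. Sv v x i)"
        by (rule sum.mono_neutral_right)
           (use graph True rng_V in \<open>auto simp: finite_graph_def Sv_def restr_def\<close>)
      with True show ?thesis by (simp add: Sv_def restr_def)
    qed (use l2_outside[OF x] in \<open>simp add: Sv_def restr_def\<close>)
  qed
  show "\<exists>A. (\<forall>e\<in>{e \<in> E. r e = v}. is_adjoint I (Se e) (A e)) \<and>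
      (\<forall>x\<in>l2 I. (\<lambda>i. \<Sum>e\<in>{e \<in> E. r e = v}. Se e (A e x) i) = Sv v x)"
    if "0 < card {e \<in> E. r e = v} \<and> finite {e \<in> E. r e = v}" for v
  proof (intro exI[of _ Se'] conjI ballI)
    show "is_adjoint I (Se e) (Se' e)" if "e \<in> {e \<in> E. r e = v}" for e using that by (intro Se_adjoint) auto
    fix x assume x: "x \<in> l2 I"
    have "{i \<in> I. \<exists>e\<in>{e \<in> E. r e = v}. first i = Some e} = {i \<in> I. rng i = v}"
    proof (intro equalityI subsetI)
      fix i assume i: "i \<in> {i \<in> I. rng i = v}"
      obtain e where e: "e \<in> E" "r e = v" using \<open>0 < card {e \<in> E. r e = v} \<and> _\<close> by (auto simp: card_gt_0_iff)
      then have "first i \<noteq> None" using first_None[of i e] i by auto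
      then show "i \<in> {i \<in> I. \<exists>e\<in>{e \<in> E. r e = v}. first i = Some e}" using i first_Some by fastforce
    qed (use first_Some in auto)
    then show "(\<lambda>i. \<Sum>e\<in>{e \<in> E. r e = v}. Se e (Se' e x) i) = Sv v x"
      using sum_Se_Se'[of "{e \<in> E. r e = v}" x] that x
      by (simp add: Sv_def[symmetric] Rot_Sv Rot_Rot)
  qed
qed

end

section \<open>Words and matrix units\<close>

context path_rep
begin

definition alg :: "'i op set" where "alg = alg_gen (Sv ` V \<union> Se ` E)"

abbreviation clos :: "'i op set" where "clos \<equiv> wot_closure I alg"

definition munit :: "'i \<Rightarrow> 'i \<Rightarrow> 'i op" where
  "munit i j = (\<lambda>x k. x j * delta i k)"

lemma op_algebra_alg: "V \<noteq> {} \<Longrightarrow> op_algebra I alg"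
  unfolding alg_def by (rule op_algebra_alg_gen) (use Se_adjoint Sv_adjoint in blast)+

definition in_alg :: "'i op \<Rightarrow> bool" where
  "in_alg T \<longleftrightarrow> (\<exists>B\<in>alg. \<forall>x\<in>l2 I. T x = B x)"

lemma in_algI: "B \<in> alg \<Longrightarrow> (\<And>x. x \<in> l2 I \<Longrightarrow> T x = B x) \<Longrightarrow> in_alg T"
  unfolding in_alg_def by (rule bexI) (rule ballI)

lemma in_algE:
  assumes "in_alg T" obtains B where "B \<in> alg" "\<forall>x\<in>l2 I. T x = B x"
proof -
  from assms obtain B where B: "B \<in> alg" "\<forall>x\<in>l2 I. T x = B x" unfolding in_alg_def by (elim bexE)
  show thesis by (rule that[OF B])
qed

lemma in_alg_Se: "e \<in> E \<Longrightarrow> in_alg (Se e)"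
  by (rule in_algI[of "Se e"]) (simp_all add: alg_def alg_gen.gen)

lemma in_alg_Sv: "v \<in> V \<Longrightarrow> in_alg (Sv v)"
  by (rule in_algI[of "Sv v"]) (simp_all add: alg_def alg_gen.gen)

lemma in_alg_add:
  assumes "in_alg T" "in_alg U" shows "in_alg (\<lambda>x i. T x i + U x i)"
proof -
  obtain B where B: "B \<in> alg" "\<forall>x\<in>l2 I. T x = B x" by (rule in_algE[OF assms(1)])
  obtain C where C: "C \<in> alg" "\<forall>x\<in>l2 I. U x = C x" by (rule in_algE[OF assms(2)])
  have "(\<lambda>x i. B x i + C x i) \<in> alg" using B(1) C(1) unfolding alg_def by (rule alg_gen.add)
  then show ?thesis by (rule in_algI) (simp only: B(2)[rule_format] C(2)[rule_format])
qed

lemma in_alg_scale: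
  assumes "in_alg T" shows "in_alg (\<lambda>x i. a * T x i)"
proof -
  obtain B where B: "B \<in> alg" "\<forall>x\<in>l2 I. T x = B x" by (rule in_algE[OF assms])
  have "(\<lambda>x i. a * B x i) \<in> alg" using B(1) unfolding alg_def by (rule alg_gen.smult)
  then show ?thesis by (rule in_algI) (simp only: B(2)[rule_format])
qed

lemma alg_l2: "V \<noteq> {} \<Longrightarrow> B \<in> alg \<Longrightarrow> x \<in> l2 I \<Longrightarrow> B x \<in> l2 I"
  by (rule bounded_op_l2[OF op_algebra.bounded[OF op_algebra_alg]])

lemma in_alg_comp:
  assumes "in_alg T" "in_alg U" and V: "V \<noteq> {}" shows "in_alg (\<lambda>x. T (U x))"
proof -
  obtain B where B: "B \<in> alg" "\<forall>x\<in>l2 I. T x = B x" by (rule in_algE[OF assms(1)])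
  obtain C where C: "C \<in> alg" "\<forall>x\<in>l2 I. U x = C x" by (rule in_algE[OF assms(2)])
  have "(\<lambda>x. B (C x)) \<in> alg" using B(1) C(1) unfolding alg_def by (rule alg_gen.mult)
  then show ?thesis by (rule in_algI) (simp only: B(2)[rule_format] C(2)[rule_format] alg_l2[OF V C(1)])
qed

lemma in_alg_zero: "V \<noteq> {} \<Longrightarrow> in_alg (\<lambda>x i. 0)"
proof -
  assume "V \<noteq> {}"
  then obtain v where "v \<in> V" by blast
  from in_alg_scale[OF in_alg_Sv[OF this], of 0] show ?thesis by simp
qed

lemma in_alg_sum:
  assumes "V \<noteq> {}" "\<And>k. k \<in> K \<Longrightarrow> in_alg (T k)" shows "in_alg (\<lambda>x i. \<Sum>k\<in>K. T k x i)"
  using assms(2)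
proof (induction K rule: infinite_finite_induct)
  case (insert k K)
  have "in_alg (\<lambda>x i. T k x i + (\<Sum>k\<in>K. T k x i))"
    by (rule in_alg_add[OF insert.prems insert.IH[OF insert.prems]]) auto
  then show ?case by (simp only: sum.insert[OF insert.hyps])
next
  case (infinite K)
  show ?case by (simp only: sum.infinite[OF infinite.hyps] in_alg_zero[OF assms(1)])
next
  case empty
  show ?case by (simp only: sum.empty in_alg_zero[OF assms(1)])
qed

lemma in_alg_cong:
  assumes "in_alg T" "\<And>x. x \<in> l2 I \<Longrightarrow> U x = T x" shows "in_alg U"
proof -
  obtain B where B: "B \<in> alg" "\<forall>x\<in>l2 I. T x = B x" by (rule in_algE[OF assms(1)])
  show ?thesis by (rule in_algI[OF B(1)]) (rule trans[OF assms(2) B(2)[rule_format]])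
qed

lemma Sv_sum: "x \<in> l2 I \<Longrightarrow> (\<lambda>i. \<Sum>v\<in>V. Sv v x i) = x"
  using ck by (simp add: ck_family_def tck_family_def)

lemma in_alg_id: "V \<noteq> {} \<Longrightarrow> in_alg (\<lambda>x. x)"
  by (rule in_alg_cong[OF in_alg_sum[OF _ in_alg_Sv, where K = V]]) (assumption+, rule Sv_sum[symmetric])

fun Sw :: "'e list \<Rightarrow> 'i op" where
  "Sw [] x = x"
| "Sw (e # w) x = Se e (Sw w x)"

lemma Sw_append: "Sw (u @ w) x = Sw u (Sw w x)"
  by (induction u) auto

lemma in_alg_Sw: "V \<noteq> {} \<Longrightarrow> set w \<subseteq> E \<Longrightarrow> in_alg (Sw w)"
proof (induction w)
  case Nil
  then show ?case by (intro in_alg_cong[OF in_alg_id]) auto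
next
  case (Cons e w)
  then have "in_alg (Sw w)" "in_alg (Se e)" using in_alg_Se by auto
  from in_alg_comp[OF this(2,1) Cons.prems(1)] show ?case by (rule in_alg_cong) (rule Sw.simps)
qed

lemma in_alg_bounded: "V \<noteq> {} \<Longrightarrow> in_alg T \<Longrightarrow> bounded_op I T"
proof -
  assume V: "V \<noteq> {}" and T: "in_alg T"
  obtain B where B: "B \<in> alg" "\<forall>x\<in>l2 I. T x = B x" by (rule in_algE[OF T])
  show "bounded_op I T"
    by (rule bounded_op_cong[OF op_algebra.bounded[OF op_algebra_alg[OF V] B(1)] B(2)[rule_format, symmetric]])
qed

lemma Se_l2: "e \<in> E \<Longrightarrow> x \<in> l2 I \<Longrightarrow> Se e x \<in> l2 I"
  by (rule bounded_op_l2[OF adjoint_bounded(1)[OF Se_adjoint]])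

lemma sqn_Se_le:
  assumes e: "e \<in> E" and x: "x \<in> l2 I" shows "sqn I (Se e x) \<le> sqn I x"
proof -
  have "complex_of_real (sqn I (Se e x)) = l2_inner I x (Sv (s e) x)"
    using adjoint_inner[OF Se_adjoint[OF e] x Se_l2[OF e x]]
    by (simp add: inner_self[OF Se_l2[OF e x]] Se'_Se[OF e x])
  also have "\<dots> = l2_inner I (Sv (s e) x) (Sv (s e) x)"
  proof -
    have "Sv (s e) (Sv (s e) x) = Sv (s e) x" by (auto simp: Sv_def restr_def)
    then show ?thesis
      using adjoint_inner[OF Sv_adjoint x, of "Sv (s e) x" "s e"] restr_l2[OF x]
      by (simp add: Sv_def)
  qed
  also have "\<dots> = of_real (sqn I (Sv (s e) x))"
    by (rule inner_self) (simp add: Sv_def restr_l2 x)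
  finally have "sqn I (Se e x) = sqn I (Sv (s e) x)" by (simp only: of_real_eq_iff)
  also have "\<dots> \<le> sqn I x"
    using power_mono[OF restr_norm_le[OF x, of "{i \<in> I. rng i = s e}"] l2_norm_nonneg, where n = 2]
    by (simp add: Sv_def l2_norm_power2)
  finally show ?thesis .
qed

lemma Sw_l2: "set w \<subseteq> E \<Longrightarrow> x \<in> l2 I \<Longrightarrow> Sw w x \<in> l2 I"
  by (induction w) (auto simp: Se_l2)

lemma sqn_Sw_le: "set w \<subseteq> E \<Longrightarrow> x \<in> l2 I \<Longrightarrow> sqn I (Sw w x) \<le> sqn I x"
proof (induction w)
  case (Cons e w)
  then have "sqn I (Se e (Sw w x)) \<le> sqn I (Sw w x)" by (intro sqn_Se_le Sw_l2) auto
  with Cons show ?case by simp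
qed simp

lemma inner_Se_orth:
  assumes e: "e \<in> E" "e' \<in> E" "e \<noteq> e'" and x: "x \<in> l2 I" and y: "y \<in> l2 I"
  shows "l2_inner I (Se e x) (Se e' y) = 0"
proof -
  note t = Tr_l2[OF e(1) x] Tr_l2[OF e(2) y]
  have "l2_inner I (Se e x) (Se e' y) = l2_inner I (Tr e x) (Tr e' y)"
    using adjoint_inner[OF Rot_adjoint t(1) Rot_l2[OF t(2)]] by (simp add: Se_def Rot_Rot t)
  also have "\<dots> = 0"
    unfolding l2_inner_def by (rule infsum_0) (use e in \<open>auto simp: Tr_def pw_def\<close>)
  finally show ?thesis .
qed

lemma Se_entry:
  assumes "i \<in> I"
  shows "Se e x i = of_real (diag i) * (if first i = Some e then x (rest i) else 0)
    + of_real (offd i) * (if first (mate i) = Some e then x (rest (mate i)) else 0)"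
  using assms mate_I[of i] by (auto simp: Se_def Rot_def Tr_def pw_def)

lemma Se_outside: "i \<notin> I \<Longrightarrow> Se e x i = 0"
  by (simp add: Se_def Rot_def)

lemma Se_entry_single: "i \<in> I \<Longrightarrow> mate i = i \<Longrightarrow> Se e x i = (if first i = Some e then x (rest i) else 0)"
  by (simp add: Se_entry diag_def offd_def)

lemma Se_entry_own: "i \<in> I \<Longrightarrow> first i = Some e \<Longrightarrow> Se e x i = of_real (diag i) * x (rest i)"
  using first_mate[of i] by (cases "mate i = i") (auto simp: Se_entry offd_def)

lemma rest_inj: "i \<in> I \<Longrightarrow> j \<in> I \<Longrightarrow> first i = Some e \<Longrightarrow> first j = Some e \<Longrightarrow> rest i = rest j \<Longrightarrow> i = j"
  using first_Some by metis

fun reads :: "'e list \<Rightarrow> 'i \<Rightarrow> 'i \<Rightarrow> bool" where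
  "reads [] i p \<longleftrightarrow> i = p"
| "reads (e # w) i p \<longleftrightarrow> i \<in> I \<and> first i = Some e \<and> reads w (rest i) p"

text \<open>A plain reading only passes basis vectors fixed by the reflection, except for its endpoint.\<close>
fun plain :: "'e list \<Rightarrow> 'i \<Rightarrow> 'i \<Rightarrow> bool" where
  "plain [] i p \<longleftrightarrow> i = p"
| "plain (e # w) i p \<longleftrightarrow> i \<in> I \<and> mate i = i \<and> first i = Some e \<and> plain w (rest i) p"

lemma plain_edges: "plain w i p \<Longrightarrow> set w \<subseteq> E"
  by (induction w arbitrary: i) (use first_Some in auto)

lemma reads_edges: "reads w i p \<Longrightarrow> set w \<subseteq> E"
  by (induction w arbitrary: i) (use first_Some in auto)

lemma Sw_plain: "plain w i p \<Longrightarrow> Sw w y i = y p"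
  by (induction w arbitrary: i) (auto simp: Se_entry_single)

lemma Sw_reads: "reads w i p \<Longrightarrow> \<exists>c. c \<noteq> 0 \<and> (\<forall>y. Sw w y i = c * y p)"
proof (induction w arbitrary: i)
  case Nil
  then show ?case by (intro exI[of _ 1]) auto
next
  case (Cons e w)
  then obtain c where c: "c \<noteq> 0" "\<And>y. Sw w y (rest i) = c * y p" by auto
  have "diag i \<noteq> 0" using kap(2) by (auto simp: diag_def)
  then show ?case
    using c Cons.prems by (intro exI[of _ "of_real (diag i) * c"]) (auto simp: Se_entry_own)
qed

lemma Sw_plain_other:
  assumes "plain w j p" "i \<noteq> j" "\<And>i'. i' \<noteq> p \<Longrightarrow> cmod (y i') \<le> M" "0 \<le> M"
  shows "cmod (Sw w y i) \<le> M"
  using assms(1,2)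
proof (induction w arbitrary: i j)
  case Nil
  then show ?case using assms(3) by auto
next
  case (Cons e w)
  then have j: "j \<in> I" "mate j = j" "first j = Some e" "plain w (rest j) p" by auto
  show ?case
  proof (cases "i \<in> I")
    case False
    then show ?thesis by (simp add: Se_outside assms(4))
  next
    case i: True
    have m: "mate i \<in> I" "mate (mate i) = i" using mate_I[OF i] by auto
    have IH: "cmod (Sw w y (rest k)) \<le> M" if "k \<in> I" "first k = Some e" "k \<noteq> j" for k
      using Cons.IH[OF j(4)] rest_inj[OF that(1) j(1) that(2) j(3)] that(3) by blast
    have le: "cmod (of_real c * z) \<le> M" if "\<bar>c\<bar> \<le> 1" "cmod z \<le> M" for c z
      using mult_mono[OF that] by (simp add: norm_mult)
    consider "first i = Some e" | "first i \<noteq> Some e" "first (mate i) = Some e"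
      | "first i \<noteq> Some e" "first (mate i) \<noteq> Some e" by blast
    then show ?thesis
    proof cases
      case 1
      then show ?thesis using le[OF diag_le IH[OF i 1 Cons.prems(2)]] by (simp add: Se_entry_own i)
    next
      case 2
      have "mate i \<noteq> j" using j(2) m(2) Cons.prems(2) by auto
      then show ?thesis using le[OF offd_le IH[OF m(1) 2(2)]] 2 by (simp add: Se_entry i)
    qed (simp add: Se_entry i assms(4))
  qed
qed

lemma Sw_mismatch:
  assumes "plain u i j" "j \<in> I" "mate j = j" "first j \<noteq> Some e"
  shows "Sw (u @ e # w) y i = 0"
  using assms by (simp add: Sw_append Sw_plain Se_entry_single)

lemma Sw_delta: "plain w i p \<Longrightarrow> Sw w (delta p) = delta i"
proof
  fix k assume pl: "plain w i p"
  show "Sw w (delta p) k = delta i k"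
  proof (cases "k = i")
    case False
    then have "cmod (Sw w (delta p) k) \<le> 0" by (intro Sw_plain_other[OF pl]) auto
    with False show ?thesis by simp
  qed (simp add: Sw_plain[OF pl])
qed

lemma munit_bounded: "i \<in> I \<Longrightarrow> j \<in> I \<Longrightarrow> bounded_op I (munit i j)"
proof (rule bounded_opI)
  fix x assume i: "i \<in> I" and j: "j \<in> I" and x: "x \<in> l2 I"
  show "munit i j x \<in> l2 I" unfolding munit_def by (intro l2_scale delta_l2 i)
  show "sqn I (munit i j x) \<le> 1 * sqn I x"
    unfolding munit_def sqn_scale using cmod_le_sqn[OF x j] i by simp
  fix y a
  show "munit i j (\<lambda>k. a * x k + y k) = (\<lambda>k. a * munit i j x k + munit i j y k)"
    by (simp add: munit_def algebra_simps)
qed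

lemma clos_left:
  assumes "V \<noteq> {}" "in_alg B" "T \<in> clos" shows "(\<lambda>x. B (T x)) \<in> clos"
proof -
  obtain C where C: "C \<in> alg" "\<forall>x\<in>l2 I. B x = C x" by (rule in_algE[OF assms(2)])
  show ?thesis
  proof (rule wot_closure_cong[OF op_algebra.closure_mult_left[OF op_algebra_alg[OF assms(1)] C(1) assms(3)]])
    fix x assume "x \<in> l2 I"
    then have "T x \<in> l2 I" by (rule bounded_op_l2[OF wot_closure_bounded[OF assms(3)]])
    then show "C (T x) = B (T x)" by (rule C(2)[rule_format, symmetric])
  qed
qed

lemma clos_right:
  assumes "V \<noteq> {}" "in_alg B" "T \<in> clos" shows "(\<lambda>x. T (B x)) \<in> clos"
proof -
  obtain C where C: "C \<in> alg" "\<forall>x\<in>l2 I. B x = C x" by (rule in_algE[OF assms(2)])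
  show ?thesis
    by (rule wot_closure_cong[OF op_algebra.closure_mult_right[OF op_algebra_alg[OF assms(1)] C(1) assms(3)]])
       (simp only: C(2)[rule_format])
qed

lemma munit_right:
  assumes V: "V \<noteq> {}" and T: "munit i j \<in> clos" and w: "reads w j p"
  shows "munit i p \<in> clos"
proof -
  obtain c where c: "c \<noteq> 0" "\<And>y. Sw w y j = c * y p" using Sw_reads[OF w] by blast
  have "(\<lambda>x. munit i j (Sw w x)) \<in> clos"
    by (rule clos_right[OF V in_alg_Sw[OF V reads_edges[OF w]] T])
  then have "(\<lambda>x k. inverse c * munit i j (Sw w x) k) \<in> clos"
    by (rule op_algebra.closure_scale[OF op_algebra_alg[OF V]])
  also have "(\<lambda>x k. inverse c * munit i j (Sw w x) k) = munit i p"
    using c(1) by (simp add: munit_def c(2) fun_eq_iff)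
  finally show ?thesis .
qed

lemma munit_left:
  assumes V: "V \<noteq> {}" and T: "munit p j \<in> clos" and w: "plain w i p" and j: "j \<in> I" and p: "p \<in> I"
  shows "munit i j \<in> clos"
proof -
  have "Sw w (munit p j x) = munit i j x" for x
    unfolding munit_def
    using bounded_op_scale_vec[OF in_alg_bounded[OF V in_alg_Sw[OF V plain_edges[OF w]]] delta_l2[OF p]]
    by (simp add: Sw_delta[OF w])
  then show ?thesis using clos_left[OF V in_alg_Sw[OF V plain_edges[OF w]] T] by simp
qed

end

section \<open>Branching components\<close>

locale branch = path_rep I V E r s rng first rest cons mate upper
  for I :: "'i set" and V :: "'v set" and E :: "'e set" and r s :: "'e \<Rightarrow> 'v"
    and rng :: "'i \<Rightarrow> 'v" and first :: "'i \<Rightarrow> 'e option" and rest :: "'i \<Rightarrow> 'i"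
    and cons :: "'e \<Rightarrow> 'i \<Rightarrow> 'i" and mate :: "'i \<Rightarrow> 'i" and upper :: "'i \<Rightarrow> bool" +
  fixes e0 e1 :: 'e and sp :: "nat \<Rightarrow> 'i" and a :: "nat \<Rightarrow> 'e list" and ret :: "nat \<Rightarrow> nat"
    and l1 :: "'e list" and pre :: "nat \<Rightarrow> 'e list" and tgt :: "nat \<Rightarrow> 'i"
  assumes e01: "e0 \<in> E" "e1 \<in> E" "e0 \<noteq> e1"
    and sp_I: "sp k \<in> I"
    and mate_sp: "mate (sp (2 * t)) = sp (2 * t + 1)"
    and sp_inj: "inj sp"
    and upper_sp: "upper (sp (2 * t))"
    and first_even: "first (sp (2 * t)) = Some e0"
    and first_odd: "first (sp (2 * t + 1)) = Some e1"
    and plain_a: "plain (a t) (rest (sp (2 * t))) (sp (ret t))"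
    and plain_l1: "plain l1 (rest (sp (2 * t + 1))) (sp (2 * t + 2))"
    and other_pairs: "i \<in> I \<Longrightarrow> mate i \<noteq> i \<Longrightarrow> i \<notin> range sp \<Longrightarrow> first i \<noteq> Some e0 \<and> first i \<noteq> Some e1"
    and mismatch: "t \<noteq> u \<Longrightarrow> \<exists>w j e w'. a t = w @ e # w' \<and> plain w (rest (sp (2 * u))) j \<and>
      j \<in> I \<and> mate j = j \<and> first j \<noteq> Some e"
    and ret_odd: "odd t \<Longrightarrow> ret t = 0"
    and plain_pre: "plain (pre t) (rest (sp (2 * t))) (tgt t)"
begin

lemma V_ne: "V \<noteq> {}"
  using rng_V sp_I by blast

lemma sp_eq: "sp k = sp l \<longleftrightarrow> k = l"
  using sp_inj by (auto simp: inj_def)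

lemma mate_sp_odd: "mate (sp (2 * t + 1)) = sp (2 * t)"
  using mate_I[OF sp_I] mate_sp by metis

lemma diag_sp: "diag (sp (2 * t)) = kap" "diag (sp (2 * t + 1)) = - kap"
  and offd_sp: "offd (sp (2 * t)) = kap" "offd (sp (2 * t + 1)) = kap"
  and mate_ne: "mate (sp (2 * t)) \<noteq> sp (2 * t)" "mate (sp (2 * t + 1)) \<noteq> sp (2 * t + 1)"
proof -
  show ne: "mate (sp (2 * t)) \<noteq> sp (2 * t)" "mate (sp (2 * t + 1)) \<noteq> sp (2 * t + 1)"
    unfolding mate_sp mate_sp_odd sp_eq by auto
  have "\<not> upper (sp (2 * t + 1))"
    using upper_mate[OF sp_I ne(1)] upper_sp mate_sp by metis
  then show "diag (sp (2 * t)) = kap" "diag (sp (2 * t + 1)) = - kap"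
    "offd (sp (2 * t)) = kap" "offd (sp (2 * t + 1)) = kap"
    using ne upper_sp by (simp_all add: diag_def offd_def)
qed

lemma edges: "set (a t) \<subseteq> E" "set l1 \<subseteq> E" "set (pre t) \<subseteq> E"
  using plain_edges plain_a plain_l1 plain_pre by blast+

definition comb :: "real \<Rightarrow> 'i vec \<Rightarrow> 'i vec \<Rightarrow> 'i vec" where
  "comb g y z = (\<lambda>i. of_real kap * (Se e0 y i + of_real g * Se e1 z i))"

lemma comb_even: "comb g y z (sp (2 * t)) = (y (rest (sp (2 * t))) + of_real g * z (rest (sp (2 * t + 1)))) / 2"
proof -
  have 0: "Se e0 y (sp (2 * t)) = of_real kap * y (rest (sp (2 * t)))"
    by (simp only: Se_entry_own[OF sp_I first_even] diag_sp)
  have 1: "Se e1 z (sp (2 * t)) = of_real kap * z (rest (sp (2 * t + 1)))"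
    using e01(3) by (simp add: Se_entry[OF sp_I] diag_sp offd_sp mate_sp first_even first_odd[simplified])
  have "comb g y z (sp (2 * t)) = (of_real kap * of_real kap) *
      (y (rest (sp (2 * t))) + of_real g * z (rest (sp (2 * t + 1))))"
    unfolding comb_def 0 1 by (simp only: algebra_simps)
  then show ?thesis unfolding kap(4) by simp
qed

lemma comb_odd: "comb g y z (sp (2 * t + 1)) = (y (rest (sp (2 * t))) - of_real g * z (rest (sp (2 * t + 1)))) / 2"
proof -
  have 0: "Se e1 z (sp (2 * t + 1)) = - of_real kap * z (rest (sp (2 * t + 1)))"
    unfolding Se_entry_own[OF sp_I first_odd] diag_sp by simp
  have 1: "Se e0 y (sp (2 * t + 1)) = of_real kap * y (rest (sp (2 * t)))"
    using e01(3) unfolding Se_entry[OF sp_I] diag_sp offd_sp mate_sp_odd first_even first_odd by simp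
  have "comb g y z (sp (2 * t + 1)) = (of_real kap * of_real kap) *
      (y (rest (sp (2 * t))) - of_real g * z (rest (sp (2 * t + 1))))"
    unfolding comb_def 0 1 by (simp add: algebra_simps)
  then show ?thesis unfolding kap(4) by simp
qed

lemma comb_single:
  assumes "i \<in> I" "mate i = i"
  shows "comb g y z i = of_real kap * (if first i = Some e0 then y (rest i)
    else if first i = Some e1 then of_real g * z (rest i) else 0)"
  using e01(3) by (simp add: comb_def Se_entry_single assms)

lemma comb_other:
  assumes "i \<in> I" "mate i \<noteq> i" "i \<notin> range sp"
  shows "comb g y z i = 0"
proof -
  have m: "mate i \<in> I" "mate (mate i) \<noteq> mate i" using mate_I[OF assms(1)] assms(2) by auto
  have "mate i \<notin> range sp"
  proof
    assume "mate i \<in> range sp"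
    then obtain k where k: "mate i = sp k" by blast
    have i: "i = mate (sp k)" using mate_I[OF assms(1)] k by simp
    show False
    proof (cases "even k")
      case True
      then show False using i mate_sp assms(3) by (auto elim!: evenE)
    next
      case False
      then show False using i mate_sp_odd assms(3) by (auto elim!: oddE)
    qed
  qed
  then show ?thesis
    using other_pairs[OF assms] other_pairs[OF m] by (simp add: comb_def Se_entry assms(1))
qed

lemma comb_outside: "i \<notin> I \<Longrightarrow> comb g y z i = 0"
  by (simp add: comb_def Se_outside)

lemma sqn_comb:
  assumes g: "\<bar>g\<bar> = 1" and y: "y \<in> l2 I" and z: "z \<in> l2 I"
    and le: "sqn I y \<le> M" "sqn I z \<le> M"
  shows "sqn I (comb g y z) \<le> M"
proof -
  note yz = Se_l2[OF e01(1) y] Se_l2[OF e01(2) z]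
  have "sqn I (comb g y z) = (cmod (of_real kap))\<^sup>2 * sqn I (\<lambda>i. Se e0 y i + of_real g * Se e1 z i)"
    unfolding comb_def by (rule sqn_scale)
  also have "sqn I (\<lambda>i. Se e0 y i + of_real g * Se e1 z i) = sqn I (Se e0 y) + sqn I (Se e1 z)"
    using g inner_Se_orth[OF e01 y z]
    by (simp add: sqn_add[OF yz(1) l2_scale[OF yz(2)]] sqn_scale inner_scale_right)
  also have "(cmod (of_real kap))\<^sup>2 = 1 / 2" using kap(1,2) by (simp add: power2_eq_square)
  finally show ?thesis
    using sqn_Se_le[OF e01(1) y] sqn_Se_le[OF e01(2) z] le by simp
qed

definition sgn_of :: "nat \<Rightarrow> real" where "sgn_of k = (if even k then 1 else -1)"

text \<open>Finite-stage solutions of the linear system satisfied by the special basis vectors,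
  with the vector at position \<open>2 * t\<close> prescribed.\<close>
fun X :: "nat \<Rightarrow> nat \<Rightarrow> nat \<Rightarrow> 'i op" where
  "X t 0 k x = (if k = 2 * t then x else (\<lambda>i. 0))"
| "X t (Suc n) k x = (if k = 2 * t then x else
     comb (sgn_of k) (Sw (a (k div 2)) (X t n (ret (k div 2)) x)) (Sw l1 (X t n (2 * (k div 2) + 2) x)))"

text \<open>The probability that the random walk moving from \<open>k\<close> to \<open>ret (k div 2)\<close> or to
  \<open>2 * (k div 2) + 2\<close> hits \<open>2 * t\<close> within \<open>n\<close> steps.\<close>
fun hit :: "nat \<Rightarrow> nat \<Rightarrow> nat \<Rightarrow> real" where
  "hit t 0 k = (if k = 2 * t then 1 else 0)"
| "hit t (Suc n) k = (if k = 2 * t then 1 else (hit t n (ret (k div 2)) + hit t n (2 * (k div 2) + 2)) / 2)"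

fun far :: "nat \<Rightarrow> nat \<Rightarrow> nat \<Rightarrow> bool" where
  "far t 0 k \<longleftrightarrow> True"
| "far t (Suc m) k \<longleftrightarrow> k \<noteq> 2 * t \<and> far t m (ret (k div 2)) \<and> far t m (2 * (k div 2) + 2)"

lemma X_l2_sqn: "x \<in> l2 I \<Longrightarrow> X t n k x \<in> l2 I \<and> sqn I (X t n k x) \<le> sqn I x"
proof (induction n arbitrary: k)
  case (Suc n)
  define y where "y = Sw (a (k div 2)) (X t n (ret (k div 2)) x)"
  define z where "z = Sw l1 (X t n (2 * (k div 2) + 2) x)"
  have y: "y \<in> l2 I" "sqn I y \<le> sqn I x"
    using Suc Sw_l2[OF edges(1)] order_trans[OF sqn_Sw_le[OF edges(1)]] by (auto simp: y_def)
  have z: "z \<in> l2 I" "sqn I z \<le> sqn I x"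
    using Suc Sw_l2[OF edges(2)] order_trans[OF sqn_Sw_le[OF edges(2)]] by (auto simp: z_def)
  have "comb (sgn_of k) y z \<in> l2 I"
    unfolding comb_def by (intro l2_scale l2_add Se_l2 e01 y z)
  moreover have "sqn I (comb (sgn_of k) y z) \<le> sqn I x"
    by (rule sqn_comb[OF _ y(1) z(1) y(2) z(2)]) (simp add: sgn_of_def)
  ultimately show ?case using Suc.prems by (simp add: y_def z_def)
qed auto

lemma in_alg_X: "in_alg (X t n k)"
proof (induction n arbitrary: k)
  case 0
  show ?case
  proof (cases "k = 2 * t")
    case True
    show ?thesis by (rule in_alg_cong[OF in_alg_id[OF V_ne]]) (simp add: True)
  next
    case False
    show ?thesis by (rule in_alg_cong[OF in_alg_zero[OF V_ne]]) (simp add: False)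
  qed
next
  case (Suc n)
  show ?case
  proof (cases "k = 2 * t")
    case True
    show ?thesis by (rule in_alg_cong[OF in_alg_id[OF V_ne]]) (simp add: True)
  next
    case False
    note y = in_alg_comp[OF in_alg_Se[OF e01(1)] in_alg_comp[OF in_alg_Sw[OF V_ne edges(1)] Suc.IH V_ne] V_ne]
    note z = in_alg_comp[OF in_alg_Se[OF e01(2)] in_alg_comp[OF in_alg_Sw[OF V_ne edges(2)] Suc.IH V_ne] V_ne]
    show ?thesis
      by (rule in_alg_cong[OF in_alg_scale[OF in_alg_add[OF y[of "k div 2" "ret (k div 2)"]
              in_alg_scale[OF z[of "2 * (k div 2) + 2"], of "of_real (sgn_of k)"]], of "of_real kap"]])
         (simp add: False comb_def)
  qed
qed

lemma nat_even_or_odd: "\<exists>u. k = 2 * u \<or> k = 2 * u + (1::nat)"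
  by (metis evenE oddE)

lemma hit_self: "hit t n (2 * t) = 1"
  by (cases n) auto

lemma hit_step: "k \<noteq> 2 * t \<Longrightarrow>
  hit t (Suc n) k = (hit t n (ret (k div 2)) + hit t n (2 * (k div 2) + 2)) / 2"
  by (simp only: hit.simps if_False)

lemma average_le: "1 - x \<le> c \<Longrightarrow> 1 - y \<le> d \<Longrightarrow> 1 - (x + y) / 2 \<le> (c + d) / (2::real)"
  by (simp add: field_simps)

lemma half_diff_le:
  "1 - x \<le> d \<Longrightarrow> 1 - y \<le> d \<Longrightarrow> x \<le> 1 \<Longrightarrow> y \<le> 1 \<Longrightarrow> 0 \<le> d \<Longrightarrow> \<bar>(x - y) / 2\<bar> \<le> (d::real)"
  by (simp add: abs_le_iff field_simps)

lemma X_sp: "X t n k x (sp k) = of_real (hit t n k) * x (sp (2 * t))"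
proof (induction n arbitrary: k)
  case (Suc n)
  show ?case
  proof (cases "k = 2 * t")
    case False
    obtain u where u: "k = 2 * u \<or> k = 2 * u + 1" using nat_even_or_odd by blast
    then have d: "k div 2 = u" by auto
    have y: "Sw (a u) (X t n (ret u) x) (rest (sp (2 * u))) = of_real (hit t n (ret u)) * x (sp (2 * t))"
      by (simp only: Sw_plain[OF plain_a] Suc.IH)
    have z: "Sw l1 (X t n (2 * u + 2) x) (rest (sp (2 * u + 1))) = of_real (hit t n (2 * u + 2)) * x (sp (2 * t))"
      by (simp only: Sw_plain[OF plain_l1] Suc.IH)
    have "X t (Suc n) k x (sp k) = (of_real (hit t n (ret u)) * x (sp (2 * t)) + of_real (hit t n (2 * u + 2)) * x (sp (2 * t))) / 2"
      using u
    proof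
      assume k: "k = 2 * u"
      have "X t (Suc n) k x (sp k) = comb 1 (Sw (a u) (X t n (ret u) x)) (Sw l1 (X t n (2 * u + 2) x)) (sp (2 * u))"
        using False k by (simp add: sgn_of_def)
      then show ?thesis unfolding comb_even y z by simp
    next
      assume k: "k = 2 * u + 1"
      have "X t (Suc n) k x (sp k) = comb (- 1) (Sw (a u) (X t n (ret u) x)) (Sw l1 (X t n (2 * u + 2) x)) (sp (2 * u + 1))"
        using False k by (simp add: sgn_of_def)
      then show ?thesis unfolding comb_odd y z by simp
    qed
    then show ?thesis using False d by (simp add: algebra_simps add_divide_distrib)
  qed simp
qed simp

lemma hit_bounds: "0 \<le> hit t n k" "hit t n k \<le> 1"
proof -
  have "0 \<le> hit t n k \<and> hit t n k \<le> 1"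
  proof (induction n arbitrary: k)
    case (Suc n)
    show ?case
    proof (cases "k = 2 * t")
      case True
      then show ?thesis by (simp only: hit_self) simp
    next
      case False
      then show ?thesis
        using Suc[of "ret (k div 2)"] Suc[of "2 * (k div 2) + 2"] unfolding hit_step[OF False] by (simp add: field_simps)
    qed
  qed simp
  then show "0 \<le> hit t n k" "hit t n k \<le> 1" by auto
qed

lemma hit_Suc_mono: "hit t n k \<le> hit t (Suc n) k"
proof (induction n arbitrary: k)
  case (Suc n)
  show ?case
  proof (cases "k = 2 * t")
    case True
    then show ?thesis by (simp only: hit_self)
  next
    case False
    show ?thesis
      unfolding hit_step[OF False] by (intro divide_right_mono add_mono Suc) simp
  qed
qed (simp add: hit_bounds)

lemma hit_mono: "n \<le> n' \<Longrightarrow> hit t n k \<le> hit t n' k"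
  by (rule lift_Suc_mono_le[of "\<lambda>n. hit t n k"]) (rule hit_Suc_mono)

lemma hit_climb:
  assumes "\<And>k. 1 - hit t n k \<le> D" "0 \<le> D" "m \<le> t"
  shows "1 - hit t (n + m) (2 * (t - m)) \<le> D * (1 - (1/2) ^ m)"
  using assms(3)
proof (induction m)
  case 0
  show ?case by (simp add: hit_self)
next
  case (Suc m)
  define k where "k = 2 * (t - Suc m)"
  have k: "k div 2 = t - Suc m" "2 * (k div 2) + 2 = 2 * (t - m)" using Suc.prems by (auto simp: k_def)
  have "1 - hit t (n + m) (ret (k div 2)) \<le> D"
    using assms(1)[of "ret (k div 2)"] hit_mono[OF le_add1, of t n "ret (k div 2)" m] by linarith
  moreover have "1 - hit t (n + m) (2 * (t - m)) \<le> D * (1 - (1/2) ^ m)" using Suc by simp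
  moreover have kt: "k \<noteq> 2 * t" using Suc.prems by (simp add: k_def)
  ultimately have "1 - (hit t (n + m) (ret (k div 2)) + hit t (n + m) (2 * (t - m))) / 2 \<le> (D + D * (1 - (1/2) ^ m)) / 2"
    by (intro average_le)
  then have "1 - hit t (n + Suc m) k \<le> (D + D * (1 - (1/2) ^ m)) / 2"
    unfolding add_Suc_right hit_step[OF kt] k(2) .
  also have "\<dots> = D * (1 - (1/2) ^ Suc m)" by (simp add: field_simps)
  finally show ?case by (simp add: k_def)
qed

lemma hit_contract:
  assumes D: "\<And>k. 1 - hit t n k \<le> D" "0 \<le> D"
  shows "1 - hit t (n + t + 2) k \<le> D * (1 - (1/2) ^ (t + 2))"
proof -
  let ?q = "(1/2 :: real) ^ t"
  have q: "0 < ?q" by simp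
  have nn: "n + t + 2 = Suc (Suc (n + t))" by simp
  have zero: "1 - hit t n' 0 \<le> D * (1 - ?q)" if "n + t \<le> n'" for n'
    using hit_climb[OF D, of t] hit_mono[OF that, of t 0] by simp
  have le: "1 - hit t n' k \<le> D" if "n \<le> n'" for n' k
    using D(1)[of k] hit_mono[OF that, of t k] by linarith
  have odd_case: "1 - hit t (Suc n') k \<le> D * (1 - ?q / 2)" if "odd (k div 2)" "n + t \<le> n'" for n' k
  proof (cases "k = 2 * t")
    case True
    then show ?thesis using D(2) q power_le_one[of "1/2::real" t] by simp
  next
    case False
    have "1 - hit t (Suc n') k \<le> (D * (1 - ?q) + D) / 2"
      unfolding hit_step[OF False] ret_odd[OF that(1)]
      by (rule average_le[OF zero[OF that(2)] le]) (use that(2) in simp)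
    also have "\<dots> = D * (1 - ?q / 2)" by (simp add: field_simps)
    finally show ?thesis .
  qed
  have q4: "(1/2::real) ^ (t + 2) = ?q / 4" by (simp add: power_add)
  show ?thesis
  proof (cases "odd (k div 2)")
    case True
    have "D * (1 - ?q / 2) \<le> D * (1 - ?q / 4)" using D(2) q by (intro mult_left_mono) auto
    then show ?thesis using odd_case[OF True, of "n + t + 1"] unfolding q4 by simp
  next
    case False
    show ?thesis
    proof (cases "k = 2 * t")
      case True
      then show ?thesis using D(2) power_le_one[of "1/2::real" "t + 2"] by simp
    next
      case kt: False
      have "odd ((2 * (k div 2) + 2) div 2)" using False by simp
      from odd_case[OF this, of "n + t"]
      have 1: "1 - hit t (Suc (n + t)) (2 * (k div 2) + 2) \<le> D * (1 - ?q / 2)" by simp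
      have 2: "1 - hit t (Suc (n + t)) (ret (k div 2)) \<le> D" by (rule le) simp
      have "1 - hit t (n + t + 2) k \<le> (D + D * (1 - ?q / 2)) / 2"
        unfolding nn hit_step[OF kt] by (rule average_le[OF 2 1])
      also have "\<dots> = D * (1 - ?q / 4)" by (simp add: field_simps)
      finally show ?thesis unfolding q4 .
    qed
  qed
qed

lemma hit_limit:
  assumes "\<epsilon> > 0"
  obtains n0 where "\<And>n k. n0 \<le> n \<Longrightarrow> 1 - hit t n k \<le> \<epsilon>"
proof -
  define c where "c = 1 - (1/2 :: real) ^ (t + 2)"
  have c: "0 \<le> c" "c < 1" using power_le_one[of "1/2::real" "t + 2"] by (auto simp: c_def)
  have iter: "1 - hit t (j * (t + 2)) k \<le> c ^ j" for j k
  proof (induction j arbitrary: k)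
    case 0
    show ?case using hit_bounds(1) by simp
  next
    case (Suc j)
    have "1 - hit t (j * (t + 2) + t + 2) k \<le> c ^ j * (1 - (1/2) ^ (t + 2))"
      by (rule hit_contract) (use Suc c in auto)
    then show ?case by (simp add: c_def algebra_simps)
  qed
  obtain j where j: "c ^ j < \<epsilon>" using real_arch_pow_inv[OF assms c(2)] by blast
  show ?thesis
  proof (rule that)
    fix n k assume "j * (t + 2) \<le> n"
    then show "1 - hit t n k \<le> \<epsilon>" using iter[of j k] hit_mono[of "j * (t + 2)" n t k] j by linarith
  qed
qed

lemma eventually_far: "\<exists>T. \<forall>t\<ge>T. far t m k"
proof (induction m arbitrary: k)
  case (Suc m)
  obtain T1 where T1: "\<forall>t\<ge>T1. far t m (ret (k div 2))" using Suc by blast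
  obtain T2 where T2: "\<forall>t\<ge>T2. far t m (2 * (k div 2) + 2)" using Suc by blast
  show ?case using T1 T2 by (intro exI[of _ "max (Suc k) (max T1 T2)"]) auto
qed simp

lemma kap_ge_half: "1 / 2 \<le> kap"
  using kap by (smt (verit) mult_left_less_imp_less mult_le_cancel_left1)

lemma X_offdiag:
  assumes n0: "\<And>n k. n0 \<le> n \<Longrightarrow> 1 - hit t n k \<le> \<epsilon>" and \<epsilon>: "0 \<le> \<epsilon>" and x: "x \<in> l2 I"
  shows "far t m k \<Longrightarrow> i \<noteq> sp k \<Longrightarrow> cmod (X t (n0 + m) k x i) \<le> (kap ^ m + \<epsilon>) * l2_norm I x"
proof (induction m arbitrary: k i)
  case 0
  have Xl: "X t n0 k x \<in> l2 I" and sq: "sqn I (X t n0 k x) \<le> sqn I x" using X_l2_sqn[OF x] by auto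
  have "cmod (X t n0 k x i) \<le> l2_norm I (X t n0 k x)" by (rule cmod_le_l2_norm[OF Xl])
  also have "\<dots> \<le> l2_norm I x" using sq by (simp add: l2_norm_sqn)
  also have "\<dots> \<le> (1 + \<epsilon>) * l2_norm I x" using \<epsilon> by (simp add: algebra_simps)
  finally show ?case by simp
next
  case (Suc m)
  define N where "N = l2_norm I x"
  have N: "0 \<le> N" by (simp add: N_def)
  define M where "M = (kap ^ m + \<epsilon>) * N"
  have M: "0 \<le> M" using kap(2) \<epsilon> N by (simp add: M_def)
  obtain u where u: "k = 2 * u \<or> k = 2 * u + 1" using nat_even_or_odd by blast
  then have d: "k div 2 = u" by auto
  have kt: "k \<noteq> 2 * t" and f1: "far t m (ret u)" and f2: "far t m (2 * u + 2)"
    using Suc.prems(1) d by auto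
  define y where "y = Sw (a u) (X t (n0 + m) (ret u) x)"
  define z where "z = Sw l1 (X t (n0 + m) (2 * u + 2) x)"
  define g where "g = sgn_of k"
  have g: "\<bar>g\<bar> = 1" by (simp add: g_def sgn_of_def)
  have Xeq: "X t (n0 + Suc m) k x = comb g y z"
    using kt d by (simp add: y_def z_def g_def)
  have yle: "cmod (y j) \<le> M" if "j \<noteq> rest (sp (2 * u))" for j
    unfolding y_def by (rule Sw_plain_other[OF plain_a that _ M]) (use Suc.IH[OF f1] in \<open>simp add: M_def N_def\<close>)
  have zle: "cmod (z j) \<le> M" if "j \<noteq> rest (sp (2 * u + 1))" for j
    unfolding z_def by (rule Sw_plain_other[OF plain_l1 that _ M]) (use Suc.IH[OF f2] in \<open>simp add: M_def N_def\<close>)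
  have kM: "kap * M \<le> (kap ^ Suc m + \<epsilon>) * N"
  proof -
    have "kap * \<epsilon> \<le> \<epsilon>" using kap \<epsilon> by (intro mult_left_le_one_le) auto
    then have "(kap ^ Suc m + kap * \<epsilon>) * N \<le> (kap ^ Suc m + \<epsilon>) * N" by (intro mult_right_mono N) simp
    then show ?thesis by (simp add: M_def algebra_simps)
  qed
  have eN: "\<epsilon> * N \<le> (kap ^ Suc m + \<epsilon>) * N" using kap(2) by (intro mult_right_mono N) simp
  have neq: "rest (sp (2 * v)) \<noteq> rest (sp (2 * u))" "rest (sp (2 * v + 1)) \<noteq> rest (sp (2 * u + 1))"
    if "v \<noteq> u" for v
    using rest_inj[OF sp_I sp_I first_even first_even] rest_inj[OF sp_I sp_I first_odd first_odd] that
    by (auto simp: sp_eq)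
  have half: "1 / 2 * cmod (z (rest (sp (2 * v + 1)))) \<le> (kap ^ Suc m + \<epsilon>) * N" if "v \<noteq> u" for v
    using zle[OF neq(2)[OF that]] mult_right_mono[OF kap_ge_half M] kM by linarith
  have y0: "y (rest (sp (2 * v))) = 0" if "v \<noteq> u" for v
    using mismatch[OF that[symmetric]] Sw_mismatch unfolding y_def by metis
  have hits: "cmod (of_real ((hit t (n0 + m) (ret u) - hit t (n0 + m) (2 * u + 2)) / 2) * x (sp (2 * t)))
      \<le> (kap ^ Suc m + \<epsilon>) * N"
    unfolding norm_mult norm_of_real N_def
    by (rule order_trans[OF mult_mono eN[unfolded N_def]])
       (use half_diff_le[OF n0[OF le_add1] n0[OF le_add1] hit_bounds(2) hit_bounds(2) \<epsilon>]
          cmod_le_l2_norm[OF x] \<epsilon> in auto)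
  consider (out) "i \<notin> I" | (single) "i \<in> I" "mate i = i" | (other) "i \<in> I" "mate i \<noteq> i" "i \<notin> range sp"
    | (even) v where "i = sp (2 * v)" | (odd) v where "i = sp (2 * v + 1)"
    using nat_even_or_odd by (metis rangeE)
  then have "cmod (comb g y z i) \<le> (kap ^ Suc m + \<epsilon>) * N"
  proof cases
    case out
    then show ?thesis using order_trans[OF mult_nonneg_nonneg kM] kap(2) M by (simp add: comb_outside)
  next
    case other
    then show ?thesis using order_trans[OF mult_nonneg_nonneg kM] kap(2) M by (simp add: comb_other)
  next
    case single
    have "i \<noteq> sp (2 * u)" "i \<noteq> sp (2 * u + 1)" using single mate_ne by auto
    then have "first i = Some e0 \<Longrightarrow> cmod (y (rest i)) \<le> M" "first i = Some e1 \<Longrightarrow> cmod (z (rest i)) \<le> M"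
      using rest_inj[OF single(1) sp_I _ first_even] rest_inj[OF single(1) sp_I _ first_odd] yle zle by blast+
    then have "cmod (comb g y z i) \<le> kap * M"
      using kap(2) M g by (auto simp: comb_single[OF single] norm_mult)
    with kM show ?thesis by linarith
  next
    case (even v)
    show ?thesis
    proof (cases "v = u")
      case False
      have "cmod (comb g y z i) = 1 / 2 * cmod (z (rest (sp (2 * v + 1))))"
        unfolding even comb_even y0[OF False] using g by (simp add: norm_mult norm_divide)
      then show ?thesis using half[OF False] by simp
    next
      case True
      then have "k = 2 * u + 1" using u Suc.prems(2) even by auto
      then have g1: "g = -1" by (simp add: g_def sgn_of_def)
      have "comb g y z i = of_real ((hit t (n0 + m) (ret u) - hit t (n0 + m) (2 * u + 2)) / 2) * x (sp (2 * t))"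
        unfolding even True comb_even y_def z_def Sw_plain[OF plain_a] Sw_plain[OF plain_l1] X_sp g1
        by (simp add: algebra_simps diff_divide_distrib)
      then show ?thesis using hits by (simp only:)
    qed
  next
    case (odd v)
    show ?thesis
    proof (cases "v = u")
      case False
      have "cmod (comb g y z i) = 1 / 2 * cmod (z (rest (sp (2 * v + 1))))"
        unfolding odd comb_odd y0[OF False] using g by (simp add: norm_mult norm_divide)
      then show ?thesis using half[OF False] by simp
    next
      case True
      then have "k = 2 * u" using u Suc.prems(2) odd by auto
      then have g1: "g = 1" by (simp add: g_def sgn_of_def)
      have "comb g y z i = of_real ((hit t (n0 + m) (ret u) - hit t (n0 + m) (2 * u + 2)) / 2) * x (sp (2 * t))"
        unfolding odd True comb_odd y_def z_def Sw_plain[OF plain_a] Sw_plain[OF plain_l1] X_sp g1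
        by (simp add: algebra_simps diff_divide_distrib)
      then show ?thesis using hits by (simp only:)
    qed
  qed
  then show ?case by (simp only: Xeq N_def)
qed

lemma munit_target:
  assumes inf: "\<And>T. \<exists>t\<ge>T. tgt t = d" and d: "d \<in> I"
  shows "munit (sp 0) d \<in> clos"
proof (rule wot_closure_entrywise[OF munit_bounded[OF sp_I d], of _ 4])
  fix D and \<epsilon> :: real assume D: "finite D" "D \<subseteq> I" "\<epsilon> > 0"
  have "\<epsilon> / 8 > 0" using D by simp
  then obtain m where m: "kap ^ m < \<epsilon> / 8" using real_arch_pow_inv[OF _ kap(3)] by blast
  obtain T where T: "\<forall>t\<ge>T. far t m 0" using eventually_far by blast
  obtain t where t: "t \<ge> T" "tgt t = d" using inf by blast
  define \<eta> where "\<eta> = min (1/2) (\<epsilon> / 8)"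
  have \<eta>: "\<eta> > 0" "\<eta> \<le> 1/2" "\<eta> \<le> \<epsilon> / 8" using D by (auto simp: \<eta>_def)
  obtain n0 where n0: "\<And>n k. n0 \<le> n \<Longrightarrow> 1 - hit t n k \<le> \<eta>"
    using hit_limit[OF \<eta>(1)] by blast
  define n where "n = n0 + m"
  define h where "h = hit t n 0"
  have h: "1 / 2 \<le> h" using n0[of n 0] \<eta> by (simp add: h_def n_def)
  define u where "u = e0 # pre t"
  have u: "set u \<subseteq> E" using edges e01 by (simp add: u_def)
  define c where "c = 1 / (kap * h)"
  have "1 / 4 \<le> kap * h" using mult_mono[OF kap_ge_half h] kap(2) by simp
  then have c: "0 < c" "c \<le> 4" by (auto simp: c_def field_simps)
  define P where "P = (\<lambda>x i. of_real c * X t n 0 (Sw u x) i)"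
  have "in_alg P"
    unfolding P_def by (rule in_alg_scale[OF in_alg_comp[OF in_alg_X in_alg_Sw[OF V_ne u] V_ne]])
  then obtain B where B: "B \<in> alg" "\<forall>x\<in>l2 I. P x = B x" by (rule in_algE)
  have ux: "Sw u x \<in> l2 I" "l2_norm I (Sw u x) \<le> l2_norm I x" if "x \<in> l2 I" for x
    using Sw_l2[OF u that] real_sqrt_le_mono[OF sqn_Sw_le[OF u that]] by (auto simp: l2_norm_sqn)
  have bound: "l2_norm I (B x) \<le> 4 * l2_norm I x" if x: "x \<in> l2 I" for x
  proof -
    have "sqn I (P x) = c\<^sup>2 * sqn I (X t n 0 (Sw u x))"
      unfolding P_def sqn_scale using c by simp
    then have "l2_norm I (P x) = c * l2_norm I (X t n 0 (Sw u x))"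
      using c by (simp add: l2_norm_sqn real_sqrt_mult)
    moreover have "l2_norm I (X t n 0 (Sw u x)) \<le> l2_norm I x"
    proof (rule order_trans[OF _ ux(2)[OF x]])
      show "l2_norm I (X t n 0 (Sw u x)) \<le> l2_norm I (Sw u x)"
        using X_l2_sqn[OF ux(1)[OF x], of t n 0] by (simp add: l2_norm_sqn)
    qed
    then have "c * l2_norm I (X t n 0 (Sw u x)) \<le> 4 * l2_norm I x"
      using c by (intro mult_mono) auto
    ultimately show ?thesis using B(2) x by simp
  qed
  have entry: "cmod (munit (sp 0) d (delta j) i - B (delta j) i) < \<epsilon>" if i: "i \<in> D" and j: "j \<in> D" for i j
  proof -
    have jl: "delta j \<in> l2 I" using j D by auto
    have BP: "B (delta j) i = P (delta j) i" using B(2) jl by simp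
    show ?thesis
    proof (cases "i = sp 0")
      case True
      have "Sw u (delta j) (sp (2 * t)) = of_real kap * delta j d"
        unfolding u_def Sw.simps Se_entry_own[OF sp_I first_even] Sw_plain[OF plain_pre] diag_sp t(2) ..
      then have "P (delta j) i = of_real (c * (h * kap)) * delta j d"
        unfolding P_def True X_sp h_def by simp
      also have "c * (h * kap) = 1" using h kap(2) by (simp add: c_def)
      finally show ?thesis using BP D by (simp add: munit_def True)
    next
      case False
      have "cmod (X t n 0 (Sw u (delta j)) i) \<le> (kap ^ m + \<eta>) * l2_norm I (Sw u (delta j))"
        unfolding n_def by (rule X_offdiag[OF n0 _ ux(1)[OF jl] _ False]) (use \<eta> T t in auto)
      also have "\<dots> \<le> (kap ^ m + \<eta>) * 1"
      proof (rule mult_left_mono)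
        show "l2_norm I (Sw u (delta j)) \<le> 1"
          using ux(2)[OF jl] j D by (simp add: l2_norm_sqn subset_iff)
      qed (use kap(2) \<eta> in simp)
      also have "\<dots> < \<epsilon> / 4" using m \<eta> by simp
      finally have "cmod (X t n 0 (Sw u (delta j)) i) < \<epsilon> / 4" .
      then have "c * cmod (X t n 0 (Sw u (delta j)) i) < 4 * (\<epsilon> / 4)"
        using c D by (intro mult_le_less_imp_less) auto
      then have "cmod (P (delta j) i) < \<epsilon>"
        unfolding P_def norm_mult using c by simp
      then show ?thesis using BP False by (simp add: munit_def)
    qed
  qed
  show "\<exists>B\<in>alg. bounded_op I B \<and> (\<forall>x\<in>l2 I. l2_norm I (B x) \<le> 4 * l2_norm I x) \<and>
      (\<forall>i\<in>D. \<forall>j\<in>D. cmod (munit (sp 0) d (delta j) i - B (delta j) i) < \<epsilon>)"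
    using B(1) op_algebra.bounded[OF op_algebra_alg[OF V_ne] B(1)] bound entry
    by (intro bexI[of _ B]) auto
qed

lemma munit_special:
  assumes T: "munit (sp 0) j \<in> clos" and j: "j \<in> I"
  shows "munit (sp k) j \<in> clos"
proof (rule wot_closure_idem, rule wot_closure_entrywise[OF munit_bounded[OF sp_I j], of _ 1])
  fix D and \<epsilon> :: real assume D: "finite D" "D \<subseteq> I" "\<epsilon> > 0"
  define \<eta> where "\<eta> = min (1/2) (\<epsilon>\<^sup>2 / 4)"
  have \<eta>: "\<eta> > 0" "\<eta> \<le> 1/2" "\<eta> \<le> \<epsilon>\<^sup>2 / 4" using D by (auto simp: \<eta>_def)
  obtain n where n: "\<And>n' k. n \<le> n' \<Longrightarrow> 1 - hit 0 n' k \<le> \<eta>"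
    using hit_limit[OF \<eta>(1)] by blast
  define h where "h = hit 0 n k"
  have h: "1 - h \<le> \<eta>" "h \<le> 1" "0 \<le> h" using n[of n k] hit_bounds by (auto simp: h_def)
  define v where "v = X 0 n k (delta (sp 0))"
  have vl: "v \<in> l2 I" and vn: "sqn I v \<le> 1"
    using X_l2_sqn[OF delta_l2[OF sp_I], of 0 n k 0] sp_I[of 0] by (auto simp: v_def)
  have vk: "v (sp k) = of_real h" by (simp add: v_def X_sp h_def)
  have small: "cmod (delta (sp k) i - v i) < \<epsilon>" if i: "i \<in> I" for i
  proof (cases "i = sp k")
    case True
    have "cmod (1 - complex_of_real h) = 1 - h"
      using h by (metis abs_of_nonneg diff_ge_0_iff_ge norm_of_real of_real_1 of_real_diff)
    moreover have "1 - h < \<epsilon>"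
    proof (cases "\<epsilon> \<le> 1")
      case True
      have "\<epsilon>\<^sup>2 / 4 < \<epsilon>" using D(3) True by (simp add: power2_eq_square)
      then show ?thesis using h \<eta> by linarith
    qed (use h \<eta> in linarith)
    ultimately show ?thesis using True vk by simp
  next
    case False
    have "(cmod (v i))\<^sup>2 + h\<^sup>2 = (\<Sum>l\<in>{i, sp k}. (cmod (v l))\<^sup>2)" using False vk by simp
    also have "\<dots> \<le> sqn I v"
      unfolding sqn_def using i sp_I by (intro finite_sum_le_infsum l2_summable[OF vl]) auto
    finally have "(cmod (v i))\<^sup>2 \<le> 1 - h\<^sup>2" using vn by linarith
    also have "1 - h\<^sup>2 = (1 - h) * (1 + h)" by (simp add: power2_eq_square algebra_simps)
    also have "\<dots> \<le> \<eta> * 2" using h \<eta> by (intro mult_mono) auto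
    also have "\<eta> * 2 < \<epsilon>\<^sup>2"
    proof -
      have "0 < \<epsilon>\<^sup>2" using D(3) by simp
      with \<eta>(3) show ?thesis by linarith
    qed
    finally have "cmod (v i) < \<epsilon>" by (rule power2_less_imp_less) (use D in simp)
    then show ?thesis using False by simp
  qed
  define B where "B = (\<lambda>x. X 0 n k (munit (sp 0) j x))"
  have Bv: "B x = (\<lambda>i. x j * v i)" if "x \<in> l2 I" for x
    unfolding B_def munit_def v_def
    by (rule bounded_op_scale_vec[OF in_alg_bounded[OF V_ne in_alg_X] delta_l2[OF sp_I]])
  have B: "B \<in> clos" unfolding B_def by (rule clos_left[OF V_ne in_alg_X T])
  have "l2_norm I (B x) \<le> 1 * l2_norm I x" if x: "x \<in> l2 I" for x
  proof -
    have "sqn I (B x) = (cmod (x j))\<^sup>2 * sqn I v" unfolding Bv[OF x] by (rule sqn_scale)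
    also have "\<dots> \<le> sqn I x * 1" using vn cmod_le_sqn[OF x j] by (intro mult_mono) auto
    finally show ?thesis by (simp add: l2_norm_sqn)
  qed
  moreover have "cmod (munit (sp k) j (delta j') i - B (delta j') i) < \<epsilon>" if "i \<in> D" "j' \<in> D" for i j'
  proof -
    have i: "i \<in> I" and "delta j' \<in> l2 I" using that D by auto
    then have "munit (sp k) j (delta j') i - B (delta j') i = delta j' j * (delta (sp k) i - v i)"
      by (simp add: Bv munit_def algebra_simps)
    also have "cmod \<dots> \<le> cmod (delta (sp k) i - v i)" by (simp add: delta_def)
    finally show ?thesis using small[OF i] by linarith
  qed
  ultimately show "\<exists>B\<in>clos. bounded_op I B \<and> (\<forall>x\<in>l2 I. l2_norm I (B x) \<le> 1 * l2_norm I x) \<and>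
      (\<forall>i\<in>D. \<forall>j'\<in>D. cmod (munit (sp k) j (delta j') i - B (delta j') i) < \<epsilon>)"
    using B wot_closure_bounded[OF B] by (intro bexI[of _ B]) auto
qed

theorem munit_branch:
  assumes "plain w i (sp k)" "reads w' d j" "\<And>T. \<exists>t\<ge>T. tgt t = d" "d \<in> I" "j \<in> I"
  shows "munit i j \<in> clos"
  by (rule munit_left[OF V_ne munit_special[OF munit_right[OF V_ne munit_target[OF assms(3,4)] assms(2)] assms(5)]
        assms(1,5) sp_I])

end

context path_rep
begin

lemma munit_unique_range:
  assumes i: "i \<in> I" and w: "plain w j i"
    and uniq: "\<And>i'. i' \<in> I \<Longrightarrow> rng i' = rng i \<Longrightarrow> i' = i"
  shows "munit j i \<in> clos"
proof -
  have V: "V \<noteq> {}" using rng_V[OF i] by blast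
  have "Sv (rng i) \<in> alg" unfolding alg_def by (rule alg_gen.gen) (simp add: rng_V[OF i])
  then have "Sv (rng i) \<in> clos" by (rule subset_wot_closure[OF _ adjoint_bounded(1)[OF Sv_adjoint]])
  then have "munit i i \<in> clos"
  proof (rule wot_closure_cong)
    fix x
    show "Sv (rng i) x = munit i i x"
      using i uniq by (auto simp: Sv_def restr_def munit_def delta_def fun_eq_iff)
  qed
  then show ?thesis by (rule munit_left[OF V _ w i i])
qed

end

section \<open>Infinite paths at a branching vertex\<close>

fun walk :: "'e set \<Rightarrow> ('e \<Rightarrow> 'v) \<Rightarrow> ('e \<Rightarrow> 'v) \<Rightarrow> 'v \<Rightarrow> 'e list \<Rightarrow> 'v \<Rightarrow> bool" where
  "walk E r s y [] x \<longleftrightarrow> y = x"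
| "walk E r s y (e # w) x \<longleftrightarrow> e \<in> E \<and> r e = y \<and> walk E r s (s e) w x"

lemma walk_append: "walk E r s y (u @ w) x \<longleftrightarrow> (\<exists>z. walk E r s y u z \<and> walk E r s z w x)"
  by (induction u arbitrary: y) auto

lemma walk_edges: "walk E r s y w x \<Longrightarrow> set w \<subseteq> E"
  by (induction w arbitrary: y) auto

lemma walk_of_rtrancl:
  assumes "(x, y) \<in> (edge_rel V E r s)\<^sup>*" shows "\<exists>w. walk E r s y w x"
  using assms
proof induction
  case base
  show ?case by (intro exI[of _ "[]"]) simp
next
  case (step y z)
  then obtain w e where "walk E r s y w x" "e \<in> E" "s e = y" "r e = z" by (auto simp: edge_rel_def)
  then show ?case by (intro exI[of _ "e # w"]) simp
qed

lemma walk_no_return: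
  assumes "walk E r s y w x"
  shows "\<exists>w'. walk E r s y w' x \<and> (\<forall>e\<in>set w'. r e \<noteq> x)"
  using assms
proof (induction w arbitrary: y)
  case Nil
  then show ?case by (intro exI[of _ "[]"]) simp
next
  case (Cons e w)
  then obtain w' where w': "walk E r s (s e) w' x" "\<forall>e\<in>set w'. r e \<noteq> x" by auto
  show ?case
  proof (cases "r e = x")
    case True
    then show ?thesis using Cons.prems by (intro exI[of _ "[]"]) simp
  next
    case False
    then show ?thesis using w' Cons.prems by (intro exI[of _ "e # w'"]) auto
  qed
qed

locale fork =
  fixes E :: "'e set" and r s :: "'e \<Rightarrow> 'v" and v :: 'v and e0 e1 :: 'e and l0 l1 :: "'e list"
    and Y :: "nat \<Rightarrow> 'e list"
  assumes e01: "e0 \<in> E" "e1 \<in> E" "e0 \<noteq> e1" "r e0 = v" "r e1 = v"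
    and l0: "walk E r s (s e0) l0 v" "\<And>e. e \<in> set l0 \<Longrightarrow> r e \<noteq> v"
    and l1: "walk E r s (s e1) l1 v" "\<And>e. e \<in> set l1 \<Longrightarrow> r e \<noteq> v"
    and Y_walk: "walk E r s v (Y t) v"
    and Y_odd: "odd t \<Longrightarrow> Y t = []" and Y_0: "Y 0 = []"
    and Y_often: "walk E r s v y v \<Longrightarrow> \<exists>t\<ge>T. Y t = y"
begin

definition L0 :: "'e list" where "L0 = e0 # l0"
definition L1 :: "'e list" where "L1 = e1 # l1"
definition base :: "'e stream" where "base = cycle (L0 @ L1 @ L0 @ L0)"
definition ones :: "nat \<Rightarrow> 'e list" where "ones n = concat (replicate n L1)"
definition P :: "nat \<Rightarrow> 'e stream" where
  "P t = L0 @- ones (Suc t) @- L0 @- L0 @- Y t @- base"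
definition Q :: "nat \<Rightarrow> 'e stream" where "Q t = L1 @- P (Suc t)"
definition spc :: "nat \<Rightarrow> 'e stream" where "spc k = (if even k then P (k div 2) else Q (k div 2))"

lemma ones_simps [simp]: "ones 0 = []" "ones (Suc n) = L1 @ ones n"
  by (simp_all add: ones_def)

lemma ones_add: "ones (m + n) = ones m @ ones n"
  by (simp add: ones_def replicate_add)

lemma L01_neq: "L0 @- x \<noteq> L1 @- y" "L1 @- y \<noteq> L0 @- x"
  using e01(3) by (auto simp: L0_def L1_def)

lemma L_Cons [simp]: "L0 \<noteq> []" "L1 \<noteq> []" "hd L0 = e0" "hd L1 = e1"
  by (simp_all add: L0_def L1_def)

lemma shd_L [simp]: "shd (L0 @- x) = e0" "shd (L1 @- x) = e1"
  by (simp_all add: L0_def L1_def)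

lemma shd_spc: "shd (spc k) = (if even k then e0 else e1)"
  by (simp add: spc_def P_def Q_def)

lemma base_unfold: "base = L0 @- L1 @- L0 @- L0 @- base"
  unfolding base_def by (subst cycle_decomp) (auto simp: L0_def)

lemma P_0: "P 0 = base"
  unfolding P_def Y_0 ones_simps by (subst (2) base_unfold) simp

lemma ones_eq: "ones m @- L0 @- x = ones n @- L0 @- y \<Longrightarrow> m = n"
proof (induction m arbitrary: n)
  case 0
  then show ?case by (cases n) (auto simp: L01_neq)
next
  case (Suc m)
  then show ?case by (cases n) (auto simp: L01_neq)
qed

lemma P_inj: "P t = P u \<Longrightarrow> t = u"
  unfolding P_def by (auto dest!: ones_eq simp del: ones_simps)

lemma spc_inj: "inj spc"
proof (rule injI)
  fix k l assume eq: "spc k = spc l"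
  then have "even k \<longleftrightarrow> even l" using shd_spc[of k] shd_spc[of l] e01(3) by (auto split: if_splits)
  moreover have "k div 2 = l div 2"
    using eq calculation P_inj by (auto simp: spc_def Q_def split: if_splits)
  ultimately show "k = l" by (metis even_two_times_div_two odd_two_times_div_two_succ)
qed

lemma spc_cases: "\<exists>t. spc k = P t \<or> spc k = Q t"
  by (auto simp: spc_def)

lemma ones_nonspecial: "ones m @- L0 @- L0 @- x \<noteq> spc k"
proof -
  have "ones m @- L0 @- L0 @- x \<noteq> P t" for t
    by (cases m) (auto simp: P_def L01_neq)
  moreover have "ones m @- L0 @- L0 @- x \<noteq> Q t" for t
  proof (cases m)
    case (Suc n)
    then show ?thesis by (cases n) (auto simp: Q_def P_def L01_neq)
  qed (auto simp: Q_def L01_neq)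
  ultimately show ?thesis using spc_cases by metis
qed

fun np :: "'e stream \<Rightarrow> 'e list \<Rightarrow> bool" where
  "np z [] \<longleftrightarrow> True"
| "np z (e # w) \<longleftrightarrow> (r e = v \<longrightarrow> e ## (w @- z) \<notin> range spc) \<and> np z w"

lemma np_append: "np z (u @ w) \<longleftrightarrow> np (w @- z) u \<and> np z w"
  by (induction u) auto

lemma np_avoid: "(\<And>e. e \<in> set w \<Longrightarrow> r e \<noteq> v) \<Longrightarrow> np z w"
  by (induction w) auto

lemma np_l0: "np z l0" and np_l1: "np z l1"
  by (rule np_avoid, erule l0(2), rule np_avoid, erule l1(2))

lemma np_L0: "L0 @- z \<notin> range spc \<Longrightarrow> np z L0"
  using np_l0 by (simp add: L0_def)

lemma np_L1: "L1 @- z \<notin> range spc \<Longrightarrow> np z L1"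
  using np_l1 by (simp add: L1_def)

lemma np_ones: "np (L0 @- L0 @- z) (ones m)"
proof (induction m)
  case (Suc m)
  have "L1 @- ones m @- L0 @- L0 @- z \<notin> range spc"
    using ones_nonspecial[of "Suc m" z] by auto
  then show ?case using Suc by (simp add: np_append np_L1)
qed simp

lemma np_L0_L0: "np (L0 @- z) L0"
  by (rule np_L0) (use ones_nonspecial[of 0 z] in auto)

lemma walk_L: "walk E r s v L0 v" "walk E r s v L1 v"
  using e01 l0 l1 by (simp_all add: L0_def L1_def)

lemma walk_ones: "walk E r s v (ones m) v"
  by (induction m) (auto simp: walk_append intro: walk_L)

lemma to_special:
  assumes "walk E r s y w v"
  shows "\<exists>c k. walk E r s y c v \<and> w @- base = c @- spc k \<and> np (spc k) c"
  using assms
proof (induction w arbitrary: y)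
  case Nil
  then show ?case by (intro exI[of _ "[]"] exI[of _ 0]) (simp add: spc_def P_0)
next
  case (Cons e w)
  from Cons.prems have "walk E r s (s e) w v" by simp
  from Cons.IH[OF this] obtain c k
    where c: "walk E r s (s e) c v" "w @- base = c @- spc k" "np (spc k) c" by blast
  show ?case
  proof (cases "r e = v \<and> e ## (w @- base) \<in> range spc")
    case True
    then obtain k' where "e ## (w @- base) = spc k'" by auto
    then have "(e # w) @- base = [] @- spc k'" by simp
    moreover have "walk E r s y [] v" using True Cons.prems by simp
    moreover have "np (spc k') []" by simp
    ultimately show ?thesis by blast
  next
    case False
    then show ?thesis using c Cons.prems by (intro exI[of _ "e # c"] exI[of _ k]) auto
  qed
qed

lemma continuation:
  "\<exists>c k. walk E r s v c v \<and> L0 @- Y t @- base = c @- spc k \<and> np (spc k) c \<and> (odd t \<longrightarrow> k = 0)"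
proof (cases "odd t")
  case True
  have "np (spc 0) L0"
    using np_L0_L0[of "L1 @- L0 @- L0 @- base"] base_unfold by (simp add: spc_def P_0)
  then show ?thesis
    using True walk_L by (intro exI[of _ L0] exI[of _ 0]) (simp add: Y_odd spc_def P_0)
next
  case False
  have "walk E r s v (L0 @ Y t) v" using walk_L Y_walk by (auto simp: walk_append)
  from to_special[OF this] False show ?thesis by auto
qed

definition cont :: "nat \<Rightarrow> 'e list \<times> nat" where
  "cont t = (SOME p. walk E r s v (fst p) v \<and> L0 @- Y t @- base = fst p @- spc (snd p) \<and>
     np (spc (snd p)) (fst p) \<and> (odd t \<longrightarrow> snd p = 0))"

lemma cont: "walk E r s v (fst (cont t)) v" "L0 @- Y t @- base = fst (cont t) @- spc (snd (cont t))"
  "np (spc (snd (cont t))) (fst (cont t))" "odd t \<Longrightarrow> snd (cont t) = 0"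
proof -
  have "\<exists>p. walk E r s v (fst p) v \<and> L0 @- Y t @- base = fst p @- spc (snd p) \<and>
     np (spc (snd p)) (fst p) \<and> (odd t \<longrightarrow> snd p = 0)"
    using continuation[of t] by (auto simp del: shift.simps)
  from someI_ex[OF this]
  show "walk E r s v (fst (cont t)) v" "L0 @- Y t @- base = fst (cont t) @- spc (snd (cont t))"
    "np (spc (snd (cont t))) (fst (cont t))" "odd t \<Longrightarrow> snd (cont t) = 0"
    unfolding cont_def by blast+
qed

definition pre :: "nat \<Rightarrow> 'e list" where "pre t = l0 @ ones (Suc t) @ L0"
definition lead :: "nat \<Rightarrow> 'e list" where "lead t = pre t @ fst (cont t)"

lemma P_pre: "P t = e0 ## pre t @- L0 @- Y t @- base"
  by (simp add: P_def pre_def L0_def)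

lemma P_lead: "P t = e0 ## lead t @- spc (snd (cont t))"
  by (simp add: P_pre lead_def cont(2))

lemma walk_pre: "walk E r s (s e0) (pre t) v"
  using l0(1) walk_ones walk_L unfolding pre_def walk_append by blast

lemma walk_lead: "walk E r s (s e0) (lead t) v"
  using walk_pre cont(1) unfolding lead_def walk_append by blast

lemma np_pre: "np (L0 @- z) (pre t)"
  unfolding pre_def by (simp only: np_append np_l0 np_L0_L0 np_ones simp_thms)

lemma np_lead: "np (spc (snd (cont t))) (lead t)"
  using np_pre[of "Y t @- base" t] cont(3) unfolding lead_def np_append cont(2)[symmetric] by simp

lemma Q_l1: "Q t = e1 ## l1 @- P (Suc t)"
  by (simp add: Q_def L1_def)

lemma lead_mismatch:
  assumes "t \<noteq> u"
  shows "\<exists>w e w' z. lead t = w @ e # w' \<and> lead u @- spc (snd (cont u)) = w @- z \<and>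
    walk E r s (s e0) w v \<and> np z w \<and> z \<notin> range spc \<and> shd z \<noteq> e \<and>
    (\<exists>w''. z = w'' @- base \<and> walk E r s v w'' v \<and> w'' \<noteq> [])"
proof -
  have eq: "lead u @- spc (snd (cont u)) = l0 @- ones (Suc u) @- L0 @- L0 @- Y u @- base"
    using cont(2)[of u] by (simp add: lead_def pre_def)
  have pw: "walk E r s (s e0) (l0 @ ones n) v" for n
    using l0(1) walk_ones unfolding walk_append by blast
  have pY: "walk E r s v (L0 @ L0 @ Y u) v" using walk_L Y_walk unfolding walk_append by blast
  show ?thesis
  proof (cases "t < u")
    case True
    then obtain d where d: "u = t + Suc d" using less_imp_Suc_add by fastforce
    define z where "z = ones (Suc d) @- L0 @- L0 @- Y u @- base"
    have "ones (Suc u) = ones (Suc t) @ ones (Suc d)" using ones_add[of "Suc t" "Suc d"] d by simp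
    then have "lead u @- spc (snd (cont u)) = (l0 @ ones (Suc t)) @- z"
      by (simp only: eq z_def shift_append)
    moreover have "lead t = (l0 @ ones (Suc t)) @ e0 # (l0 @ fst (cont t))"
      by (simp add: lead_def pre_def L0_def)
    moreover have "np z (l0 @ ones (Suc t))"
    proof -
      have "np (L0 @- L0 @- Y u @- base) (ones (Suc t + Suc d))" by (rule np_ones)
      then have "np z (ones (Suc t))" unfolding ones_add np_append z_def by blast
      then show ?thesis by (simp only: np_append np_l0 simp_thms)
    qed
    moreover have "z \<notin> range spc" unfolding z_def using ones_nonspecial by blast
    moreover have "shd z \<noteq> e0" using e01(3) by (simp add: z_def)
    moreover have "z = (ones (Suc d) @ L0 @ L0 @ Y u) @- base" by (simp add: z_def)
    moreover have "walk E r s v (ones (Suc d) @ L0 @ L0 @ Y u) v"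
      using walk_ones[of "Suc d"] pY walk_append by metis
    moreover have "ones (Suc d) @ L0 @ L0 @ Y u \<noteq> []" by (simp add: L0_def)
    ultimately show ?thesis using pw[of "Suc t"] by blast
  next
    case False
    then obtain d where d: "t = u + Suc d" using assms less_imp_Suc_add[of u t] by fastforce
    define z where "z = L0 @- L0 @- Y u @- base"
    have "ones (Suc t) = ones (Suc u) @ ones (Suc d)" using ones_add[of "Suc u" "Suc d"] d by simp
    then have "lead t = (l0 @ ones (Suc u)) @ e1 # (l1 @ ones d @ L0 @ fst (cont t))"
      by (simp add: lead_def pre_def L1_def)
    moreover have "lead u @- spc (snd (cont u)) = (l0 @ ones (Suc u)) @- z"
      by (simp only: eq z_def shift_append)
    moreover have "np z (l0 @ ones (Suc u))"
      unfolding z_def by (simp only: np_append np_l0 np_ones simp_thms)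
    moreover have "z \<notin> range spc" unfolding z_def using ones_nonspecial[of 0] by auto
    moreover have "shd z \<noteq> e1" using e01(3) by (simp add: z_def)
    moreover have "z = (L0 @ L0 @ Y u) @- base" by (simp add: z_def)
    moreover have "L0 @ L0 @ Y u \<noteq> []" by (simp add: L0_def)
    ultimately show ?thesis using pw[of "Suc u"] pY by blast
  qed
qed

end

lemma exists_enumeration:
  assumes E: "finite E"
  shows "\<exists>Y :: nat \<Rightarrow> _. (\<forall>t. walk E r s v (Y t) v) \<and> (\<forall>t. odd t \<longrightarrow> Y t = []) \<and> Y 0 = [] \<and>
    (\<forall>y T. walk E r s v y v \<longrightarrow> (\<exists>t\<ge>T. Y t = y))"
proof -
  define C where "C = {y. walk E r s v y v}"
  have "C \<subseteq> lists E" using walk_edges by (fastforce simp: C_def)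
  then have C: "countable C" using countable_lists[OF countable_finite[OF E]] countable_subset by blast
  have ne: "C \<noteq> {}" by (auto simp: C_def intro: exI[of _ "[]"])
  define Y where "Y t = (if odd t \<or> t = 0 then [] else from_nat_into C (fst (prod_decode (t div 2))))" for t
  have 1: "walk E r s v (Y t) v" for t
    using from_nat_into[OF ne] by (auto simp: Y_def C_def)
  have 2: "\<exists>t\<ge>T. Y t = y" if y: "walk E r s v y v" for y T
  proof -
    have "y \<in> C" using y by (simp add: C_def)
    then obtain n where n: "from_nat_into C n = y" using from_nat_into_surj[OF C] by blast
    define t where "t = 2 * prod_encode (n, Suc T)"
    have "Suc T \<le> prod_encode (n, Suc T)" by (rule le_prod_encode_2)
    then have "t \<ge> T" "t \<noteq> 0" by (auto simp: t_def)
    moreover have "Y t = y" using \<open>t \<noteq> 0\<close> n by (simp add: Y_def t_def)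
    ultimately show ?thesis by blast
  qed
  have 3: "Y 0 = []" "odd t \<Longrightarrow> Y t = []" for t by (simp_all add: Y_def)
  show ?thesis
  proof (rule exI[where x = Y], intro conjI allI impI)
    show "walk E r s v (Y t) v" for t by (rule 1)
    show "\<exists>t\<ge>T. Y t = y" if "walk E r s v y v" for y T using that by (rule 2)
  qed (auto simp: 3)
qed

section \<open>The path basis of a graph\<close>

locale model =
  fixes V :: "'v set" and E :: "'e set" and r s :: "'e \<Rightarrow> 'v"
    and root :: "'v \<Rightarrow> 'v" and Br :: "'v set"
    and e0 e1 :: "'v \<Rightarrow> 'e" and l0 l1 :: "'v \<Rightarrow> 'e list" and Y :: "'v \<Rightarrow> nat \<Rightarrow> 'e list"
    and beg :: "'v \<Rightarrow> 'e stream" and g :: "'v \<times> 'e stream \<Rightarrow> 'i"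
  assumes graph: "finite_graph V E r s"
    and root_walk: "v \<in> V \<Longrightarrow> \<exists>w. walk E r s v w (root v)" "v \<in> V \<Longrightarrow> \<exists>w. walk E r s (root v) w v"
    and root_edge: "e \<in> E \<Longrightarrow> root (s e) = root (r e)"
    and Br: "v \<in> Br \<Longrightarrow> v \<in> V \<and> root v = v"
    and fork: "v \<in> Br \<Longrightarrow> fork E r s v (e0 v) (e1 v) (l0 v) (l1 v) (Y v)"
    and beg_Br: "v \<in> Br \<Longrightarrow> beg v = fork.base (e0 v) (e1 v) (l0 v) (l1 v)"
    and beg_other: "v \<in> V \<Longrightarrow> root v = v \<Longrightarrow> v \<notin> Br \<Longrightarrow> e \<in> E \<Longrightarrow> r e = v \<Longrightarrow>
      \<exists>w. w \<noteq> [] \<and> walk E r s v w v \<and> beg v = w @- beg v"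
    and indegree: "v \<in> V \<Longrightarrow> root v \<notin> Br \<Longrightarrow> e \<in> E \<Longrightarrow> e' \<in> E \<Longrightarrow> r e = v \<Longrightarrow> r e' = v \<Longrightarrow> e = e'"
    and inj_g: "inj_on g {(y, w @- beg (root y)) | y w. y \<in> V \<and> walk E r s y w (root y)}"
begin

definition B :: "('v \<times> 'e stream) set" where
  "B = {(y, w @- beg (root y)) | y w. y \<in> V \<and> walk E r s y w (root y)}"

lemma edge_V: "e \<in> E \<Longrightarrow> s e \<in> V \<and> r e \<in> V"
  using graph by (auto simp: finite_graph_def)

lemma walk_root: "walk E r s y w x \<Longrightarrow> root y = root x"
  by (induction w arbitrary: y) (auto simp: root_edge[symmetric])

lemma walk_V: "walk E r s y w x \<Longrightarrow> x \<in> V \<Longrightarrow> y \<in> V"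
  by (cases w) (auto simp: edge_V)

lemma B_walk: "(x, z) \<in> B \<Longrightarrow> walk E r s y w x \<Longrightarrow> (y, w @- z) \<in> B"
proof -
  assume xz: "(x, z) \<in> B" and w: "walk E r s y w x"
  then obtain w' where w': "x \<in> V" "walk E r s x w' (root x)" "z = w' @- beg (root x)" by (auto simp: B_def)
  have "walk E r s y (w @ w') (root y)" "y \<in> V" "w @- z = (w @ w') @- beg (root y)"
    using w w' walk_root[OF w] walk_V[OF w] by (auto simp: walk_append)
  then show ?thesis unfolding B_def by blast
qed

lemma B_root: "v \<in> V \<Longrightarrow> root v = v \<Longrightarrow> (v, beg v) \<in> B"
  unfolding B_def by (auto intro!: exI[of _ "[]"])

lemma beg_cycle:
  assumes v: "v \<in> V" "root v = v" and e: "e \<in> E" "r e = v"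
  shows "\<exists>w. w \<noteq> [] \<and> walk E r s v w v \<and> beg v = w @- beg v"
proof (cases "v \<in> Br")
  case True
  interpret fork E r s v "e0 v" "e1 v" "l0 v" "l1 v" "Y v" by (rule fork[OF True])
  have "beg v = (L0 @ L1 @ L0 @ L0) @- beg v"
    using base_unfold unfolding beg_Br[OF True] by simp
  moreover have "walk E r s v (L0 @ L1 @ L0 @ L0) v" using walk_L by (auto simp: walk_append)
  ultimately show ?thesis by (intro exI[of _ "L0 @ L1 @ L0 @ L0"]) simp
qed (use beg_other assms in blast)

lemma B_Cons:
  assumes b: "(y, z) \<in> B" and e: "e \<in> E" "r e = y"
  shows "shd z \<in> E \<and> r (shd z) = y \<and> (s (shd z), stl z) \<in> B"
proof -
  obtain w where w: "y \<in> V" "walk E r s y w (root y)" "z = w @- beg (root y)" using b by (auto simp: B_def)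
  have "\<exists>w. w \<noteq> [] \<and> walk E r s y w (root y) \<and> z = w @- beg (root y)"
  proof (cases "w = []")
    case True
    then have "root y = y" using w(2) by simp
    with beg_cycle[OF w(1) this e] w True show ?thesis by auto
  qed (use w in blast)
  then obtain e' w' where w': "walk E r s y (e' # w') (root y)" "z = (e' # w') @- beg (root y)"
    by (metis neq_Nil_conv)
  then have "root (s e') = root y" using root_edge by auto
  then have "(s e', w' @- beg (root y)) \<in> B" using w' edge_V unfolding B_def by auto
  with w' show ?thesis by simp
qed

abbreviation sc :: "'v \<Rightarrow> nat \<Rightarrow> 'e stream" where
  "sc v \<equiv> fork.spc (e0 v) (e1 v) (l0 v) (l1 v) (Y v)"

lemma sc_inj: "v \<in> Br \<Longrightarrow> inj (sc v)"
  by (rule fork.spc_inj[OF fork])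

lemma sc_B: assumes "v \<in> Br" shows "(v, sc v k) \<in> B"
proof -
  interpret fork E r s v "e0 v" "e1 v" "l0 v" "l1 v" "Y v" by (rule fork[OF assms])
  have base: "(v, base) \<in> B" using B_root Br[OF assms] by (simp add: beg_Br[OF assms, symmetric])
  have P: "(v, P t) \<in> B" for t
    unfolding P_def by (intro B_walk[OF B_walk[OF B_walk[OF B_walk[OF B_walk[OF base Y_walk] walk_L(1)] walk_L(1)] walk_ones] walk_L(1)])
  have "(v, Q t) \<in> B" for t unfolding Q_def by (rule B_walk[OF P walk_L(2)])
  with P show ?thesis by (auto simp: spc_def)
qed

definition special :: "'v \<times> 'e stream \<Rightarrow> bool" where
  "special b \<longleftrightarrow> fst b \<in> Br \<and> snd b \<in> range (sc (fst b))"

definition idx :: "'v \<times> 'e stream \<Rightarrow> nat" where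
  "idx b = inv (sc (fst b)) (snd b)"

definition flip :: "nat \<Rightarrow> nat" where "flip k = (if even k then k + 1 else k - 1)"

lemma flip: "flip (flip k) = k" "flip k \<noteq> k" "even (flip k) \<longleftrightarrow> odd k" "flip (2 * t) = 2 * t + 1"
  by (auto simp: flip_def elim: oddE)

definition mt :: "'v \<times> 'e stream \<Rightarrow> 'v \<times> 'e stream" where
  "mt b = (if special b then (fst b, sc (fst b) (flip (idx b))) else b)"

lemma idx_sc: "v \<in> Br \<Longrightarrow> idx (v, sc v k) = k"
  by (simp add: idx_def inv_f_f[OF sc_inj])

lemma special_sc: "v \<in> Br \<Longrightarrow> special (v, sc v k)"
  by (simp add: special_def)

lemma mt_sc: "v \<in> Br \<Longrightarrow> mt (v, sc v k) = (v, sc v (flip k))"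
  by (simp add: mt_def special_sc idx_sc)

lemma specialE:
  assumes "special b" obtains v k where "v \<in> Br" "b = (v, sc v k)"
  using assms that by (cases b) (auto simp: special_def)

lemma mt_eq: "mt b = b \<longleftrightarrow> \<not> special b"
proof
  assume eq: "mt b = b"
  show "\<not> special b"
  proof
    assume "special b"
    then obtain v k where b: "v \<in> Br" "b = (v, sc v k)" by (rule specialE)
    then have "flip k = k" using eq idx_sc[OF b(1), of k] idx_sc[OF b(1), of "flip k"] by (simp add: mt_sc)
    then show False by (simp add: flip)
  qed
qed (simp add: mt_def)

definition I :: "'i set" where "I = g ` B"
definition dec :: "'i \<Rightarrow> 'v \<times> 'e stream" where "dec = inv_into B g"

lemma dec_g [simp]: "b \<in> B \<Longrightarrow> dec (g b) = b"
  using inj_g unfolding dec_def B_def by (rule inv_into_f_f)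

definition rng :: "'i \<Rightarrow> 'v" where "rng i = fst (dec i)"
definition first :: "'i \<Rightarrow> 'e option" where
  "first i = (let z = snd (dec i) in if shd z \<in> E \<and> r (shd z) = fst (dec i) then Some (shd z) else None)"
definition rest :: "'i \<Rightarrow> 'i" where
  "rest i = (let z = snd (dec i) in g (s (shd z), stl z))"
definition cons :: "'e \<Rightarrow> 'i \<Rightarrow> 'i" where "cons e i = g (r e, e ## snd (dec i))"
definition mate :: "'i \<Rightarrow> 'i" where "mate i = g (mt (dec i))"
definition upper :: "'i \<Rightarrow> bool" where "upper i \<longleftrightarrow> even (idx (dec i))"

lemma g_simps:
  assumes "(y, z) \<in> B"
  shows "rng (g (y, z)) = y" "rest (g (y, z)) = g (s (shd z), stl z)"
    "first (g (y, z)) = (if shd z \<in> E \<and> r (shd z) = y then Some (shd z) else None)"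
    "cons e (g (y, z)) = g (r e, e ## z)" "mate (g (y, z)) = g (mt (y, z))"
    "upper (g (y, z)) \<longleftrightarrow> even (idx (y, z))"
  using assms by (simp_all add: rng_def rest_def first_def cons_def mate_def upper_def Let_def)

lemma mt_B: "b \<in> B \<Longrightarrow> mt b \<in> B"
  using sc_B by (cases "special b") (auto simp: mt_def elim: specialE)

lemma g_eq: "b \<in> B \<Longrightarrow> b' \<in> B \<Longrightarrow> g b = g b' \<longleftrightarrow> b = b'"
  using dec_g by metis

lemma mate_fix: "b \<in> B \<Longrightarrow> mate (g b) = g b \<longleftrightarrow> \<not> special b"
  using g_eq[OF mt_B] by (cases b) (simp add: g_simps mt_eq)

lemma I_cases: "i \<in> I \<Longrightarrow> (\<And>y z. (y, z) \<in> B \<Longrightarrow> i = g (y, z) \<Longrightarrow> thesis) \<Longrightarrow> thesis"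
  unfolding I_def by auto

lemma first_sc:
  assumes v: "v \<in> Br"
  shows "first (g (v, sc v k)) = Some (if even k then e0 v else e1 v)"
proof -
  interpret fork E r s v "e0 v" "e1 v" "l0 v" "l1 v" "Y v" by (rule fork[OF v])
  show ?thesis using e01 by (simp add: g_simps(3)[OF sc_B[OF v]] shd_spc)
qed

sublocale path_rep I V E r s rng first rest cons mate upper
proof
  show "finite_graph V E r s" by (rule graph)
  show "rng i \<in> V" if "i \<in> I" for i
    using that by (rule I_cases) (auto simp: g_simps B_def)
  show "e \<in> E \<and> r e = rng i \<and> rest i \<in> I \<and> rng (rest i) = s e \<and> cons e (rest i) = i"
    if "i \<in> I" "first i = Some e" for i e
    using that(1)
  proof (rule I_cases)
    fix y z assume b: "(y, z) \<in> B" and i: "i = g (y, z)"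
    have e: "e \<in> E" "r e = y" "shd z = e" using that(2) by (auto simp: i g_simps[OF b] split: if_splits)
    note c = B_Cons[OF b e(1,2)]
    have "e ## stl z = z" using e(3) by (metis stream.collapse)
    then show ?thesis using e c by (auto simp: i g_simps[OF b] g_simps I_def)
  qed
  show "cons e i \<in> I \<and> first (cons e i) = Some e \<and> rest (cons e i) = i"
    if "i \<in> I" "e \<in> E" "rng i = s e" for i e
    using that(1)
  proof (rule I_cases)
    fix y z assume b: "(y, z) \<in> B" and i: "i = g (y, z)"
    have y: "y = s e" using that(3) by (simp add: i g_simps[OF b])
    have "walk E r s (r e) [e] y" using that(2) y by simp
    from B_walk[OF b this] have "(r e, e ## z) \<in> B" by simp
    moreover have "cons e i = g (r e, e ## z)" by (simp add: i g_simps[OF b])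
    ultimately show ?thesis using that(2) y by (auto simp: i g_simps I_def)
  qed
  show "r e \<noteq> rng i" if "i \<in> I" "first i = None" "e \<in> E" for i e
    using that(1)
  proof (rule I_cases)
    fix y z assume b: "(y, z) \<in> B" and i: "i = g (y, z)"
    show ?thesis using B_Cons[OF b that(3)] that(2) by (auto simp: i g_simps[OF b])
  qed
  show "mate i \<in> I \<and> mate (mate i) = i \<and> rng (mate i) = rng i" if "i \<in> I" for i
    using that
  proof (rule I_cases)
    fix y z assume b: "(y, z) \<in> B" and i: "i = g (y, z)"
    show ?thesis
    proof (cases "special (y, z)")
      case True
      then obtain k where y: "y \<in> Br" and z: "z = sc y k" by (auto elim: specialE)
      then show ?thesis
        using sc_B[OF y] by (simp add: i g_simps[OF sc_B[OF y]] mt_sc[OF y] flip I_def)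
    next
      case False
      then have "mt (y, z) = (y, z)" by (simp add: mt_eq)
      then show ?thesis using b by (simp add: i g_simps[OF b] I_def)
    qed
  qed
  have sp: "\<exists>v k. v \<in> Br \<and> i = g (v, sc v k) \<and> mate i = g (v, sc v (flip k))" if "i \<in> I" "mate i \<noteq> i" for i
    using that(1)
  proof (rule I_cases)
    fix y z assume b: "(y, z) \<in> B" and i: "i = g (y, z)"
    then have "special (y, z)" using that(2) mate_fix[OF b] by blast
    then obtain k where y: "y \<in> Br" and z: "z = sc y k" by (auto elim: specialE)
    then show ?thesis by (auto simp: i g_simps[OF sc_B[OF y]] mt_sc[OF y])
  qed
  show "upper (mate i) = (\<not> upper i)" if i: "i \<in> I" "mate i \<noteq> i" for i
  proof -
    obtain v k where v: "v \<in> Br" "i = g (v, sc v k)" "mate i = g (v, sc v (flip k))" using sp[OF i] by blast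
    show ?thesis unfolding v(2,3) by (simp add: g_simps(6)[OF sc_B[OF v(1)]] idx_sc[OF v(1)] flip v(3)[unfolded v(2)])
  qed
  show "first (mate i) \<noteq> first i" if i: "i \<in> I" "mate i \<noteq> i" for i
  proof -
    obtain v k where v: "v \<in> Br" "i = g (v, sc v k)" "mate i = g (v, sc v (flip k))" using sp[OF i] by blast
    have "e0 v \<noteq> e1 v" by (rule fork.e01(3)[OF fork[OF v(1)]])
    then show ?thesis unfolding v(3) unfolding v(2) first_sc[OF v(1)] by (auto simp: flip)
  qed
qed

lemma reads_walk:
  assumes "(x, z) \<in> B" "walk E r s y w x"
  shows "reads w (g (y, w @- z)) (g (x, z))"
  using assms(2)
proof (induction w arbitrary: y)
  case (Cons e w)
  have b: "(y, e ## w @- z) \<in> B" using B_walk[OF assms(1) Cons.prems] by simp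
  have "g (y, e ## w @- z) \<in> I" using b by (simp add: I_def)
  then show ?case using Cons by (simp add: g_simps[OF b])
qed simp

lemma plain_walk:
  assumes "(x, z) \<in> B" "walk E r s y w x"
    and "\<And>u w'. w = u @ w' \<Longrightarrow> w' \<noteq> [] \<Longrightarrow> \<not> special (r (hd w'), w' @- z)"
  shows "plain w (g (y, w @- z)) (g (x, z))"
  using assms(2,3)
proof (induction w arbitrary: y)
  case (Cons e w)
  have b: "(y, e ## w @- z) \<in> B" using B_walk[OF assms(1) Cons.prems(1)] by simp
  have I: "g (y, e ## w @- z) \<in> I" using b by (simp add: I_def)
  have "\<not> special (y, e ## w @- z)" using Cons.prems(2)[of "[]" "e # w"] Cons.prems(1) by simp
  then have "mate (g (y, e ## w @- z)) = g (y, e ## w @- z)" using mate_fix[OF b] by blast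
  moreover have "plain w (g (s e, w @- z)) (g (x, z))"
  proof (rule Cons.IH)
    show "\<not> special (r (hd w'), w' @- z)" if "w = u @ w'" "w' \<noteq> []" for u w'
      using Cons.prems(2)[of "e # u" w'] that by simp
  qed (use Cons.prems in simp)
  ultimately show ?case using I Cons.prems by (simp add: g_simps[OF b])
qed simp

lemma B_form:
  assumes "(y, z) \<in> B" obtains w where "y \<in> V" "walk E r s y w (root y)" "z = w @- beg (root y)"
  using assms by (auto simp: B_def)

lemma connected:
  assumes "y \<in> V" "y' \<in> V" "root y = root y'" shows "\<exists>w. walk E r s y w y'"
proof -
  obtain w w' where "walk E r s y w (root y)" "walk E r s (root y') w' y'"
    using root_walk assms(1,2) by blast
  then have "walk E r s y (w @ w') y'" using assms(3) by (auto simp: walk_append)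
  then show ?thesis by blast
qed

lemma munit_forked:
  assumes v: "v \<in> Br" and b: "(y, z) \<in> B" "root y = v" and b': "(y', z') \<in> B" "root y' = v"
  shows "munit (g (y, z)) (g (y', z')) \<in> clos"
proof -
  interpret F: fork E r s v "e0 v" "e1 v" "l0 v" "l1 v" "Y v" by (rule fork[OF v])
  note beg = beg_Br[OF v]
  have base: "(v, F.base) \<in> B" using B_root Br[OF v] by (simp add: beg[symmetric])
  have sp_B: "(v, F.spc k) \<in> B" for k by (rule sc_B[OF v])
  have special: "special (x, t) \<longleftrightarrow> x = v \<and> t \<in> range F.spc" if "root x = v" for x t
    using that v Br by (auto simp: special_def)
  have plain_np: "plain w (g (x, w @- t)) (g (v, t))"
    if t: "(v, t) \<in> B" and w: "walk E r s x w v" and np: "F.np t w" for x w t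
  proof (rule plain_walk[OF t w])
    fix u w' assume uw: "w = u @ w'" and ne: "w' \<noteq> []"
    then obtain e w'' where w': "w' = e # w''" by (cases w') auto
    have "walk E r s (r e) w' v" using w unfolding uw by (auto simp: walk_append w')
    then have root: "root (r e) = v" using walk_root Br[OF v] by metis
    have "F.np t (e # w'')" using np unfolding uw w' F.np_append by blast
    then show "\<not> special (r (hd w'), w' @- t)" by (simp add: special[OF root] w')
  qed
  define tg where "tg t = g (v, F.L0 @- Y v t @- F.base)" for t
  have sp_even: "F.spc (2 * t) = F.P t" and sp_odd: "F.spc (2 * t + 1) = F.Q t"
    and sp_next: "F.spc (2 * t + 2) = F.P (Suc t)" for t
    by (simp_all add: F.spc_def)
  have rest_even: "rest (g (v, F.spc (2 * t))) = g (s (e0 v), F.lead t @- F.spc (snd (F.cont t)))" for t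
    by (subst g_simps(2)[OF sp_B]) (simp only: sp_even F.P_lead stream.sel)
  have rest_even': "rest (g (v, F.spc (2 * t))) = g (s (e0 v), F.pre t @- F.L0 @- Y v t @- F.base)" for t
    by (subst g_simps(2)[OF sp_B]) (simp only: sp_even F.P_pre stream.sel)
  have rest_odd: "rest (g (v, F.spc (2 * t + 1))) = g (s (e1 v), l1 v @- F.spc (2 * t + 2))" for t
    by (subst g_simps(2)[OF sp_B]) (simp only: sp_odd sp_next F.Q_l1 stream.sel)
  have tg_B: "(v, F.L0 @- w @- F.base) \<in> B" if "walk E r s v w v" for w
    by (rule B_walk[OF B_walk[OF base that] F.walk_L(1)])
  interpret branch I V E r s rng first rest cons mate upper "e0 v" "e1 v" "\<lambda>k. g (v, F.spc k)"
    F.lead "\<lambda>t. snd (F.cont t)" "l1 v" F.pre tg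
  proof
    show "e0 v \<in> E" "e1 v \<in> E" "e0 v \<noteq> e1 v" by (rule F.e01)+
    show "g (v, F.spc k) \<in> I" for k using sp_B by (simp add: I_def)
    show "mate (g (v, F.spc (2 * t))) = g (v, F.spc (2 * t + 1))" for t
      by (simp only: g_simps(5)[OF sp_B] mt_sc[OF v] flip)
    show "inj (\<lambda>k. g (v, F.spc k))"
      using F.spc_inj g_eq[OF sp_B sp_B] by (auto simp: inj_def)
    show "upper (g (v, F.spc (2 * t)))" for t
      by (simp add: g_simps(6)[OF sp_B] idx_sc[OF v])
    show "first (g (v, F.spc (2 * t))) = Some (e0 v)" for t
      by (simp add: first_sc[OF v])
    show "first (g (v, F.spc (2 * t + 1))) = Some (e1 v)" for t
      by (simp add: first_sc[OF v])
    show "plain (F.lead t) (rest (g (v, F.spc (2 * t)))) (g (v, F.spc (snd (F.cont t))))" for t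
      unfolding rest_even by (rule plain_np[OF sp_B F.walk_lead F.np_lead])
    show "plain (l1 v) (rest (g (v, F.spc (2 * t + 1)))) (g (v, F.spc (2 * t + 2)))" for t
      unfolding rest_odd by (rule plain_np[OF sp_B F.l1(1) F.np_l1])
    show "first i \<noteq> Some (e0 v) \<and> first i \<noteq> Some (e1 v)"
      if i: "i \<in> I" "mate i \<noteq> i" "i \<notin> range (\<lambda>k. g (v, F.spc k))" for i
      using i(1)
    proof (rule I_cases)
      fix x t assume xt: "(x, t) \<in> B" and ieq: "i = g (x, t)"
      have "special (x, t)" using i(2) mate_fix[OF xt] ieq by blast
      then have "x \<noteq> v" using i(3) ieq special[of x t] Br[OF v] by auto
      then show ?thesis using F.e01(4,5) by (auto simp: ieq g_simps[OF xt])
    qed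
    show "\<exists>w j e w'. F.lead t = w @ e # w' \<and> plain w (rest (g (v, F.spc (2 * u)))) j \<and>
      j \<in> I \<and> mate j = j \<and> first j \<noteq> Some e" if tu: "t \<noteq> u" for t u
    proof -
      obtain w e w' x w'' where m: "F.lead t = w @ e # w'" "F.lead u @- F.spc (snd (F.cont u)) = w @- x"
        "walk E r s (s (e0 v)) w v" "F.np x w" "x \<notin> range F.spc" "shd x \<noteq> e"
        "x = w'' @- F.base" "walk E r s v w'' v"
        using F.lead_mismatch[OF tu] by blast
      have x: "(v, x) \<in> B" unfolding m(7) by (rule B_walk[OF base m(8)])
      have "plain w (rest (g (v, F.spc (2 * u)))) (g (v, x))"
        unfolding rest_even m(2) by (rule plain_np[OF x m(3,4)])
      moreover have "mate (g (v, x)) = g (v, x)"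
        using mate_fix[OF x] special[of v x] Br[OF v] m(5) by blast
      moreover have "first (g (v, x)) \<noteq> Some e" using m(6) by (simp add: g_simps[OF x])
      moreover have "g (v, x) \<in> I" using x by (simp add: I_def)
      ultimately show ?thesis using m(1) by blast
    qed
    show "snd (F.cont t) = 0" if "odd t" for t by (rule F.cont(4)[OF that])
    show "plain (F.pre t) (rest (g (v, F.spc (2 * t)))) (tg t)" for t
      unfolding rest_even' tg_def by (rule plain_np[OF tg_B[OF F.Y_walk] F.walk_pre F.np_pre])
  qed
  obtain w where w: "walk E r s y w v" "z = w @- F.base"
    using B_form[OF b(1)] b(2) beg by metis
  obtain w' where w': "y' \<in> V" "walk E r s y' w' v" "z' = w' @- F.base"
    using B_form[OF b'(1)] b'(2) beg by metis
  obtain c k where c: "walk E r s y c v" "z = c @- F.spc k" "F.np (F.spc k) c"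
    using F.to_special[OF w(1)] w(2) by auto
  obtain m where m: "walk E r s v m y'" using connected[of v y'] Br[OF v] w' b'(2) by auto
  have mw: "walk E r s v (m @ w') v" using m w'(2) by (auto simp: walk_append)
  have Lm: "walk E r s v (F.L0 @ m) y'" using m F.walk_L by (auto simp: walk_append)
  show ?thesis
  proof (rule munit_branch)
    show "plain c (g (y, z)) (g (v, F.spc k))" unfolding c(2) by (rule plain_np[OF sp_B c(1,3)])
    show "reads (F.L0 @ m) (g (v, (F.L0 @ m) @- z')) (g (y', z'))" by (rule reads_walk[OF b'(1) Lm])
    show "\<exists>t\<ge>T. tg t = g (v, (F.L0 @ m) @- z')" for T
      using F.Y_often[OF mw, of T] by (auto simp: tg_def w'(3))
    show "g (v, (F.L0 @ m) @- z') \<in> I" using B_walk[OF b'(1) Lm] by (simp add: I_def)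
    show "g (y', z') \<in> I" using b'(1) by (simp add: I_def)
  qed
qed

lemma stream_unique:
  assumes "root y \<notin> Br" "(y, z) \<in> B" "(y, z') \<in> B" shows "z = z'"
  using assms
proof (coinduction arbitrary: y z z' rule: stream.coinduct_strong)
  case (Eq_stream y z z')
  have y: "y \<in> V" using Eq_stream(2) by (auto simp: B_def)
  show ?case
  proof (cases "\<exists>e\<in>E. r e = y")
    case True
    then obtain e where e: "e \<in> E" "r e = y" by blast
    note c = B_Cons[OF Eq_stream(2) e] B_Cons[OF Eq_stream(3) e]
    have "shd z = shd z'" using indegree[OF y Eq_stream(1)] c by blast
    moreover have "root (s (shd z)) \<notin> Br" using root_edge c(1) Eq_stream(1) by auto
    ultimately show ?thesis using c by auto
  next
    case False
    have "w = []" if "walk E r s y w (root y)" for w using that False by (cases w) auto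
    then have "z = beg (root y)" "z' = beg (root y)"
      using Eq_stream(2,3) unfolding B_def by auto fastforce+
    then show ?thesis by simp
  qed
qed

lemma munit_unforked:
  assumes y: "root y \<notin> Br" and b: "(y, z) \<in> B" and b': "(y', z') \<in> B" "root y' = root y"
  shows "munit (g (y, z)) (g (y', z')) \<in> clos"
proof -
  have V: "y \<in> V" "y' \<in> V" using b b' by (auto simp: B_def)
  obtain w where w: "walk E r s y w y'" using connected[OF V] b'(2) by auto
  have z: "z = w @- z'" by (rule stream_unique[OF y b B_walk[OF b'(1) w]])
  show ?thesis
  proof (rule munit_unique_range)
    show "g (y', z') \<in> I" using b' by (simp add: I_def)
    show "plain w (g (y, z)) (g (y', z'))"
      unfolding z
    proof (rule plain_walk[OF b'(1) w])
      fix u w' assume uw: "w = u @ w'" "w' \<noteq> []"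
      then obtain e w'' where w': "w' = e # w''" by (cases w') auto
      have "walk E r s (r e) w' y'" using w unfolding uw by (auto simp: walk_append w')
      then have "root (r e) \<notin> Br" using walk_root b'(2) y by metis
      then show "\<not> special (r (hd w'), w' @- z')" using Br by (auto simp: special_def w')
    qed
    show "i = g (y', z')" if "i \<in> I" "rng i = rng (g (y', z'))" for i
      using that(1)
    proof (rule I_cases)
      fix x t assume xt: "(x, t) \<in> B" and i: "i = g (x, t)"
      have "x = y'" using that(2) by (simp add: i g_simps[OF xt] g_simps[OF b'(1)])
      then show ?thesis using stream_unique[of y' t z'] xt b' y i by simp
    qed
  qed
qed

lemma munit_same_root:
  assumes "i \<in> I" "j \<in> I" "root (rng i) = root (rng j)"
  shows "munit i j \<in> clos"
proof -
  obtain y z where b: "(y, z) \<in> B" "i = g (y, z)" using I_cases[OF assms(1)] by blast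
  obtain y' z' where b': "(y', z') \<in> B" "j = g (y', z')" using I_cases[OF assms(2)] by blast
  have "root y' = root y" using assms(3) by (simp add: b b' g_simps[OF b(1)] g_simps[OF b'(1)])
  moreover have "root y \<in> Br \<Longrightarrow> root (root y) = root y" using Br by blast
  ultimately show ?thesis
    unfolding b(2) b'(2) using munit_forked[OF _ b(1) refl b'(1)] munit_unforked[OF _ b(1) b'(1)] by blast
qed

lemma block_diagonal_clos:
  assumes V: "V \<noteq> {}" and T: "bounded_op I T"
    and d: "\<And>i j. i \<in> I \<Longrightarrow> j \<in> I \<Longrightarrow> root (rng i) \<noteq> root (rng j) \<Longrightarrow> T (delta j) i = 0"
  shows "T \<in> clos"
proof (rule op_algebra.closure_from_matrix_units[OF op_algebra_alg[OF V] T])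
  fix i j assume "i \<in> I" "j \<in> I" "T (delta j) i \<noteq> 0"
  then show "(\<lambda>x k. x j * delta i k) \<in> clos"
    using munit_same_root d unfolding munit_def by blast
qed

lemma clos_block_diagonal:
  assumes T: "T \<in> clos" and i: "i \<in> I" and j: "j \<in> I" and ne: "root (rng i) \<noteq> root (rng j)"
  shows "T (delta j) i = 0"
proof -
  have tck: "tck_family I V E r s Sv Se" using ck by (simp add: ck_family_def)
  have "root y = root x" if "(x, y) \<in> (edge_rel V E r s)\<^sup>*" for x y
    using walk_of_rtrancl[OF that] walk_root by blast
  then have no: "(rng j, rng i) \<notin> (edge_rel V E r s)\<^sup>*" using ne by auto
  have "cmod (T (delta j) i) < \<epsilon>" if e: "\<epsilon> > 0" for \<epsilon>
  proof -
    have F: "finite {(delta j, delta i)}" "{(delta j, delta i)} \<subseteq> l2 I \<times> l2 I" using i j by auto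
    obtain C where C: "C \<in> alg"
      and d: "cmod (l2_inner I (delta i) (T (delta j)) - l2_inner I (delta i) (C (delta j))) < \<epsilon>"
      by (rule wot_closure_approx[OF T F e]) simp
    have Sj: "Sv (rng j) (delta j) = delta j" using j by (auto simp: Sv_def restr_def delta_def)
    have "Sv (rng i) (C (Sv (rng j) (delta j))) = (\<lambda>i. 0)"
      using alg_gen_reach[OF tck graph C[unfolded alg_def]] rng_V i j no by simp
    then have "Sv (rng i) (C (delta j)) i = 0" by (simp add: Sj)
    then have "C (delta j) i = 0" using i by (simp add: Sv_def restr_def)
    then show ?thesis using d i by (simp add: inner_delta_left)
  qed
  from this[of "cmod (T (delta j) i)"] show ?thesis by auto
qed

lemma self_adjoint: "self_adjoint_set I (free_semigroupoid_alg I V E Sv Se)"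
  unfolding self_adjoint_set_def free_semigroupoid_alg_def alg_def[symmetric]
proof
  fix T assume T: "T \<in> clos"
  obtain C where "C \<in> alg" by (rule wot_closure_approx[OF T, of "{}" 1]) auto
  then have V: "V \<noteq> {}" using edge_V unfolding alg_def by induction blast+
  obtain T' where T': "is_adjoint I T T'" using adjoint_exists[OF wot_closure_bounded[OF T]] by blast
  have "T' \<in> clos"
  proof (rule block_diagonal_clos[OF V adjoint_bounded(2)[OF T']])
    fix i j assume i: "i \<in> I" and j: "j \<in> I" and ne: "root (rng i) \<noteq> root (rng j)"
    have "T' (delta j) i = cnj (T (delta i) j)"
      using adjoint_inner[OF T' delta_l2[OF i] delta_l2[OF j]]
      by (simp add: inner_delta_left[OF i] inner_delta_right[OF j])
    then show "T' (delta j) i = 0" using clos_block_diagonal[OF T j i] ne by simp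
  qed
  with T' show "\<exists>T'\<in>clos. is_adjoint I T T'" by blast
qed

lemma Sv_nonzero:
  assumes v: "v \<in> V" shows "\<exists>x\<in>l2 I. Sv v x \<noteq> (\<lambda>i. 0)"
proof -
  obtain w where "walk E r s v w (root v)" using root_walk[OF v] by blast
  then have b: "(v, w @- beg (root v)) \<in> B" using v by (auto simp: B_def)
  define i where "i = g (v, w @- beg (root v))"
  have i: "i \<in> I" "rng i = v" using b by (auto simp: i_def I_def g_simps[OF b])
  then have "Sv v (delta i) i \<noteq> 0" by (simp add: Sv_def restr_def)
  then show ?thesis using delta_l2[OF i(1)] by (metis)
qed

end

section \<open>The main theorem\<close>

lemma model_exists:
  fixes V :: "'v set" and E :: "'e set" and r s :: "'e \<Rightarrow> 'v"
  assumes graph: "finite_graph V E r s"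
    and rev': "\<forall>e\<in>E. (r e, s e) \<in> (edge_rel V E r s)\<^sup>*"
  shows "\<exists>root Br e0 e1 l0 l1 Y (beg :: 'v \<Rightarrow> 'e stream).
    \<forall>g :: 'v \<times> 'e stream \<Rightarrow> 'i.
      inj_on g {(y, w @- beg (root y)) | y w. y \<in> V \<and> walk E r s y w (root y)} \<longrightarrow>
      model V E r s root Br e0 e1 l0 l1 Y beg g"
proof -
  note rev = bspec[OF rev']
  define R where "R = (edge_rel V E r s)\<^sup>*"
  have EV: "s e \<in> V" "r e \<in> V" if "e \<in> E" for e using graph that by (auto simp: finite_graph_def)
  have edge: "(s e, r e) \<in> R" "(r e, s e) \<in> R" if "e \<in> E" for e
    using rev[OF that] EV[OF that] that by (auto simp: R_def edge_rel_def)
  have R_trans: "(x, z) \<in> R" if "(x, y) \<in> R" "(y, z) \<in> R" for x y z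
    using that unfolding R_def by (rule rtrancl_trans)
  have R_refl: "(x, x) \<in> R" for x by (simp add: R_def)
  have R_sym: "(y, x) \<in> R" if "(x, y) \<in> R" for x y
    using that unfolding R_def
  proof induction
    case (step y z)
    then have "(z, y) \<in> (edge_rel V E r s)\<^sup>*" using rev by (auto simp: edge_rel_def)
    then show ?case using step.IH by (rule rtrancl_trans)
  qed simp
  have walk: "\<exists>w. walk E r s y w x" if "(x, y) \<in> R" for x y
    using walk_of_rtrancl that by (simp add: R_def)
  define br where "br w \<longleftrightarrow> (\<exists>e\<in>E. \<exists>e'\<in>E. e \<noteq> e' \<and> r e = w \<and> r e' = w)" for w
  define cls where "cls v = {w \<in> V. (v, w) \<in> R}" for v
  define pick where "pick C = (if \<exists>w\<in>C. br w then SOME w. w \<in> C \<and> br w else SOME w. w \<in> C)" for C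
  define root where "root v = pick (cls v)" for v
  have pick: "pick C \<in> C" if "C \<noteq> {}" for C
    using that someI_ex[of "\<lambda>w. w \<in> C \<and> br w"] some_in_eq[of C] by (auto simp: pick_def)
  have pick_br: "br (pick C)" if "w \<in> C" "br w" for w C
    using that someI_ex[of "\<lambda>w. w \<in> C \<and> br w"] by (auto simp: pick_def)
  have root_cls: "root v \<in> V" "(v, root v) \<in> R" if "v \<in> V" for v
    using pick[of "cls v"] that R_refl by (auto simp: root_def cls_def)
  have root_eq: "root v = root w" if "(v, w) \<in> R" for v w
  proof -
    have "cls v = cls w" using that R_sym[OF that] R_trans unfolding cls_def by blast
    then show ?thesis by (simp add: root_def)
  qed
  define Br where "Br = {v \<in> V. br v \<and> root v = v}"
  have "\<forall>v. \<exists>d. v \<in> Br \<longrightarrow> fork E r s v (fst d) (fst (snd d)) (fst (snd (snd d)))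
      (fst (snd (snd (snd d)))) (snd (snd (snd (snd d))))"
  proof
    fix v
    show "\<exists>d. v \<in> Br \<longrightarrow> fork E r s v (fst d) (fst (snd d)) (fst (snd (snd d)))
      (fst (snd (snd (snd d)))) (snd (snd (snd (snd d))))"
    proof (cases "v \<in> Br")
      case True
      then obtain e0 e1 where e: "e0 \<in> E" "e1 \<in> E" "e0 \<noteq> e1" "r e0 = v" "r e1 = v"
        by (auto simp: Br_def br_def)
      obtain l0 where l0: "walk E r s (s e0) l0 v" "\<forall>e\<in>set l0. r e \<noteq> v"
        using walk[OF edge(2)[OF e(1)]] walk_no_return e(4) by metis
      obtain l1 where l1: "walk E r s (s e1) l1 v" "\<forall>e\<in>set l1. r e \<noteq> v"
        using walk[OF edge(2)[OF e(2)]] walk_no_return e(5) by metis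
      have "finite E" using graph by (simp add: finite_graph_def)
      from exists_enumeration[OF this, of r s v] obtain Y :: "nat \<Rightarrow> 'e list" where Y: "\<forall>t. walk E r s v (Y t) v" "\<forall>t. odd t \<longrightarrow> Y t = []" "Y 0 = []"
        "\<forall>y T. walk E r s v y v \<longrightarrow> (\<exists>t\<ge>T. Y t = y)"
        by (elim exE conjE)
      have "fork E r s v e0 e1 l0 l1 Y" by unfold_locales (use e l0 l1 Y in auto)
      then show ?thesis by (intro exI[of _ "(e0, e1, l0, l1, Y)"]) simp
    qed simp
  qed
  then obtain D where D: "\<And>v. v \<in> Br \<Longrightarrow> fork E r s v (fst (D v)) (fst (snd (D v))) (fst (snd (snd (D v))))
      (fst (snd (snd (snd (D v))))) (snd (snd (snd (snd (D v)))))" by metis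
  define e0 where "e0 v = fst (D v)" for v
  define e1 where "e1 v = fst (snd (D v))" for v
  define l0 where "l0 v = fst (snd (snd (D v)))" for v
  define l1 where "l1 v = fst (snd (snd (snd (D v))))" for v
  define Y where "Y v = snd (snd (snd (snd (D v))))" for v
  have fork: "fork E r s v (e0 v) (e1 v) (l0 v) (l1 v) (Y v)" if "v \<in> Br" for v
    using D[OF that] by (simp add: e0_def e1_def l0_def l1_def Y_def)
  define beg where "beg v = (if v \<in> Br then fork.base (e0 v) (e1 v) (l0 v) (l1 v)
    else cycle (SOME w. w \<noteq> [] \<and> walk E r s v w v))" for v
  have beg_other: "\<exists>w. w \<noteq> [] \<and> walk E r s v w v \<and> beg v = w @- beg v"
    if v: "v \<notin> Br" and e: "e \<in> E" "r e = v" for v e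
  proof -
    obtain w where "walk E r s (s e) w v" using walk[OF edge(2)[OF e(1)]] e(2) by blast
    then have "\<exists>w. w \<noteq> [] \<and> walk E r s v w v" using e by (intro exI[of _ "e # w"]) simp
    then obtain w where w: "w \<noteq> []" "walk E r s v w v" "beg v = cycle w"
      using someI_ex[of "\<lambda>w. w \<noteq> [] \<and> walk E r s v w v"] v by (auto simp: beg_def)
    then show ?thesis using cycle_decomp by metis
  qed
  have "model V E r s root Br e0 e1 l0 l1 Y beg g"
    if g: "inj_on g {(y, w @- beg (root y)) | y w. y \<in> V \<and> walk E r s y w (root y)}"
    for g :: "'v \<times> 'e stream \<Rightarrow> 'i"
  proof (rule model.intro)
    show "\<exists>w. walk E r s v w (root v)" if "v \<in> V" for v using walk[OF R_sym[OF root_cls(2)[OF that]]] .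
    show "\<exists>w. walk E r s (root v) w v" if "v \<in> V" for v using walk[OF root_cls(2)[OF that]] .
    show "root (s e) = root (r e)" if "e \<in> E" for e by (rule root_eq[OF edge(1)[OF that]])
    show "beg v = fork.base (e0 v) (e1 v) (l0 v) (l1 v)" if "v \<in> Br" for v using that by (simp add: beg_def)
    show "e = e'" if v: "v \<in> V" "root v \<notin> Br" and e: "e \<in> E" "e' \<in> E" "r e = v" "r e' = v" for v e e'
    proof (rule ccontr)
      assume "e \<noteq> e'"
      then have "br v" using e by (auto simp: br_def)
      then have "br (root v)" using pick_br[of v "cls v"] v R_refl by (auto simp: root_def cls_def)
      moreover have "root (root v) = root v" using root_eq[OF root_cls(2)[OF v(1)]] by simp
      ultimately show False using v root_cls by (simp add: Br_def)
    qed
    show "v \<in> V \<and> root v = v" if "v \<in> Br" for v using that by (simp add: Br_def)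
    show "\<exists>w. w \<noteq> [] \<and> walk E r s v w v \<and> beg v = w @- beg v"
      if "v \<notin> Br" "e \<in> E" "r e = v" for v e by (rule beg_other[OF that])
  qed (fact graph fork g)+
  then show ?thesis by (intro exI allI impI)
qed

lemma countable_basis:
  assumes "finite_graph V E r s"
  shows "countable {(y, w @- beg (rt y)) | y w. y \<in> V \<and> walk E r s y w (rt y)}"
proof (rule countable_subset)
  have "countable V" "countable E" using assms by (auto simp: finite_graph_def countable_finite)
  then show "countable ((\<lambda>(y, w). (y, w @- beg (rt y))) ` (V \<times> lists E))" by auto
  show "{(y, w @- beg (rt y)) | y w. y \<in> V \<and> walk E r s y w (rt y)}
      \<subseteq> (\<lambda>(y, w). (y, w @- beg (rt y))) ` (V \<times> lists E)"
    using walk_edges by fastforce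
qed

lemma is_cycle_of_indegree:
  assumes graph: "finite_graph V E r s" and trans: "transitive_graph V E r s"
    and deg: "\<And>e e'. e \<in> E \<Longrightarrow> e' \<in> E \<Longrightarrow> r e = r e' \<Longrightarrow> e = e'"
  shows "is_cycle V E r s"
proof -
  obtain v0 where v0: "v0 \<in> V" using trans by (auto simp: transitive_graph_def)
  define p where "p v = s (THE e. e \<in> E \<and> r e = v)" for v
  have p: "p (r e) = s e" if "e \<in> E" for e
  proof -
    have "(THE e'. e' \<in> E \<and> r e' = r e) = e" using that deg by blast
    then show ?thesis by (simp add: p_def)
  qed
  have reach: "\<exists>m. 0 < m \<and> (p ^^ m) v0 = x" if "x \<in> V" for x
  proof -
    have "(x, v0) \<in> (edge_rel V E r s)\<^sup>+" using trans that v0 by (auto simp: transitive_graph_def)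
    then show ?thesis
    proof (induction rule: converse_trancl_induct)
      case (base y)
      then have "p v0 = y" using p by (auto simp: edge_rel_def)
      then show ?case by (intro exI[of _ 1]) simp
    next
      case (step y z)
      then obtain m where "0 < m" "(p ^^ m) v0 = z" by blast
      moreover have "p z = y" using step(1) p by (auto simp: edge_rel_def)
      ultimately show ?case by (intro exI[of _ "Suc m"]) simp
    qed
  qed
  define n where "n = (LEAST m. 0 < m \<and> (p ^^ m) v0 = v0)"
  have n: "0 < n" "(p ^^ n) v0 = v0"
    using LeastI_ex[OF reach[OF v0]] by (simp_all add: n_def)
  have least: "n \<le> m" if "0 < m" "(p ^^ m) v0 = v0" for m
    unfolding n_def using that by (intro Least_le) simp
  have period: "(p ^^ (m + n * k)) v0 = (p ^^ m) v0" for m k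
  proof (induction k)
    case (Suc k)
    have "m + n * Suc k = (m + n * k) + n" by simp
    then show ?case using Suc n(2) by (simp only: funpow_add o_apply)
  qed simp
  define f where "f i = (p ^^ (n - i)) v0" for i
  have pV: "p x \<in> V" if "x \<in> V" for x
  proof -
    have "(x, x) \<in> (edge_rel V E r s)\<^sup>+" using trans that by (auto simp: transitive_graph_def)
    then obtain y where "(y, x) \<in> edge_rel V E r s" by (meson tranclE)
    then show ?thesis using p by (auto simp: edge_rel_def)
  qed
  have fV: "f i \<in> V" for i
  proof -
    have "(p ^^ m) v0 \<in> V" for m by (induction m) (auto simp: v0 pV)
    then show ?thesis by (simp add: f_def)
  qed
  have pf: "p (f (Suc i mod n)) = f i" if "i < n" for i
  proof (cases "Suc i = n")
    case True
    then have "n - i = 1" by simp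
    then show ?thesis using True n by (simp add: f_def)
  next
    case False
    then have "Suc i < n" using that by simp
    then have "n - i = Suc (n - Suc i)" by simp
    then show ?thesis using \<open>Suc i < n\<close> by (simp add: f_def)
  qed
  have inj: "inj_on f {..<n}"
  proof (rule linorder_inj_onI)
    fix i j assume ij: "i < j" "i \<in> {..<n}" "j \<in> {..<n}"
    show "f i \<noteq> f j"
    proof
      assume "f i = f j"
      then have "(p ^^ i) ((p ^^ (n - i)) v0) = (p ^^ i) ((p ^^ (n - j)) v0)" by (simp add: f_def)
      then have "(p ^^ (i + (n - i))) v0 = (p ^^ (i + (n - j))) v0" by (simp add: funpow_add)
      then have "(p ^^ (i + (n - j))) v0 = v0" using ij n by simp
      then have "n \<le> i + (n - j)" using ij by (intro least) auto
      then show False using ij by auto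
    qed
  qed auto
  have surj: "V \<subseteq> f ` {..<n}"
  proof
    fix x assume "x \<in> V"
    then obtain m where m: "(p ^^ m) v0 = x" using reach by blast
    define k where "k = m mod n"
    have k: "k < n" using n by (simp add: k_def)
    have x: "(p ^^ k) v0 = x" using period[of k "m div n"] m by (simp add: k_def)
    show "x \<in> f ` {..<n}"
    proof (cases "k = 0")
      case True
      then have "f 0 = x" using x n by (simp add: f_def)
      then show ?thesis using n by blast
    next
      case False
      then have "f (n - k) = x" using x k by (simp add: f_def)
      then show ?thesis using False k by auto
    qed
  qed
  have bij: "bij_betw f {..<n} V" using inj surj fV by (auto simp: bij_betw_def)
  have shift: "\<exists>i<n. Suc i mod n = j" if "j < n" for j
  proof (cases j)
    case 0
    then show ?thesis using n by (intro exI[of _ "n - 1"]) simp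
  next
    case (Suc i)
    then show ?thesis using that by (intro exI[of _ i]) simp
  qed
  have edge: "\<exists>i<n. s e = f i \<and> r e = f (Suc i mod n)" if e: "e \<in> E" for e
  proof -
    have "r e \<in> V" using e graph by (auto simp: finite_graph_def)
    then obtain j where j: "j < n" "r e = f j" using surj by blast
    obtain i where i: "i < n" "Suc i mod n = j" using shift[OF j(1)] by blast
    have "s e = f i" using p[OF e] pf[OF i(1)] i(2) j(2) by simp
    then show ?thesis using i j by blast
  qed
  have unique: "\<exists>!e. e \<in> E \<and> s e = f i \<and> r e = f (Suc i mod n)" if i: "i < n" for i
  proof -
    have "(f (Suc i mod n), f (Suc i mod n)) \<in> (edge_rel V E r s)\<^sup>+"
      using trans fV by (auto simp: transitive_graph_def)
    then obtain y where "(y, f (Suc i mod n)) \<in> edge_rel V E r s" by (meson tranclE)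
    then obtain e where e: "e \<in> E" "r e = f (Suc i mod n)" by (auto simp: edge_rel_def)
    then have "s e = f i" using p[OF e(1)] pf[OF i] by simp
    with e deg show ?thesis by metis
  qed
  show ?thesis
    unfolding is_cycle_def using n bij edge unique by (intro exI[of _ n] exI[of _ f]) auto
qed

theorem theorem1p10:
  fixes V :: "'v set" and E :: "'e set" and r s :: "'e \<Rightarrow> 'v"
  assumes "finite_graph V E r s"
    and "infinite (UNIV :: 'i set)"
  shows "((\<exists>(I :: 'i set) Sv Se. ck_family I V E r s Sv Se \<and>
             (\<forall>v\<in>V. \<exists>x\<in>l2 I. Sv v x \<noteq> (\<lambda>i. 0)) \<and>
             self_adjoint_set I (free_semigroupoid_alg I V E Sv Se))
         \<longleftrightarrow> union_of_transitive_components V E r s)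
      \<and> (transitive_graph V E r s \<and> \<not> is_cycle V E r s \<longrightarrow>
          (\<exists>Sv Se. tck_family (UNIV :: nat set) V E r s Sv Se \<and>
             (\<forall>T. bounded_op UNIV T \<longrightarrow> T \<in> free_semigroupoid_alg UNIV V E Sv Se)))"
proof (intro conjI iffI impI)
  assume "\<exists>(I :: 'i set) Sv Se. ck_family I V E r s Sv Se \<and>
             (\<forall>v\<in>V. \<exists>x\<in>l2 I. Sv v x \<noteq> (\<lambda>i. 0)) \<and>
             self_adjoint_set I (free_semigroupoid_alg I V E Sv Se)"
  then obtain I :: "'i set" and Sv Se where ck: "ck_family I V E r s Sv Se"
    and nz: "\<forall>v\<in>V. \<exists>x\<in>l2 I. Sv v x \<noteq> (\<lambda>i. 0)"
    and sa: "self_adjoint_set I (free_semigroupoid_alg I V E Sv Se)" by blast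
  have tck: "tck_family I V E r s Sv Se" using ck by (simp add: ck_family_def)
  show "union_of_transitive_components V E r s"
    by (rule union_of_transitive_componentsI[OF assms(1) self_adjoint_reverse_path[OF tck assms(1) sa]])
       (use nz in blast)+
next
  assume "union_of_transitive_components V E r s"
  then obtain Q where Q: "\<Union>Q = V" "\<forall>W\<in>Q. transitive_on W E r s" "\<forall>e\<in>E. \<exists>W\<in>Q. s e \<in> W \<and> r e \<in> W"
    by (auto simp: union_of_transitive_components_def)
  have rev: "\<forall>e\<in>E. (r e, s e) \<in> (edge_rel V E r s)\<^sup>*"
  proof
    fix e assume e: "e \<in> E"
    obtain W where W: "W \<in> Q" "s e \<in> W" "r e \<in> W" using Q(3) e by blast
    have "(r e, s e) \<in> (edge_rel W E r s)\<^sup>*" using Q(2) W by (simp add: transitive_on_def)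
    moreover have "edge_rel W E r s \<subseteq> edge_rel V E r s" using W(1) Q(1) by (auto simp: edge_rel_def)
    ultimately show "(r e, s e) \<in> (edge_rel V E r s)\<^sup>*" using rtrancl_mono by blast
  qed
  obtain root Br e0 e1 l0 l1 Y and beg :: "'v \<Rightarrow> 'e stream" where
    M: "\<forall>g :: 'v \<times> 'e stream \<Rightarrow> 'i. inj_on g {(y, w @- beg (root y)) | y w. y \<in> V \<and> walk E r s y w (root y)}
      \<longrightarrow> model V E r s root Br e0 e1 l0 l1 Y beg g"
    using model_exists[OF assms(1) rev] by (elim exE)
  define S where "S = {(y, w @- beg (root y)) | y w. y \<in> V \<and> walk E r s y w (root y)}"
  have "countable S" unfolding S_def by (rule countable_basis[OF assms(1)])
  obtain h :: "nat \<Rightarrow> 'i" where h: "inj h" using infinite_countable_subset[OF assms(2)] by blast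
  have "inj_on (h \<circ> to_nat_on S) S"
    by (rule comp_inj_on[OF inj_on_to_nat_on[OF \<open>countable S\<close>] inj_on_subset[OF h subset_UNIV]])
  then interpret model V E r s root Br e0 e1 l0 l1 Y beg "h \<circ> to_nat_on S"
    unfolding S_def by (rule M[rule_format])
  show "\<exists>(I :: 'i set) Sv Se. ck_family I V E r s Sv Se \<and>
             (\<forall>v\<in>V. \<exists>x\<in>l2 I. Sv v x \<noteq> (\<lambda>i. 0)) \<and>
             self_adjoint_set I (free_semigroupoid_alg I V E Sv Se)"
    by (intro exI[of _ I] exI[of _ Sv] exI[of _ Se] conjI ballI ck self_adjoint Sv_nonzero)
next
  assume asm: "transitive_graph V E r s \<and> \<not> is_cycle V E r s"
  then have trans: "transitive_graph V E r s" by blast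
  have EV: "s e \<in> V" "r e \<in> V" if "e \<in> E" for e using assms(1) that by (auto simp: finite_graph_def)
  have all: "(x, y) \<in> (edge_rel V E r s)\<^sup>*" if "x \<in> V" "y \<in> V" for x y
    using trans that by (auto simp: transitive_graph_def intro: trancl_into_rtrancl)
  have rev: "\<forall>e\<in>E. (r e, s e) \<in> (edge_rel V E r s)\<^sup>*" using all EV by blast
  obtain e e' where e: "e \<in> E" "e' \<in> E" "r e = r e'" "e \<noteq> e'"
    using is_cycle_of_indegree[OF assms(1) trans] asm by blast
  obtain root Br e0 e1 l0 l1 Y and beg :: "'v \<Rightarrow> 'e stream" where
    M: "\<forall>g :: 'v \<times> 'e stream \<Rightarrow> nat. inj_on g {(y, w @- beg (root y)) | y w. y \<in> V \<and> walk E r s y w (root y)}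
      \<longrightarrow> model V E r s root Br e0 e1 l0 l1 Y beg g"
    using model_exists[OF assms(1) rev] by (elim exE)
  define S where "S = {(y, w @- beg (root y)) | y w. y \<in> V \<and> walk E r s y w (root y)}"
  have S: "countable S" unfolding S_def by (rule countable_basis[OF assms(1)])
  interpret model V E r s root Br e0 e1 l0 l1 Y beg "to_nat_on S"
    using inj_on_to_nat_on[OF S] unfolding S_def by (rule M[rule_format])
  have "root (r e) \<in> Br" using indegree[OF EV(2)[OF e(1)] _ e(1,2)] e(3,4) by metis
  then have "inj (\<lambda>k. (root (r e), sc (root (r e)) k))" "range (\<lambda>k. (root (r e), sc (root (r e)) k)) \<subseteq> S"
    using sc_inj sc_B by (auto simp: inj_def S_def B_def)
  then have "infinite S" using finite_subset range_inj_infinite by blast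
  then have "to_nat_on S ` S = UNIV" using to_nat_on_infinite[OF S] by (simp add: bij_betw_def)
  then have I: "I = UNIV" unfolding I_def B_def S_def[symmetric] .
  have V: "V \<noteq> {}" using EV e by blast
  have root: "root x = root y" if "x \<in> V" "y \<in> V" for x y
    using walk_of_rtrancl[OF all[OF that]] walk_root by metis
  have "T \<in> free_semigroupoid_alg UNIV V E Sv Se" if T: "bounded_op UNIV T" for T
    unfolding free_semigroupoid_alg_def alg_def[symmetric] I[symmetric]
    by (rule block_diagonal_clos[OF V]) (use T root rng_V in \<open>simp_all add: I\<close>)
  moreover have "tck_family UNIV V E r s Sv Se" using ck by (simp add: ck_family_def I)
  ultimately show "\<exists>Sv Se. tck_family (UNIV :: nat set) V E r s Sv Se \<and>
             (\<forall>T. bounded_op UNIV T \<longrightarrow> T \<in> free_semigroupoid_alg UNIV V E Sv Se)"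
    by (intro exI[of _ Sv] exI[of _ Se] conjI allI impI)
qed

end
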